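(* Let $R$ be a countable ring and let $\mathbf{V}_R$ be the variety of all $R$-modules. If $R$ is not weakly left-perfect, then no strong enough $\mathrm{AEC}$-covering of $(\mathcal{F}_{\mathbf{V}_R},\leq_{\ast}^{\mathrm{ff}})$ is superstable.
   Context: Rings and modules. Rings are associative and unital; $R$-modules are left modules, viewed as a variety in the language of abelian groups with a unary function symbol for each $r\in R$. $R$ is weakly left-perfect if for any sequence $(r_n:n<\omega)\in R^{\omega}$ such that for every $m<\omega$ the product $r_0\cdots r_m$ is not a zero-divisor (i.e., neither a left nor a right zero-divisor), the sequence of principal ideals $r_0\cdots r_mR$ ($m<\omega$) eventually stabilises. Free objects. Let $\mathbf{V}$ be a variety of algebras (in the sense of universal algebra) in a language $L$. $\mathcal{F}_{\mathbf{V}}$ is the class of free algebras in $\mathbf{V}$, and $\mathcal{F}^{\infty}_{\mathbf{V}}$ the class of those of infinite rank. $\ast$ denotes the free product (coproduct) in $\mathbf{V}$. $A\leq B$ means that $A$ is an $L$-substructure of $B$, and $\langle X\rangle_B$ is the substructure of $B$ generated by $X$. For $A,B\in\mathcal{F}_{\mathbf{V}}$, $A\leq_{\ast}^{\mathrm{ff}} B$ means that there is $C\in\mathcal{F}_{\mathbf{V}}$ with $A\ast C=B$ (i.e., $A,C\leq B$ and $B$ is the internal free product of $A$ and $C$). For a structure $B$ and $C\subseteq B$, $\mathrm{dcl}^{\mathrm{qf}}_B(C)$ is the quantifier-free definable closure of $C$ in $B$: the set of $b\in B$ that are the unique solution in $B$ of some quantifier-free formula with parameters in $C$. RCP. $\mathbf{V}$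 (in a countable language) satisfies the Reinforced Construction Principle $(\mathrm{RCP})$ if there are countable $A,B\in\mathcal{F}^{\infty}_{\mathbf{V}}$ with $A\leq B$ such that: (a) $A$ is freely generated by $\{a_i:i<\omega\}$ and, for every $i<\omega$, letting $A_i=\langle a_j:j\leq i\rangle_B$, we have $A_i\leq_{\ast}^{\mathrm{ff}}B$; (b) $A\not\leq_{\ast}^{\mathrm{ff}}B\ast C$ for every $C\in\mathcal{F}_{\mathbf{V}}$; (c) $B$ is freely generated by $\{b_i:i<\omega\}$ and $\mathrm{dcl}^{\mathrm{qf}}_B(A b_0)=B$. AECs. A class $\mathcal{K}$ of $L$-structures with a binary relation $\preccurlyeq$ is an abstract elementary class (AEC) if: (1) $\mathcal{K}$ and $\preccurlyeq$ are closed under isomorphism; (2) $A\preccurlyeq B$ implies $A\leq B$; (3) $\preccurlyeq$ is a partial order on $\mathcal{K}$; (4) if $(A_i)_{i<\delta}$ is an increasing continuous $\preccurlyeq$-chain in $\mathcal{K}$, then $\bigcup_{i<\delta}A_i\in\mathcal{K}$, $A_j\preccurlyeq\bigcup_{i<\delta}A_i$ for each $j<\delta$, and if $A_i\preccurlyeq B$ for all $i<\delta$ then $\bigcup_{i<\delta}A_i\preccurlyeq B$; (5) if $A,B,C\in\mathcal{K}$, $A\preccurlyeq C$, $B\preccurlyeq C$ and $A\leq B$, then $A\preccurlyeq B$; (6) there is a cardinal $\mathrm{LS}(\mathcal{K},\preccurlyeq)\geq|L|+\aleph_0$ such that if $A\in\mathcal{K}$ and $B\subseteq A$, there is $C\in\mathcal{K}$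 with $B\subseteq C\preccurlyeq A$ and $|C|\leq|B|+\mathrm{LS}(\mathcal{K},\preccurlyeq)$. An embedding $f:A\to B$ is strong if $f(A)\preccurlyeq B$. AP and JEP are the amalgamation and joint embedding properties with respect to strong embeddings. AEC-covering. $(\mathcal{K},\preccurlyeq)$ is an $\mathrm{AEC}$-covering of $(\mathcal{F}_{\mathbf{V}},\leq_{\ast}^{\mathrm{ff}})$ if: $\mathcal{F}^{\infty}_{\mathbf{V}}\subseteq\mathcal{K}$; $(\mathcal{K},\preccurlyeq)$ is an AEC; for $A,B\in\mathcal{F}_{\mathbf{V}}\cap\mathcal{K}$, $A\leq_{\ast}^{\mathrm{ff}}B$ implies $A\preccurlyeq B$; and $(\mathcal{K},\preccurlyeq)$ has AP and JEP. Monster model, types, stability. $B\in\mathcal{K}$ is $(\kappa,\preccurlyeq)$-universal if every $C\in\mathcal{K}$ with $|C|\leq\kappa$ strongly embeds in $B$; it is $(\kappa,\preccurlyeq)$-homogeneous if every isomorphism between strong substructures $A_0,A_1\preccurlyeq B$ of size $<\kappa$ extends to an automorphism of $B$. Given AP and JEP, such models exist for all $\kappa\geq\mathrm{LS}(\mathcal{K},\preccurlyeq)$; the monster model $\mathfrak{M}$ is a $(\kappa,\preccurlyeq)$-homogeneous and $(\kappa,\preccurlyeq)$-universal model for some large enough $\kappa$. For $B\preccurlyeq\mathfrak{M}$ of size $<\kappa$, the Galois type $\mathrm{tp}(a/B)$ of $a\in\mathfrak{M}$ is the orbit of $a$ under the automorphisms of $\mathfrak{M}$ fixing $B$ pointwise,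 and $S(B)$ is the set of Galois types over $B$. $(\mathcal{K},\preccurlyeq)$ is $\lambda$-stable if $|S(B)|\leq\lambda$ for every $B\preccurlyeq\mathfrak{M}$ with $|B|=\lambda$; it is superstable if it is $\lambda$-stable for all sufficiently large $\lambda$. Strong enough. The covering $(\mathcal{K},\preccurlyeq)$ of $(\mathcal{F}_{\mathbf{V}},\leq_{\ast}^{\mathrm{ff}})$ is strong enough if: (i) whenever $A,B,C\in\mathcal{F}^{\infty}_{\mathbf{V}}$ and $A\preccurlyeq B$, then $A\ast C\preccurlyeq B\ast C$; (ii) if $A$ and $B$ (with $b_0$) are as in $(\mathrm{RCP})$ and $B\preccurlyeq M\in\mathcal{K}$, then $\mathrm{dcl}^{\mathrm{qf}}_B(Ab_0)=\mathrm{dcl}^{\mathrm{qf}}_M(Ab_0)$; (iii) if $A$ and $B$ (with $b_0$) are as in $(\mathrm{RCP})$, with $B\preccurlyeq\mathfrak{M}$, and $f$ is an automorphism of the monster model $\mathfrak{M}$ fixing $A$ pointwise, then $\mathrm{dcl}^{\mathrm{qf}}_{\mathfrak{M}}(Ab_0)=\mathrm{dcl}^{\mathrm{qf}}_{\mathfrak{M}}(Af(b_0))$.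
   Formalization: dcl^qf is taken as all entries of finite tuples that are the unique solution of a quantifier-free formula; with single-element solutions only, the claim fails for R = F_2<x,y>. Classes of structures live in a universe of strongly inaccessible size. *)

theory Defs
  imports "HOL-Library.FuncSet" "HOL-Library.Countable_Set"
begin

unbundle cardinal_syntax

section \<open>The universe of sets\<close>

text \<open>
  Classes of structures of unbounded cardinality are taken inside a type \<open>'u\<close> that plays the
  role of the universe of sets. The hypothesis \<open>inaccessible\<close> says that \<open>'u\<close> has strongly
  inaccessible cardinality; sets of smaller cardinality are the sets of the theory, arbitrary
  collections are its classes, and cardinals are the cardinal orders below \<open>|UNIV|\<close>.
\<close>

definition inaccessible :: "'u itself \<Rightarrow> bool" where
  "inaccessible _ \<longleftrightarrow>
     natLeq <o |UNIV :: 'u set| \<and> regularCard |UNIV :: 'u set| \<and>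
     (\<forall>X :: 'u set. |X| <o |UNIV :: 'u set| \<longrightarrow> |Pow X| <o |UNIV :: 'u set| )"

definition small_card :: "'u rel \<Rightarrow> bool" where
  "small_card \<kappa> \<longleftrightarrow> Card_order \<kappa> \<and> \<kappa> <o |UNIV :: 'u set|"


section \<open>Structures in a functional language\<close>

text \<open>
  A language is a type \<open>'f\<close> of function symbols with an arity function. Operations are undefined
  outside their domain, so that equality of structures is genuine equality.
\<close>

record ('f, 'u) struc =
  univ :: "'u set"
  opn :: "'f \<Rightarrow> 'u list \<Rightarrow> 'u"

definition closed_under :: "('f \<Rightarrow> nat) \<Rightarrow> ('f, 'u) struc \<Rightarrow> 'u set \<Rightarrow> bool" where
  "closed_under ar M X \<longleftrightarrow>
     (\<forall>f xs. set xs \<subseteq> X \<and> length xs = ar f \<longrightarrow> opn M f xs \<in> X)"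

definition structures :: "('f \<Rightarrow> nat) \<Rightarrow> ('f, 'u) struc set" where
  "structures ar = {M. |univ M| <o |UNIV :: 'u set| \<and> closed_under ar M (univ M) \<and>
     (\<forall>f xs. \<not> (set xs \<subseteq> univ M \<and> length xs = ar f) \<longrightarrow> opn M f xs = undefined)}"

definition substructure :: "('f \<Rightarrow> nat) \<Rightarrow> ('f, 'u) struc \<Rightarrow> ('f, 'u) struc \<Rightarrow> bool" where
  "substructure ar A B \<longleftrightarrow> A \<in> structures ar \<and> B \<in> structures ar \<and> univ A \<subseteq> univ B \<and>
     (\<forall>f xs. set xs \<subseteq> univ A \<and> length xs = ar f \<longrightarrow> opn A f xs = opn B f xs)"

definition restr :: "('f \<Rightarrow> nat) \<Rightarrow> ('f, 'u) struc \<Rightarrow> 'u set \<Rightarrow> ('f, 'u) struc" where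
  "restr ar M X = \<lparr>univ = X,
     opn = (\<lambda>f xs. if set xs \<subseteq> X \<and> length xs = ar f then opn M f xs else undefined)\<rparr>"

definition generated :: "('f \<Rightarrow> nat) \<Rightarrow> ('f, 'u) struc \<Rightarrow> 'u set \<Rightarrow> ('f, 'u) struc" where
  "generated ar M X = restr ar M (\<Inter>{Y. X \<subseteq> Y \<and> Y \<subseteq> univ M \<and> closed_under ar M Y})"

definition homs :: "('f \<Rightarrow> nat) \<Rightarrow> ('f, 'u) struc \<Rightarrow> ('f, 'u) struc \<Rightarrow> ('u \<Rightarrow> 'u) set" where
  "homs ar A B = {h \<in> univ A \<rightarrow>\<^sub>E univ B.
     \<forall>f xs. set xs \<subseteq> univ A \<and> length xs = ar f \<longrightarrow> h (opn A f xs) = opn B f (map h xs)}"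

definition isos :: "('f \<Rightarrow> nat) \<Rightarrow> ('f, 'u) struc \<Rightarrow> ('f, 'u) struc \<Rightarrow> ('u \<Rightarrow> 'u) set" where
  "isos ar A B = {h \<in> homs ar A B. bij_betw h (univ A) (univ B)}"

definition auts :: "('f \<Rightarrow> nat) \<Rightarrow> ('f, 'u) struc \<Rightarrow> ('u \<Rightarrow> 'u) set" where
  "auts ar M = isos ar M M"


section \<open>Quantifier-free definable closure\<close>

datatype ('f, 'u) trm = Var nat | Par 'u | App 'f "('f, 'u) trm list"

datatype ('f, 'u) qf = Eq "('f, 'u) trm" "('f, 'u) trm" | Neg "('f, 'u) qf"
  | Conj "('f, 'u) qf" "('f, 'u) qf"

text \<open>
  \<open>trm_over ar n C\<close> and \<open>qf_over ar n C\<close> are the terms and formulas with free variables among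
  \<open>Var 0, \<dots>, Var (n - 1)\<close> and parameters in \<open>C\<close>.
\<close>

inductive_set trm_over :: "('f \<Rightarrow> nat) \<Rightarrow> nat \<Rightarrow> 'u set \<Rightarrow> ('f, 'u) trm set"
  for ar :: "'f \<Rightarrow> nat" and n :: nat and C :: "'u set" where
  "i < n \<Longrightarrow> Var i \<in> trm_over ar n C"
| "c \<in> C \<Longrightarrow> Par c \<in> trm_over ar n C"
| "length ts = ar f \<Longrightarrow> (\<And>t. t \<in> set ts \<Longrightarrow> t \<in> trm_over ar n C) \<Longrightarrow> App f ts \<in> trm_over ar n C"

primrec qf_over :: "('f \<Rightarrow> nat) \<Rightarrow> nat \<Rightarrow> 'u set \<Rightarrow> ('f, 'u) qf \<Rightarrow> bool" where
  "qf_over ar n C (Eq s t) \<longleftrightarrow> s \<in> trm_over ar n C \<and> t \<in> trm_over ar n C"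
| "qf_over ar n C (Neg \<phi>) \<longleftrightarrow> qf_over ar n C \<phi>"
| "qf_over ar n C (Conj \<phi> \<psi>) \<longleftrightarrow> qf_over ar n C \<phi> \<and> qf_over ar n C \<psi>"

primrec trm_val :: "('f, 'u) struc \<Rightarrow> 'u list \<Rightarrow> ('f, 'u) trm \<Rightarrow> 'u" where
  "trm_val M xs (Var i) = xs ! i"
| "trm_val M xs (Par c) = c"
| "trm_val M xs (App f ts) = opn M f (map (trm_val M xs) ts)"

primrec qf_sat :: "('f, 'u) struc \<Rightarrow> 'u list \<Rightarrow> ('f, 'u) qf \<Rightarrow> bool" where
  "qf_sat M xs (Eq s t) \<longleftrightarrow> trm_val M xs s = trm_val M xs t"
| "qf_sat M xs (Neg \<phi>) \<longleftrightarrow> \<not> qf_sat M xs \<phi>"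
| "qf_sat M xs (Conj \<phi> \<psi>) \<longleftrightarrow> qf_sat M xs \<phi> \<and> qf_sat M xs \<psi>"

text \<open>
  Formulas may have several free variables: a finite tuple is definable over \<open>C\<close> if it is the
  unique solution of a quantifier-free formula over \<open>C\<close>, and \<open>dcl_qf\<close> collects the entries of
  such tuples. This is an idempotent operator containing the unique solutions of formulas in one
  variable. The latter alone are not closed under the operations of the structure: in free left
  modules over a free algebra in \<open>x, y\<close> over a field, \<open>b\<close> is the unique solution of \<open>x b = c\<close>, but
  \<open>y b\<close> satisfies no nontrivial linear equation over \<open>c\<close>. With one variable only, clause (c) of
  the Reinforced Construction Principle below could not be met over such a ring.
\<close>

definition dcl_qf :: "('f \<Rightarrow> nat) \<Rightarrow> ('f, 'u) struc \<Rightarrow> 'u set \<Rightarrow> 'u set" where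
  "dcl_qf ar M C = {b. \<exists>n \<phi> bs. qf_over ar n C \<phi> \<and>
     {xs. length xs = n \<and> set xs \<subseteq> univ M \<and> qf_sat M xs \<phi>} = {bs} \<and> b \<in> set bs}"


section \<open>Free algebras and free products in a class of algebras\<close>

definition free_on ::
  "('f \<Rightarrow> nat) \<Rightarrow> ('f, 'u) struc set \<Rightarrow> ('f, 'u) struc \<Rightarrow> 'u set \<Rightarrow> bool" where
  "free_on ar V F X \<longleftrightarrow> F \<in> V \<and> X \<subseteq> univ F \<and> generated ar F X = F \<and>
     (\<forall>N \<in> V. \<forall>g \<in> X \<rightarrow> univ N. \<exists>h \<in> homs ar F N. \<forall>x \<in> X. h x = g x)"

definition free_algs :: "('f \<Rightarrow> nat) \<Rightarrow> ('f, 'u) struc set \<Rightarrow> ('f, 'u) struc set" where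
  "free_algs ar V = {F. \<exists>X. free_on ar V F X}"

definition free_algs_inf :: "('f \<Rightarrow> nat) \<Rightarrow> ('f, 'u) struc set \<Rightarrow> ('f, 'u) struc set" where
  "free_algs_inf ar V = {F. \<exists>X. infinite X \<and> free_on ar V F X}"

text \<open>\<open>free_prod ar V A C B\<close>: \<open>B\<close> is the internal free product of \<open>A\<close> and \<open>C\<close>.\<close>

definition free_prod :: "('f \<Rightarrow> nat) \<Rightarrow> ('f, 'u) struc set \<Rightarrow>
    ('f, 'u) struc \<Rightarrow> ('f, 'u) struc \<Rightarrow> ('f, 'u) struc \<Rightarrow> bool" where
  "free_prod ar V A C B \<longleftrightarrow> A \<in> V \<and> C \<in> V \<and> B \<in> V \<and> substructure ar A B \<and> substructure ar C B \<and>
     (\<forall>N \<in> V. \<forall>f \<in> homs ar A N. \<forall>g \<in> homs ar C N.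
        \<exists>!h. h \<in> homs ar B N \<and> (\<forall>x \<in> univ A. h x = f x) \<and> (\<forall>x \<in> univ C. h x = g x))"

definition ff_le ::
  "('f \<Rightarrow> nat) \<Rightarrow> ('f, 'u) struc set \<Rightarrow> ('f, 'u) struc \<Rightarrow> ('f, 'u) struc \<Rightarrow> bool" where
  "ff_le ar V A B \<longleftrightarrow> A \<in> free_algs ar V \<and> B \<in> free_algs ar V \<and>
     (\<exists>C \<in> free_algs ar V. free_prod ar V A C B)"


section \<open>The Reinforced Construction Principle\<close>

text \<open>\<open>A\<close> and \<open>B\<close>, together with \<open>b\<^sub>0\<close>, witness (RCP) for \<open>V\<close>.\<close>

definition RCP_pair :: "('f \<Rightarrow> nat) \<Rightarrow> ('f, 'u) struc set \<Rightarrow>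
    ('f, 'u) struc \<Rightarrow> ('f, 'u) struc \<Rightarrow> 'u \<Rightarrow> bool" where
  "RCP_pair ar V A B b\<^sub>0 \<longleftrightarrow>
     A \<in> free_algs_inf ar V \<and> B \<in> free_algs_inf ar V \<and>
     countable (univ A) \<and> countable (univ B) \<and> substructure ar A B \<and>
     (\<exists>a :: nat \<Rightarrow> 'u. inj a \<and> free_on ar V A (range a) \<and>
        (\<forall>i. ff_le ar V (generated ar B (a ` {..i})) B)) \<and>
     (\<forall>C D. C \<in> free_algs ar V \<and> free_prod ar V B C D \<longrightarrow> \<not> ff_le ar V A D) \<and>
     (\<exists>b :: nat \<Rightarrow> 'u. inj b \<and> free_on ar V B (range b) \<and> b 0 = b\<^sub>0 \<and>
        dcl_qf ar B (univ A \<union> {b\<^sub>0}) = univ B)"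


section \<open>Abstract elementary classes\<close>

definition is_union ::
  "('f \<Rightarrow> nat) \<Rightarrow> 'i set \<Rightarrow> ('i \<Rightarrow> ('f, 'u) struc) \<Rightarrow> ('f, 'u) struc \<Rightarrow> bool" where
  "is_union ar I A U \<longleftrightarrow> U \<in> structures ar \<and> univ U = (\<Union>i \<in> I. univ (A i)) \<and>
     (\<forall>i \<in> I. substructure ar (A i) U)"

definition limit_point :: "'i rel \<Rightarrow> 'i \<Rightarrow> bool" where
  "limit_point r i \<longleftrightarrow> i \<in> Field r \<and> underS r i \<noteq> {} \<and>
     (\<forall>j \<in> underS r i. \<exists>k \<in> underS r i. j \<in> underS r k)"

text \<open>The index ordinal of a chain is given as a well-order \<open>r\<close> on a small nonempty set.\<close>

definition cont_chain :: "('f \<Rightarrow> nat) \<Rightarrow> ('f, 'u) struc set \<Rightarrow>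
    (('f, 'u) struc \<Rightarrow> ('f, 'u) struc \<Rightarrow> bool) \<Rightarrow> 'u rel \<Rightarrow> ('u \<Rightarrow> ('f, 'u) struc) \<Rightarrow> bool" where
  "cont_chain ar K le r A \<longleftrightarrow>
     Well_order r \<and> Field r \<noteq> {} \<and> |Field r| <o |UNIV :: 'u set| \<and>
     (\<forall>i \<in> Field r. A i \<in> K) \<and> (\<forall>(i, j) \<in> r. le (A i) (A j)) \<and>
     (\<forall>i. limit_point r i \<longrightarrow> is_union ar (underS r i) A (A i))"

definition iso_closed :: "('f \<Rightarrow> nat) \<Rightarrow> ('f, 'u) struc set \<Rightarrow>
    (('f, 'u) struc \<Rightarrow> ('f, 'u) struc \<Rightarrow> bool) \<Rightarrow> bool" where
  "iso_closed ar K le \<longleftrightarrow>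
     (\<forall>A \<in> K. \<forall>B \<in> structures ar. isos ar A B \<noteq> {} \<longrightarrow> B \<in> K) \<and>
     (\<forall>A B B' f. le A B \<and> B' \<in> structures ar \<and> f \<in> isos ar B B' \<longrightarrow>
        le (restr ar B' (f ` univ A)) B')"

definition AEC :: "('f \<Rightarrow> nat) \<Rightarrow> ('f, 'u) struc set \<Rightarrow>
    (('f, 'u) struc \<Rightarrow> ('f, 'u) struc \<Rightarrow> bool) \<Rightarrow> bool" where
  "AEC ar K le \<longleftrightarrow>
     K \<subseteq> structures ar \<and> (\<forall>A B. le A B \<longrightarrow> A \<in> K \<and> B \<in> K) \<and>
     iso_closed ar K le \<and>
     (\<forall>A B. le A B \<longrightarrow> substructure ar A B) \<and>
     reflp_on K le \<and> antisymp_on K le \<and> transp_on K le \<and>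
     (\<forall>r A U. cont_chain ar K le r A \<and> is_union ar (Field r) A U \<longrightarrow>
        U \<in> K \<and> (\<forall>j \<in> Field r. le (A j) U) \<and>
        (\<forall>B \<in> K. (\<forall>i \<in> Field r. le (A i) B) \<longrightarrow> le U B)) \<and>
     (\<forall>A B C. le A C \<and> le B C \<and> substructure ar A B \<longrightarrow> le A B) \<and>
     (\<exists>LS :: 'u rel. small_card LS \<and> |UNIV :: 'f set| +c natLeq \<le>o LS \<and>
        (\<forall>A \<in> K. \<forall>X \<subseteq> univ A.
           \<exists>C. X \<subseteq> univ C \<and> le C A \<and> |univ C| \<le>o |X| +c LS))"

definition strong_embs :: "('f \<Rightarrow> nat) \<Rightarrow> (('f, 'u) struc \<Rightarrow> ('f, 'u) struc \<Rightarrow> bool) \<Rightarrow>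
    ('f, 'u) struc \<Rightarrow> ('f, 'u) struc \<Rightarrow> ('u \<Rightarrow> 'u) set" where
  "strong_embs ar le A B =
     {f \<in> homs ar A B. inj_on f (univ A) \<and> le (restr ar B (f ` univ A)) B}"

definition amalgamation :: "('f \<Rightarrow> nat) \<Rightarrow> ('f, 'u) struc set \<Rightarrow>
    (('f, 'u) struc \<Rightarrow> ('f, 'u) struc \<Rightarrow> bool) \<Rightarrow> bool" where
  "amalgamation ar K le \<longleftrightarrow>
     (\<forall>A \<in> K. \<forall>B \<in> K. \<forall>C \<in> K. \<forall>f \<in> strong_embs ar le A B. \<forall>g \<in> strong_embs ar le A C.
        \<exists>D \<in> K. \<exists>f' \<in> strong_embs ar le B D. \<exists>g' \<in> strong_embs ar le C D.
          \<forall>x \<in> univ A. f' (f x) = g' (g x))"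

definition joint_embedding :: "('f \<Rightarrow> nat) \<Rightarrow> ('f, 'u) struc set \<Rightarrow>
    (('f, 'u) struc \<Rightarrow> ('f, 'u) struc \<Rightarrow> bool) \<Rightarrow> bool" where
  "joint_embedding ar K le \<longleftrightarrow>
     (\<forall>B \<in> K. \<forall>C \<in> K. \<exists>D \<in> K. strong_embs ar le B D \<noteq> {} \<and> strong_embs ar le C D \<noteq> {})"

definition AEC_covering :: "('f \<Rightarrow> nat) \<Rightarrow> ('f, 'u) struc set \<Rightarrow> ('f, 'u) struc set \<Rightarrow>
    (('f, 'u) struc \<Rightarrow> ('f, 'u) struc \<Rightarrow> bool) \<Rightarrow> bool" where
  "AEC_covering ar V K le \<longleftrightarrow>
     free_algs_inf ar V \<subseteq> K \<and> AEC ar K le \<and>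
     (\<forall>A \<in> free_algs ar V \<inter> K. \<forall>B \<in> free_algs ar V \<inter> K. ff_le ar V A B \<longrightarrow> le A B) \<and>
     amalgamation ar K le \<and> joint_embedding ar K le"


section \<open>Monster models, Galois types and superstability\<close>

definition universal_model :: "('f \<Rightarrow> nat) \<Rightarrow> ('f, 'u) struc set \<Rightarrow>
    (('f, 'u) struc \<Rightarrow> ('f, 'u) struc \<Rightarrow> bool) \<Rightarrow> 'u rel \<Rightarrow> ('f, 'u) struc \<Rightarrow> bool" where
  "universal_model ar K le \<kappa> M \<longleftrightarrow>
     M \<in> K \<and> (\<forall>C \<in> K. |univ C| \<le>o \<kappa> \<longrightarrow> strong_embs ar le C M \<noteq> {})"

definition homogeneous_model :: "('f \<Rightarrow> nat) \<Rightarrow> ('f, 'u) struc set \<Rightarrow>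
    (('f, 'u) struc \<Rightarrow> ('f, 'u) struc \<Rightarrow> bool) \<Rightarrow> 'u rel \<Rightarrow> ('f, 'u) struc \<Rightarrow> bool" where
  "homogeneous_model ar K le \<kappa> M \<longleftrightarrow>
     M \<in> K \<and> (\<forall>A\<^sub>0 A\<^sub>1. le A\<^sub>0 M \<and> le A\<^sub>1 M \<and> |univ A\<^sub>0| <o \<kappa> \<and> |univ A\<^sub>1| <o \<kappa> \<longrightarrow>
        (\<forall>f \<in> isos ar A\<^sub>0 A\<^sub>1. \<exists>g \<in> auts ar M. \<forall>x \<in> univ A\<^sub>0. g x = f x))"

definition monster :: "('f \<Rightarrow> nat) \<Rightarrow> ('f, 'u) struc set \<Rightarrow>
    (('f, 'u) struc \<Rightarrow> ('f, 'u) struc \<Rightarrow> bool) \<Rightarrow> 'u rel \<Rightarrow> ('f, 'u) struc \<Rightarrow> bool" where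
  "monster ar K le \<kappa> M \<longleftrightarrow> small_card \<kappa> \<and>
     homogeneous_model ar K le \<kappa> M \<and> universal_model ar K le \<kappa> M"

definition galois_type ::
  "('f \<Rightarrow> nat) \<Rightarrow> ('f, 'u) struc \<Rightarrow> ('f, 'u) struc \<Rightarrow> 'u \<Rightarrow> 'u set" where
  "galois_type ar M B a = {f a | f. f \<in> auts ar M \<and> (\<forall>x \<in> univ B. f x = x)}"

definition galois_types ::
  "('f \<Rightarrow> nat) \<Rightarrow> ('f, 'u) struc \<Rightarrow> ('f, 'u) struc \<Rightarrow> 'u set set" where
  "galois_types ar M B = galois_type ar M B ` univ M"

text \<open>
  Galois types over a base of size \<open>\<mu>\<close> are computed in a monster model for some \<open>\<kappa> > \<mu>\<close>; such
  models exist by the amalgamation and joint embedding properties, and by universality and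
  homogeneity the number of types does not depend on the choice.
\<close>

definition stable_in :: "('f \<Rightarrow> nat) \<Rightarrow> ('f, 'u) struc set \<Rightarrow>
    (('f, 'u) struc \<Rightarrow> ('f, 'u) struc \<Rightarrow> bool) \<Rightarrow> 'u rel \<Rightarrow> bool" where
  "stable_in ar K le \<mu> \<longleftrightarrow>
     (\<exists>\<kappa> M. \<mu> <o \<kappa> \<and> monster ar K le \<kappa> M \<and>
        (\<forall>B. le B M \<and> |univ B| =o \<mu> \<longrightarrow> |galois_types ar M B| \<le>o \<mu>))"

definition superstable :: "('f \<Rightarrow> nat) \<Rightarrow> ('f, 'u) struc set \<Rightarrow>
    (('f, 'u) struc \<Rightarrow> ('f, 'u) struc \<Rightarrow> bool) \<Rightarrow> bool" where
  "superstable ar K le \<longleftrightarrow>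
     (\<exists>\<mu>\<^sub>0 :: 'u rel. small_card \<mu>\<^sub>0 \<and>
        (\<forall>\<mu> :: 'u rel. small_card \<mu> \<and> \<mu>\<^sub>0 \<le>o \<mu> \<longrightarrow> stable_in ar K le \<mu>))"


section \<open>Strong enough coverings\<close>

text \<open>
  In the first clause \<open>E\<close> and \<open>D\<close> are the free products of \<open>C\<close> with \<open>A\<close> and with \<open>B\<close>, and \<open>h\<close> is
  the canonical map between them.
\<close>

definition strong_enough :: "('f \<Rightarrow> nat) \<Rightarrow> ('f, 'u) struc set \<Rightarrow> ('f, 'u) struc set \<Rightarrow>
    (('f, 'u) struc \<Rightarrow> ('f, 'u) struc \<Rightarrow> bool) \<Rightarrow> bool" where
  "strong_enough ar V K le \<longleftrightarrow>
     (\<forall>A B C D E h.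
        A \<in> free_algs_inf ar V \<and> B \<in> free_algs_inf ar V \<and> C \<in> free_algs_inf ar V \<and> le A B \<and>
        free_prod ar V A C E \<and> free_prod ar V B C D \<and>
        h \<in> homs ar E D \<and> (\<forall>x \<in> univ A \<union> univ C. h x = x) \<longrightarrow>
        h \<in> strong_embs ar le E D) \<and>
     (\<forall>A B b\<^sub>0 M. RCP_pair ar V A B b\<^sub>0 \<and> le B M \<longrightarrow>
        dcl_qf ar B (univ A \<union> {b\<^sub>0}) = dcl_qf ar M (univ A \<union> {b\<^sub>0})) \<and>
     (\<exists>\<kappa>\<^sub>0 :: 'u rel. small_card \<kappa>\<^sub>0 \<and>
        (\<forall>\<kappa> M A B b\<^sub>0 f. \<kappa>\<^sub>0 \<le>o \<kappa> \<and> monster ar K le \<kappa> M \<and> RCP_pair ar V A B b\<^sub>0 \<and> le B M \<and>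
           f \<in> auts ar M \<and> (\<forall>x \<in> univ A. f x = x) \<longrightarrow>
           dcl_qf ar M (univ A \<union> {b\<^sub>0}) = dcl_qf ar M (univ A \<union> {f b\<^sub>0})))"


section \<open>Modules over a ring\<close>

text \<open>
  Associative unital rings are types of sort \<open>{ring, monoid_mult}\<close>; unlike \<open>ring_1\<close>, this sort does
  not exclude the zero ring.
\<close>

datatype 'r mod_sym = Zero | Plus | Minus | Scale 'r

primrec mod_ar :: "'r mod_sym \<Rightarrow> nat" where
  "mod_ar Zero = 0"
| "mod_ar Plus = 2"
| "mod_ar Minus = 1"
| "mod_ar (Scale r) = 1"

definition modules :: "('r :: {ring, monoid_mult} mod_sym, 'u) struc set" where
  "modules = {M \<in> structures mod_ar.
     (\<forall>x \<in> univ M. \<forall>y \<in> univ M. \<forall>z \<in> univ M.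
        opn M Plus [opn M Plus [x, y], z] = opn M Plus [x, opn M Plus [y, z]]) \<and>
     (\<forall>x \<in> univ M. \<forall>y \<in> univ M. opn M Plus [x, y] = opn M Plus [y, x]) \<and>
     (\<forall>x \<in> univ M. opn M Plus [opn M Zero [], x] = x) \<and>
     (\<forall>x \<in> univ M. opn M Plus [opn M Minus [x], x] = opn M Zero []) \<and>
     (\<forall>r. \<forall>x \<in> univ M. \<forall>y \<in> univ M. opn M (Scale r) [opn M Plus [x, y]] =
        opn M Plus [opn M (Scale r) [x], opn M (Scale r) [y]]) \<and>
     (\<forall>r s. \<forall>x \<in> univ M. opn M (Scale (r + s)) [x] =
        opn M Plus [opn M (Scale r) [x], opn M (Scale s) [x]]) \<and>
     (\<forall>r s. \<forall>x \<in> univ M. opn M (Scale (r * s)) [x] = opn M (Scale r) [opn M (Scale s) [x]]) \<and>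
     (\<forall>x \<in> univ M. opn M (Scale 1) [x] = x)}"

definition zero_divisor :: "'r :: {ring, monoid_mult} \<Rightarrow> bool" where
  "zero_divisor a \<longleftrightarrow> (\<exists>b. b \<noteq> 0 \<and> a * b = 0) \<or> (\<exists>b. b \<noteq> 0 \<and> b * a = 0)"

definition weakly_left_perfect :: "'r :: {ring, monoid_mult} itself \<Rightarrow> bool" where
  "weakly_left_perfect _ \<longleftrightarrow>
     (\<forall>r :: nat \<Rightarrow> 'r. (\<forall>m. \<not> zero_divisor (prod_list (map r [0..<Suc m]))) \<longrightarrow>
        (\<exists>k. \<forall>m \<ge> k. range ((*) (prod_list (map r [0..<Suc m]))) =
                       range ((*) (prod_list (map r [0..<Suc k])))))"

end

theory Submission
  imports Defs "HOL-Algebra.FiniteProduct"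
begin

text \<open>
  Let \<open>r\<close> witness that \<open>R\<close> is not weakly left perfect. In a free module \<open>F\<close> with a sequence \<open>s\<close> of
  basis elements, let \<open>h\<close> send \<open>s i\<close> to \<open>s i - r i s (i + 1)\<close> and fix the other basis elements. It is
  injective, and agrees on any finite set of basis elements with an automorphism of \<open>F\<close>, a product of
  transvections. If the basis is countable, \<open>h F\<close>, \<open>F\<close>, \<open>s 0\<close> satisfy (RCP): \<open>s (i + 1)\<close> is the only
  solution of \<open>h (s i) = s i - r i x\<close>, and a retraction onto \<open>h F\<close> would make almost all \<open>r j\<close> right
  invertible. If infinitely many basis elements lie off \<open>s\<close>, then \<open>h F\<close> is the union of an \<open>\<omega>\<close>-chain of
  free factors of \<open>F\<close> of infinite rank, hence strong in \<open>F\<close>.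

  Now let the basis of \<open>F\<close> be the tree of finite sequences in a set \<open>U\<close> with more branches than
  elements, and place \<open>F\<close> in the monster. Every branch \<open>p\<close> has its map \<open>h p\<close>, which extends to an
  automorphism \<open>g p\<close> of the monster; let \<open>g p\<close> send \<open>b p\<close> to the root. Suppose \<open>b p\<close> and \<open>b q\<close> have the
  same type over \<open>F\<close>, where \<open>p \<noteq> q\<close>, and let \<open>B\<close> be spanned by the two branches. Being strong enough
  forces \<open>k = g p \<circ> (g q)\<inverse>\<close> to map \<open>B\<close> into itself. As \<open>k \<circ> h q = h p\<close> on \<open>B\<close>, the coordinates of the
  \<open>k\<close>-image of the branch \<open>q\<close> yield right inverses of almost all \<open>r j\<close> once more.
\<close>

section \<open>Substructures and homomorphisms\<close>

text \<open>Isolates the intersection inside \<open>generated\<close>, so that the carrier can be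
  treated apart from the operations cut down to it.\<close>

definition span :: "('f \<Rightarrow> nat) \<Rightarrow> ('f, 'u) struc \<Rightarrow> 'u set \<Rightarrow> 'u set" where
  "span ar M X = \<Inter>{Y. X \<subseteq> Y \<and> Y \<subseteq> univ M \<and> closed_under ar M Y}"

lemma generated_span: "generated ar M X = restr ar M (span ar M X)"
  by (simp add: generated_def span_def)

lemma univ_restr [simp]: "univ (restr ar M X) = X"
  by (simp add: restr_def)

lemma opn_restr: "set xs \<subseteq> X \<Longrightarrow> length xs = ar f \<Longrightarrow> opn (restr ar M X) f xs = opn M f xs"
  by (simp add: restr_def)

lemma univ_generated: "univ (generated ar M X) = span ar M X"
  by (simp add: generated_span)

lemma closed_underD:
  "closed_under ar M X \<Longrightarrow> set xs \<subseteq> X \<Longrightarrow> length xs = ar f \<Longrightarrow> opn M f xs \<in> X"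
  by (auto simp: closed_under_def)

lemma structures_closed: "M \<in> structures ar \<Longrightarrow> closed_under ar M (univ M)"
  by (simp add: structures_def)

lemma structures_opn:
  "M \<in> structures ar \<Longrightarrow> set xs \<subseteq> univ M \<Longrightarrow> length xs = ar f \<Longrightarrow> opn M f xs \<in> univ M"
  by (rule closed_underD[OF structures_closed])

lemma substructureD:
  assumes "substructure ar A B"
  shows "A \<in> structures ar" "B \<in> structures ar" "univ A \<subseteq> univ B"
    "\<And>f xs. set xs \<subseteq> univ A \<Longrightarrow> length xs = ar f \<Longrightarrow> opn A f xs = opn B f xs"
  using assms by (auto simp: substructure_def)

lemma structures_card: "M \<in> structures ar \<Longrightarrow> |univ M| <o |UNIV :: 'u set|"
  for M :: "('f, 'u) struc"
  by (simp add: structures_def)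

text \<open>Structures have \<open>undefined\<close> operations outside their domain, so agreement
  on arguments from the carrier is already equality.\<close>

lemma struct_eqI:
  assumes "A \<in> structures ar" "B \<in> structures ar" "univ A = univ B"
    "\<And>f xs. set xs \<subseteq> univ A \<Longrightarrow> length xs = ar f \<Longrightarrow> opn A f xs = opn B f xs"
  shows "A = B"
proof -
  have "opn A f xs = opn B f xs" for f xs
    using assms by (cases "set xs \<subseteq> univ A \<and> length xs = ar f") (auto simp: structures_def)
  then have "opn A = opn B" by blast
  with assms(3) show ?thesis by simp
qed

lemma span_superset: "X \<subseteq> span ar M X"
  by (auto simp: span_def)

lemma span_minimal: "X \<subseteq> Y \<Longrightarrow> Y \<subseteq> univ M \<Longrightarrow> closed_under ar M Y \<Longrightarrow> span ar M X \<subseteq> Y"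
  by (auto simp: span_def)

lemma span_subset_univ: "M \<in> structures ar \<Longrightarrow> X \<subseteq> univ M \<Longrightarrow> span ar M X \<subseteq> univ M"
  by (rule span_minimal) (auto simp: structures_closed)

lemma closed_under_span: "M \<in> structures ar \<Longrightarrow> closed_under ar M (span ar M X)"
  unfolding closed_under_def[of ar M "span ar M X"]
  by (auto simp: span_def subset_eq intro!: closed_underD)

lemma span_mono:
  "M \<in> structures ar \<Longrightarrow> X \<subseteq> span ar M Y \<Longrightarrow> Y \<subseteq> univ M \<Longrightarrow> span ar M X \<subseteq> span ar M Y"
  by (rule span_minimal) (auto simp: closed_under_span dest: span_subset_univ)

lemma restr_structures:
  assumes "M \<in> structures ar" "X \<subseteq> univ M" "closed_under ar M X"
  shows "restr ar M X \<in> structures ar"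
proof -
  have "|X| <o |UNIV :: 'b set|"
    using card_of_mono1[OF assms(2)] structures_card[OF assms(1)] by (rule ordLeq_ordLess_trans)
  then show ?thesis
    using assms(3) by (auto simp: structures_def restr_def closed_under_def)
qed

lemma substructure_restr:
  assumes "M \<in> structures ar" "X \<subseteq> univ M" "closed_under ar M X"
  shows "substructure ar (restr ar M X) M"
  using assms restr_structures[OF assms] by (auto simp: substructure_def opn_restr)

lemma substructure_generated:
  "M \<in> structures ar \<Longrightarrow> X \<subseteq> univ M \<Longrightarrow> substructure ar (generated ar M X) M"
  unfolding generated_span
  by (intro substructure_restr span_subset_univ closed_under_span)

lemma restr_univ: "M \<in> structures ar \<Longrightarrow> restr ar M (univ M) = M"
  by (rule struct_eqI[where ar = ar])
    (auto simp: structures_closed opn_restr intro: restr_structures)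

lemma substructure_closed: "substructure ar A B \<Longrightarrow> closed_under ar B (univ A)"
  by (auto simp: substructure_def structures_def closed_under_def)

lemma substructure_eq_restr:
  assumes "substructure ar A B"
  shows "A = restr ar B (univ A)"
  using assms substructure_closed[OF assms]
  by (intro struct_eqI[where ar = ar]) (auto simp: substructure_def opn_restr intro: restr_structures)

lemma restr_restr: "Y \<subseteq> X \<Longrightarrow> restr ar (restr ar M X) Y = restr ar M Y"
  by (auto simp: restr_def fun_eq_iff)

lemma closed_under_restr: "Y \<subseteq> X \<Longrightarrow> closed_under ar (restr ar M X) Y \<longleftrightarrow> closed_under ar M Y"
  unfolding closed_under_def restr_def by auto

text \<open>In one direction a closed subset \<open>Y\<close> of \<open>M\<close> is traced on
  \<open>X\<close>: \<open>X \<inter> Y\<close> is again closed, and it competes in the smaller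
  structure.\<close>

lemma span_restr:
  assumes "closed_under ar M X" "X \<subseteq> univ M" "Z \<subseteq> X"
  shows "span ar (restr ar M X) Z = span ar M Z"
proof
  show "span ar (restr ar M X) Z \<subseteq> span ar M Z"
  proof
    fix v assume v: "v \<in> span ar (restr ar M X) Z"
    show "v \<in> span ar M Z" unfolding span_def
    proof (rule InterI)
      fix Y assume "Y \<in> {Y. Z \<subseteq> Y \<and> Y \<subseteq> univ M \<and> closed_under ar M Y}"
      then have "Z \<subseteq> X \<inter> Y" "closed_under ar M (X \<inter> Y)"
        using assms(1,3) by (auto simp: closed_under_def)
      then have "X \<inter> Y \<in> {Y. Z \<subseteq> Y \<and> Y \<subseteq> univ (restr ar M X) \<and> closed_under ar (restr ar M X) Y}"
        by (simp add: closed_under_restr)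
      then have "v \<in> X \<inter> Y" using v unfolding span_def by (rule InterD[rotated])
      then show "v \<in> Y" by simp
    qed
  qed
  show "span ar M Z \<subseteq> span ar (restr ar M X) Z"
    using assms by (auto simp: span_def closed_under_restr)
qed

lemma generated_restr:
  assumes "M \<in> structures ar" "closed_under ar M X" "X \<subseteq> univ M" "Z \<subseteq> X"
  shows "generated ar (restr ar M X) Z = generated ar M Z"
  using assms span_minimal[of Z X M ar]
  by (simp add: generated_span span_restr restr_restr)

lemma generated_eqD: "generated ar M X = M \<Longrightarrow> span ar M X = univ M"
  by (metis univ_generated)

lemma generated_eqI: "M \<in> structures ar \<Longrightarrow> span ar M X = univ M \<Longrightarrow> generated ar M X = M"
  by (simp add: generated_span restr_univ)

section \<open>Homomorphisms, images and isomorphisms\<close>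

lemma homs_closed: "h \<in> homs ar A B \<Longrightarrow> x \<in> univ A \<Longrightarrow> h x \<in> univ B"
  by (auto simp: homs_def)

lemma homs_opn:
  "h \<in> homs ar A B \<Longrightarrow> set xs \<subseteq> univ A \<Longrightarrow> length xs = ar f \<Longrightarrow> h (opn A f xs) = opn B f (map h xs)"
  by (auto simp: homs_def)

lemma homs_ext:
  "h \<in> homs ar A B \<Longrightarrow> k \<in> homs ar A C \<Longrightarrow> (\<And>x. x \<in> univ A \<Longrightarrow> h x = k x) \<Longrightarrow> h = k"
  unfolding homs_def by (auto intro: PiE_ext)

lemma homs_id: "substructure ar A B \<Longrightarrow> restrict id (univ A) \<in> homs ar A B"
  using substructure_closed[of ar A B]
  by (auto simp: homs_def substructure_def closed_under_def subset_eq map_idI)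

lemma homs_comp:
  assumes "h \<in> homs ar A B" "k \<in> homs ar B C" "A \<in> structures ar"
  shows "restrict (k \<circ> h) (univ A) \<in> homs ar A C"
proof -
  have "restrict (k \<circ> h) (univ A) (opn A f xs) = opn C f (map (restrict (k \<circ> h) (univ A)) xs)"
    if "set xs \<subseteq> univ A" "length xs = ar f" for f xs
  proof -
    have m: "set (map h xs) \<subseteq> univ B" using that assms by (auto simp: homs_def)
    have e: "map (restrict (k \<circ> h) (univ A)) xs = map k (map h xs)"
      using that by (auto simp: subset_eq)
    have "opn A f xs \<in> univ A"
      using that assms(3) by (auto intro: closed_underD structures_closed)
    then show ?thesis
      using that m homs_opn[OF assms(1)] homs_opn[OF assms(2) m] unfolding e by simp
  qed
  then show ?thesis using assms by (auto simp: homs_def)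
qed

lemma homs_restrict:
  assumes "h \<in> homs ar A B" "substructure ar A' A"
  shows "restrict h (univ A') \<in> homs ar A' B"
proof -
  have sub: "univ A' \<subseteq> univ A" using assms by (auto simp: substructure_def)
  have "opn A' f xs \<in> univ A'" "opn A' f xs = opn A f xs"
    "map (restrict h (univ A')) xs = map h xs"
    if "set xs \<subseteq> univ A'" "length xs = ar f" for f xs
    using that substructureD[OF assms(2)] structures_opn[of A' ar xs f] by auto
  then have "restrict h (univ A') (opn A' f xs) = opn B f (map (restrict h (univ A')) xs)"
    if "set xs \<subseteq> univ A'" "length xs = ar f" for f xs
    using that sub homs_opn[OF assms(1), of xs f] by (metis restrict_apply' subset_trans)
  then show ?thesis using sub homs_closed[OF assms(1)] by (auto simp: homs_def simp del: restrict_apply)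
qed

lemma homs_codomain:
  assumes "h \<in> homs ar A B" "h ` univ A \<subseteq> Y"
  shows "h \<in> homs ar A (restr ar B Y)"
proof -
  have "opn (restr ar B Y) f (map h xs) = opn B f (map h xs)"
    if "set xs \<subseteq> univ A" "length xs = ar f" for f xs
    using that assms by (intro opn_restr) auto
  then show ?thesis using assms by (auto simp: homs_def)
qed

text \<open>The set on which two homomorphisms agree is closed under the operations, so it contains
  the span of \<open>X\<close>.\<close>

lemma homs_eq_on_span:
  assumes "h \<in> homs ar A B" "k \<in> homs ar A C" "A \<in> structures ar" "X \<subseteq> univ A"
    "\<And>x. x \<in> X \<Longrightarrow> h x = k x"
    "\<And>f xs. set xs \<subseteq> univ B \<inter> univ C \<Longrightarrow> length xs = ar f \<Longrightarrow> opn B f xs = opn C f xs"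
    "x \<in> span ar A X"
  shows "h x = k x"
proof -
  let ?Y = "{x \<in> univ A. h x = k x}"
  have "closed_under ar A ?Y" unfolding closed_under_def
  proof (intro allI impI)
    fix f xs assume a: "set xs \<subseteq> ?Y \<and> length xs = ar f"
    then have "set xs \<subseteq> univ A" "length xs = ar f" by auto
    moreover from a have m: "map h xs = map k xs" by auto
    moreover from a have "set (map h xs) \<subseteq> univ B \<inter> univ C"
      using homs_closed[OF assms(1)] homs_closed[OF assms(2)] by auto
    ultimately show "opn A f xs \<in> ?Y"
      using assms(6)[of "map k xs" f] homs_opn[OF assms(1), of xs f] homs_opn[OF assms(2), of xs f]
        structures_opn[OF assms(3), of xs f]
      unfolding m by simp
  qed
  then have "span ar A X \<subseteq> ?Y" using assms by (intro span_minimal) auto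
  with assms(7) show ?thesis by auto
qed

lemma homs_image_closed:
  assumes "h \<in> homs ar A B" "closed_under ar A Y" "Y \<subseteq> univ A"
  shows "closed_under ar B (h ` Y)"
  unfolding closed_under_def
proof (intro allI impI)
  fix f xs assume a: "set xs \<subseteq> h ` Y \<and> length xs = ar f"
  then have "xs \<in> lists (h ` Y)" by auto
  then obtain ys where ys: "xs = map h ys" "ys \<in> lists Y" by (auto simp: lists_image)
  then have "opn A f ys \<in> Y" using a assms by (intro closed_underD) auto
  moreover have "h (opn A f ys) = opn B f xs"
    using a ys assms by (auto simp: homs_opn subset_eq)
  ultimately show "opn B f xs \<in> h ` Y" by (metis image_eqI)
qed

text \<open>Two minimality arguments: the preimage of a closed set is closed, and so is the image of
  a closed set.\<close>

lemma homs_image_span: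
  assumes "h \<in> homs ar A B" "A \<in> structures ar" "B \<in> structures ar" "X \<subseteq> univ A"
  shows "h ` span ar A X = span ar B (h ` X)"
proof
  let ?Y = "{x \<in> univ A. h x \<in> span ar B (h ` X)}"
  have "closed_under ar A ?Y" unfolding closed_under_def
  proof (intro allI impI)
    fix f xs assume a: "set xs \<subseteq> ?Y \<and> length xs = ar f"
    then have "set (map h xs) \<subseteq> span ar B (h ` X)" by auto
    then have "opn B f (map h xs) \<in> span ar B (h ` X)"
      using a assms(3) by (intro closed_underD[OF closed_under_span]) auto
    then show "opn A f xs \<in> ?Y"
      using a homs_opn[OF assms(1), of xs f] closed_underD[OF structures_closed[OF assms(2)], of xs f]
      by fastforce
  qed
  then have "span ar A X \<subseteq> ?Y"
    using assms(4) span_superset[of "h ` X" ar B] by (intro span_minimal) auto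
  then show "h ` span ar A X \<subseteq> span ar B (h ` X)" by auto
  show "span ar B (h ` X) \<subseteq> h ` span ar A X"
  proof (rule span_minimal)
    show "h ` X \<subseteq> h ` span ar A X" using span_superset[of X ar A] by auto
    show "h ` span ar A X \<subseteq> univ B"
      using span_subset_univ[OF assms(2,4)] homs_closed[OF assms(1)] by auto
    show "closed_under ar B (h ` span ar A X)"
      by (rule homs_image_closed[OF assms(1) closed_under_span[OF assms(2)] span_subset_univ[OF assms(2,4)]])
  qed
qed

lemma isosD: "h \<in> isos ar A B \<Longrightarrow> h \<in> homs ar A B" "h \<in> isos ar A B \<Longrightarrow> bij_betw h (univ A) (univ B)"
  by (auto simp: isos_def)

lemma isos_inverse:
  assumes "h \<in> isos ar A B" "A \<in> structures ar" "B \<in> structures ar"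
  shows "restrict (inv_into (univ A) h) (univ B) \<in> isos ar B A"
proof -
  let ?g = "restrict (inv_into (univ A) h) (univ B)"
  have bij: "bij_betw ?g (univ B) (univ A)"
    using bij_betw_inv_into[OF isosD(2)[OF assms(1)]] by (simp cong: bij_betw_cong)
  have hg: "h (?g y) = y" "?g y \<in> univ A" if "y \<in> univ B" for y
    using that isosD(2)[OF assms(1)] bij
    by (auto simp: bij_betw_inv_into_right bij_betw_def)
  have gh: "?g (h x) = x" if "x \<in> univ A" for x
    using that isosD(2)[OF assms(1)] bij_betwE[OF isosD(2)[OF assms(1)]]
    by (simp add: bij_betw_inv_into_left)
  have "?g (opn B f ys) = opn A f (map ?g ys)" if "set ys \<subseteq> univ B" "length ys = ar f" for f ys
  proof -
    have s: "set (map ?g ys) \<subseteq> univ A" using that hg by (auto simp del: restrict_apply)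
    have "h (opn A f (map ?g ys)) = opn B f (map h (map ?g ys))"
      using that s by (intro homs_opn[OF isosD(1)[OF assms(1)]]) auto
    also have "map h (map ?g ys) = ys"
      using that hg by (auto simp: subset_eq simp del: restrict_apply intro: map_idI)
    finally show ?thesis
      using gh[of "opn A f (map ?g ys)"] that structures_opn[OF assms(2) s, of f]
      by (simp only: length_map)
  qed
  then show ?thesis using bij by (auto simp: isos_def homs_def bij_betw_def)
qed

lemma inj_homs_iso_image:
  assumes "h \<in> homs ar A B" "inj_on h (univ A)"
  shows "h \<in> isos ar A (restr ar B (h ` univ A))"
  using assms by (auto simp: isos_def bij_betw_def intro: homs_codomain)

section \<open>Modules\<close>

abbreviation pl :: "('r mod_sym, 'u) struc \<Rightarrow> 'u \<Rightarrow> 'u \<Rightarrow> 'u" where "pl M x y \<equiv> opn M Plus [x, y]"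
abbreviation zr :: "('r mod_sym, 'u) struc \<Rightarrow> 'u" where "zr M \<equiv> opn M Zero []"
abbreviation ng :: "('r mod_sym, 'u) struc \<Rightarrow> 'u \<Rightarrow> 'u" where "ng M x \<equiv> opn M Minus [x]"
abbreviation sc :: "('r mod_sym, 'u) struc \<Rightarrow> 'r \<Rightarrow> 'u \<Rightarrow> 'u" where "sc M r x \<equiv> opn M (Scale r) [x]"

text \<open>Turns quantification over symbols and argument lists into one case for each kind of
  module operation.\<close>

lemma length_mod_ar_cases:
  assumes "length xs = mod_ar f"
  obtains "f = Zero" "xs = []" | x y where "f = Plus" "xs = [x, y]"
    | x where "f = Minus" "xs = [x]" | r x where "f = Scale r" "xs = [x]"
  using assms by (cases f; cases xs; cases "tl xs") auto

lemma closed_under_mod_iff: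
  "closed_under mod_ar M X \<longleftrightarrow> zr M \<in> X \<and> (\<forall>x\<in>X. \<forall>y\<in>X. pl M x y \<in> X) \<and>
     (\<forall>x\<in>X. ng M x \<in> X) \<and> (\<forall>r. \<forall>x\<in>X. sc M r x \<in> X)" (is "_ \<longleftrightarrow> ?R")
proof
  assume c: "closed_under mod_ar M X"
  show ?R
    using closed_underD[OF c, of "[]" Zero] closed_underD[OF c, of "[_, _]" Plus]
      closed_underD[OF c, of "[_]" Minus] closed_underD[OF c, of "[_]" "Scale _"]
    by auto
next
  assume ?R
  then show "closed_under mod_ar M X"
    unfolding closed_under_def by (auto elim!: length_mod_ar_cases)
qed

lemma homs_mod_iff:
  "h \<in> homs mod_ar A B \<longleftrightarrow> h \<in> univ A \<rightarrow>\<^sub>E univ B \<and> h (zr A) = zr B \<and>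
     (\<forall>x\<in>univ A. \<forall>y\<in>univ A. h (pl A x y) = pl B (h x) (h y)) \<and>
     (\<forall>x\<in>univ A. h (ng A x) = ng B (h x)) \<and> (\<forall>r. \<forall>x\<in>univ A. h (sc A r x) = sc B r (h x))"
  (is "_ \<longleftrightarrow> ?R")
proof
  assume c: "h \<in> homs mod_ar A B"
  show ?R
    using homs_opn[OF c, of "[]" Zero] homs_opn[OF c, of "[_, _]" Plus]
      homs_opn[OF c, of "[_]" Minus] homs_opn[OF c, of "[_]" "Scale _"] c
    by (auto simp: homs_def)
next
  assume ?R
  then show "h \<in> homs mod_ar A B"
    unfolding homs_def by (auto elim!: length_mod_ar_cases)
qed

lemma homs_mod:
  assumes "h \<in> homs mod_ar A B"
  shows "h (zr A) = zr B"
    "x \<in> univ A \<Longrightarrow> y \<in> univ A \<Longrightarrow> h (pl A x y) = pl B (h x) (h y)"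
    "x \<in> univ A \<Longrightarrow> h (ng A x) = ng B (h x)"
    "x \<in> univ A \<Longrightarrow> h (sc A r x) = sc B r (h x)"
  using assms by (auto simp: homs_mod_iff)

lemma modules_structures: "M \<in> modules \<Longrightarrow> M \<in> structures mod_ar"
  by (simp add: modules_def)

lemma modules_closed:
  assumes "M \<in> modules"
  shows "zr M \<in> univ M" "x \<in> univ M \<Longrightarrow> y \<in> univ M \<Longrightarrow> pl M x y \<in> univ M"
    "x \<in> univ M \<Longrightarrow> ng M x \<in> univ M" "x \<in> univ M \<Longrightarrow> sc M r x \<in> univ M"
  using structures_closed[OF modules_structures[OF assms]] by (auto simp: closed_under_mod_iff)

text \<open>The module axioms are universally quantified equations, so every instance over the
  closed set \<open>X\<close> is an instance over \<open>M\<close>.\<close>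

lemma modules_restr:
  assumes "M \<in> modules" "X \<subseteq> univ M" "closed_under mod_ar M X"
  shows "restr mod_ar M X \<in> modules"
proof -
  let ?N = "restr mod_ar M X"
  have e: "zr ?N = zr M" "\<And>x y. x \<in> X \<Longrightarrow> y \<in> X \<Longrightarrow> pl ?N x y = pl M x y"
    "\<And>x. x \<in> X \<Longrightarrow> ng ?N x = ng M x" "\<And>r x. x \<in> X \<Longrightarrow> sc ?N r x = sc M r x"
    by (simp_all add: opn_restr)
  have c: "zr M \<in> X" "\<And>x y. x \<in> X \<Longrightarrow> y \<in> X \<Longrightarrow> pl M x y \<in> X"
    "\<And>x. x \<in> X \<Longrightarrow> ng M x \<in> X" "\<And>r x. x \<in> X \<Longrightarrow> sc M r x \<in> X"
    using assms(3) by (auto simp: closed_under_mod_iff)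
  have s: "?N \<in> structures mod_ar"
    using assms by (intro restr_structures modules_structures)
  show ?thesis
    unfolding modules_def mem_Collect_eq
    by (simp add: e c s del: ball_simps) (insert assms(1,2), unfold modules_def, blast)
qed

lemma modules_generated: "M \<in> modules \<Longrightarrow> X \<subseteq> univ M \<Longrightarrow> generated mod_ar M X \<in> modules"
  unfolding generated_span
  by (intro modules_restr span_subset_univ closed_under_span modules_structures)

lemma modules_isos:
  assumes "A \<in> modules" "B \<in> structures mod_ar" "h \<in> isos mod_ar A B"
  shows "B \<in> modules"
proof -
  have im: "univ B = h ` univ A" using isosD(2)[OF assms(3)] by (auto simp: bij_betw_def)
  note hm = homs_mod[OF isosD(1)[OF assms(3)]]
  note cl = modules_closed[OF assms(1)]
  show ?thesis
    unfolding modules_def mem_Collect_eq im ball_simps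
    using assms(1,2)
    by (simp add: hm[symmetric] cl) (simp add: modules_def)
qed

text \<open>Makes \<open>finprod\<close> available for finite sums in a module; they are needed to
  extend maps from a basis.\<close>

definition add_group :: "('r mod_sym, 'u) struc \<Rightarrow> 'u monoid" where
  "add_group M = \<lparr>carrier = univ M, monoid.mult = pl M, one = zr M\<rparr>"

lemma add_group_simps [simp]: "carrier (add_group M) = univ M" "monoid.mult (add_group M) = pl M"
  "one (add_group M) = zr M"
  by (simp_all add: add_group_def)

lemma comm_group_add_group:
  assumes "M \<in> modules"
  shows "comm_group (add_group M)"
proof (rule comm_groupI)
  fix x assume "x \<in> carrier (add_group M)"
  then show "\<exists>y\<in>carrier (add_group M). y \<otimes>\<^bsub>add_group M\<^esub> x = \<one>\<^bsub>add_group M\<^esub>"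
    using assms by (intro bexI[of _ "ng M x"]) (auto simp: modules_closed, simp add: modules_def)
qed (use assms in \<open>auto simp: modules_closed\<close>, (simp_all add: modules_def))

lemma mod_laws:
  assumes "M \<in> modules" "x \<in> univ M" "y \<in> univ M"
  shows mod_comm: "pl M x y = pl M y x" and mod_zero: "pl M (zr M) x = x" "pl M x (zr M) = x"
    and mod_neg: "pl M (ng M x) x = zr M" "pl M x (ng M x) = zr M"
    and mod_scale: "sc M r (pl M x y) = pl M (sc M r x) (sc M r y)"
      "sc M (r + s) x = pl M (sc M r x) (sc M s x)" "sc M (r * s) x = sc M r (sc M s x)" "sc M 1 x = x"
proof -
  show "pl M x y = pl M y x" "pl M (zr M) x = x" "pl M (ng M x) x = zr M"
      "sc M r (pl M x y) = pl M (sc M r x) (sc M r y)"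
      "sc M (r + s) x = pl M (sc M r x) (sc M s x)" "sc M (r * s) x = sc M r (sc M s x)" "sc M 1 x = x"
    using assms by (simp_all add: modules_def)
  show "pl M x (zr M) = x" "pl M x (ng M x) = zr M"
    using assms modules_closed[OF assms(1)] unfolding modules_def mem_Collect_eq by metis+
qed

lemma mod_assoc:
  "M \<in> modules \<Longrightarrow> x \<in> univ M \<Longrightarrow> y \<in> univ M \<Longrightarrow> z \<in> univ M \<Longrightarrow> pl M (pl M x y) z = pl M x (pl M y z)"
  by (simp add: modules_def)

lemma mod_idem_zero:
  assumes "M \<in> modules" "x \<in> univ M" "pl M x x = x"
  shows "x = zr M"
proof -
  have "pl M (ng M x) (pl M x x) = pl M (pl M (ng M x) x) x"
    using assms by (simp add: mod_assoc modules_closed)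
  then show ?thesis using assms by (simp add: mod_neg mod_zero)
qed

lemma mod_zero_scale:
  assumes "M \<in> modules"
  shows "sc M r (zr M) = zr M" "ng M (zr M) = zr M" "x \<in> univ M \<Longrightarrow> sc M 0 x = zr M"
proof -
  note z = modules_closed[OF assms]
  show "sc M r (zr M) = zr M"
    using mod_scale(1)[OF assms z(1) z(1), of r] mod_zero[OF assms z(1) z(1)] z
    by (intro mod_idem_zero[OF assms]) auto
  show "ng M (zr M) = zr M"
    using mod_neg(1)[OF assms z(1) z(1)] mod_zero[OF assms z(3)[OF z(1)] z(1)] by simp
  show "sc M 0 x = zr M" if "x \<in> univ M"
    using mod_scale(2)[OF assms that that, of 0 0] z(4)[OF that]
    by (intro mod_idem_zero[OF assms]) auto
qed

lemma mod_neg_eq: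
  assumes "M \<in> modules" "x \<in> univ M" "y \<in> univ M" "pl M x y = zr M"
  shows "y = ng M x"
proof -
  have "pl M (ng M x) (pl M x y) = pl M (pl M (ng M x) x) y"
    using assms by (simp add: mod_assoc modules_closed)
  then show ?thesis using assms by (simp add: mod_neg mod_zero modules_closed)
qed

lemma mod_scale_neg:
  assumes "M \<in> modules" "x \<in> univ M"
  shows "sc M (- r) x = ng M (sc M r x)" "sc M r (ng M x) = ng M (sc M r x)"
proof -
  show "sc M (- r) x = ng M (sc M r x)"
    using mod_scale(2)[OF assms assms(2), of r "- r"] assms
    by (intro mod_neg_eq) (auto simp: modules_closed mod_zero_scale)
  show "sc M r (ng M x) = ng M (sc M r x)"
    using mod_scale(1)[OF assms modules_closed(3)[OF assms], of r] assms
    by (intro mod_neg_eq) (auto simp: modules_closed mod_zero_scale mod_neg)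
qed

lemma mod_add_diff:
  assumes "M \<in> modules" "x \<in> univ M" "y \<in> univ M"
  shows "pl M (pl M x y) (ng M y) = x" "pl M (pl M x (ng M y)) y = x"
  using assms by (simp_all add: mod_assoc mod_neg mod_zero modules_closed)

lemma zero_hom:
  assumes "A \<in> modules" "B \<in> modules"
  shows "(\<lambda>x\<in>univ A. zr B) \<in> homs mod_ar A B"
  using assms mod_zero(1)[OF assms(2) modules_closed(1)[OF assms(2)] modules_closed(1)[OF assms(2)]]
  by (auto simp: homs_mod_iff modules_closed mod_zero_scale)

section \<open>Free modules and free factors\<close>

lemma free_onD:
  assumes "free_on mod_ar modules F X"
  shows "F \<in> modules" "F \<in> structures mod_ar" "X \<subseteq> univ F" "span mod_ar F X = univ F"
  using assms by (auto simp: free_on_def dest: generated_eqD modules_structures)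

lemma free_on_extend:
  assumes "free_on mod_ar modules F X" "N \<in> modules" "\<And>x. x \<in> X \<Longrightarrow> g x \<in> univ N"
  obtains h where "h \<in> homs mod_ar F N" "\<And>x. x \<in> X \<Longrightarrow> h x = g x"
  using assms unfolding free_on_def by (metis Pi_I)

lemma homs_eq_on_free:
  assumes "free_on mod_ar modules F X" "h \<in> homs mod_ar F N" "k \<in> homs mod_ar F N"
    "\<And>x. x \<in> X \<Longrightarrow> h x = k x" "x \<in> univ F"
  shows "h x = k x"
  using homs_eq_on_span[OF assms(2,3) free_onD(2,3)[OF assms(1)] assms(4), of x] assms(5)
    free_onD(4)[OF assms(1)] by simp

lemma free_onI:
  assumes "F \<in> modules" "X \<subseteq> univ F" "span mod_ar F X = univ F"
    "\<And>N g. N \<in> modules \<Longrightarrow> (\<And>x. x \<in> X \<Longrightarrow> g x \<in> univ N) \<Longrightarrow> \<exists>h\<in>homs mod_ar F N. \<forall>x\<in>X. h x = g x"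
  shows "free_on mod_ar modules F X"
  using assms by (auto simp: free_on_def Pi_iff intro!: generated_eqI modules_structures)

text \<open>A map on \<open>Z\<close> is extended by zero to the rest of the basis, then to
  \<open>F\<close>, and restricted back.\<close>

lemma free_on_generated:
  assumes "free_on mod_ar modules F X" "Z \<subseteq> X"
  shows "free_on mod_ar modules (generated mod_ar F Z) Z"
proof (rule free_onI)
  note F = free_onD[OF assms(1)]
  have Z: "Z \<subseteq> univ F" using F assms(2) by auto
  show "generated mod_ar F Z \<in> modules" using F Z by (intro modules_generated)
  show "Z \<subseteq> univ (generated mod_ar F Z)" by (simp add: univ_generated span_superset)
  show "span mod_ar (generated mod_ar F Z) Z = univ (generated mod_ar F Z)"
    unfolding generated_span using F(2) Z
    by (simp add: span_restr closed_under_span span_subset_univ span_superset)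
  fix N :: "('a mod_sym, 'b) struc" and g assume N: "N \<in> modules" "\<And>x. x \<in> Z \<Longrightarrow> g x \<in> univ N"
  obtain h where h: "h \<in> homs mod_ar F N" "\<And>x. x \<in> X \<Longrightarrow> h x = (if x \<in> Z then g x else zr N)"
    by (rule free_on_extend[OF assms(1) N(1), of "\<lambda>x. if x \<in> Z then g x else zr N"])
      (auto simp: N modules_closed)
  have "restrict h (univ (generated mod_ar F Z)) \<in> homs mod_ar (generated mod_ar F Z) N"
    by (intro homs_restrict[OF h(1)] substructure_generated F Z)
  moreover have "x \<in> univ (generated mod_ar F Z)" if "x \<in> Z" for x
    using that span_superset[of Z mod_ar F] by (auto simp: univ_generated)
  ultimately show "\<exists>h\<in>homs mod_ar (generated mod_ar F Z) N. \<forall>x\<in>Z. h x = g x"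
    using h(2) assms(2) by (intro bexI) (auto simp: subset_iff)
qed

lemma free_on_isos:
  assumes "free_on mod_ar modules F X" "h \<in> isos mod_ar F G" "G \<in> structures mod_ar"
  shows "free_on mod_ar modules G (h ` X)"
proof (rule free_onI)
  note F = free_onD[OF assms(1)]
  note h = isosD[OF assms(2)]
  show "G \<in> modules" using F(1) assms(3,2) by (rule modules_isos)
  show "h ` X \<subseteq> univ G" using homs_closed[OF h(1)] F(3) by auto
  show "span mod_ar G (h ` X) = univ G"
    using homs_image_span[OF h(1) F(2) assms(3) F(3)] F(4) h(2) by (simp add: bij_betw_def)
  fix N :: "('a mod_sym, 'b) struc" and g assume N: "N \<in> modules" "\<And>x. x \<in> h ` X \<Longrightarrow> g x \<in> univ N"
  obtain k where k: "k \<in> homs mod_ar F N" "\<And>x. x \<in> X \<Longrightarrow> k x = g (h x)"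
    using free_on_extend[OF assms(1) N(1), of "\<lambda>x. g (h x)"] N by auto
  let ?i = "restrict (inv_into (univ F) h) (univ G)"
  have i: "?i \<in> homs mod_ar G F"
    by (intro isosD isos_inverse assms F)
  have "?i (h x) = x" "h x \<in> univ G" if "x \<in> X" for x
    using that F(3) h(2) by (auto simp: bij_betw_def subset_iff)
  then show "\<exists>h'\<in>homs mod_ar G N. \<forall>x\<in>h ` X. h' x = g x"
    using homs_comp[OF i k(1) assms(3)] k(2) by (intro bexI) (auto simp del: restrict_apply simp: restrict_apply')
qed

text \<open>The complementary factor is generated by the remaining basis elements
  \<open>X - Z\<close>.\<close>

lemma ff_le_generated:
  assumes "free_on mod_ar modules F X" "Z \<subseteq> X"
  shows "ff_le mod_ar modules (generated mod_ar F Z) F"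
proof -
  let ?A = "generated mod_ar F Z" and ?C = "generated mod_ar F (X - Z)"
  note F = free_onD[OF assms(1)]
  have A: "free_on mod_ar modules ?A Z" and C: "free_on mod_ar modules ?C (X - Z)"
    using assms by (auto intro: free_on_generated)
  have sA: "substructure mod_ar ?A F" and sC: "substructure mod_ar ?C F"
    using F assms(2) by (auto intro!: substructure_generated)
  have "\<exists>!h. h \<in> homs mod_ar F N \<and> (\<forall>x\<in>univ ?A. h x = f x) \<and> (\<forall>x\<in>univ ?C. h x = g x)"
    if N: "N \<in> modules" and f: "f \<in> homs mod_ar ?A N" and g: "g \<in> homs mod_ar ?C N" for N f g
  proof (rule ex_ex1I)
    obtain h where h: "h \<in> homs mod_ar F N" "\<And>x. x \<in> X \<Longrightarrow> h x = (if x \<in> Z then f x else g x)"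
      using free_on_extend[OF assms(1) N, of "\<lambda>x. if x \<in> Z then f x else g x"]
        homs_closed[OF f] homs_closed[OF g] free_onD(3)[OF A] free_onD(3)[OF C]
      by (metis DiffI subsetD)
    have "h x = f x" if "x \<in> univ ?A" for x
      using homs_eq_on_free[OF A homs_restrict[OF h(1) sA] f _ that] that h(2) assms(2) free_onD(3)[OF A]
      by (auto simp: subset_iff)
    moreover have "h x = g x" if "x \<in> univ ?C" for x
      using homs_eq_on_free[OF C homs_restrict[OF h(1) sC] g _ that] that h(2) assms(2) free_onD(3)[OF C]
      by (auto simp: subset_iff)
    ultimately show "\<exists>h. h \<in> homs mod_ar F N \<and> (\<forall>x\<in>univ ?A. h x = f x) \<and> (\<forall>x\<in>univ ?C. h x = g x)"
      using h(1) by blast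
  next
    fix h k assume h: "h \<in> homs mod_ar F N \<and> (\<forall>x\<in>univ ?A. h x = f x) \<and> (\<forall>x\<in>univ ?C. h x = g x)"
      and k: "k \<in> homs mod_ar F N \<and> (\<forall>x\<in>univ ?A. k x = f x) \<and> (\<forall>x\<in>univ ?C. k x = g x)"
    have "h x = k x" if "x \<in> X" for x
      using that h k free_onD(3)[OF A] free_onD(3)[OF C] by (cases "x \<in> Z") auto
    then have "h x = k x" if "x \<in> univ F" for x
      using homs_eq_on_free[OF assms(1)] h k that by blast
    then show "h = k" using h k homs_ext by blast
  qed
  then have "free_prod mod_ar modules ?A ?C F"
    using free_onD(1)[OF A] free_onD(1)[OF C] F(1) sA sC unfolding free_prod_def by blast
  then show ?thesis using A C assms(1) unfolding ff_le_def free_algs_def by blast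
qed

text \<open>The universal property of the free product is applied to the identity of
  \<open>A\<close> and the zero map on the complement. This is how a free factor will be
  refuted.\<close>

lemma ff_le_retraction:
  assumes "ff_le mod_ar modules A D"
  obtains \<rho> where "\<rho> \<in> homs mod_ar D A" "\<And>x. x \<in> univ A \<Longrightarrow> \<rho> x = x"
proof -
  from assms obtain C where C: "free_prod mod_ar modules A C D"
    unfolding ff_le_def by blast
  then have m: "A \<in> modules" "C \<in> modules" by (auto simp: free_prod_def)
  have "substructure mod_ar A A"
    using m modules_structures by (auto simp: substructure_def)
  then have "restrict id (univ A) \<in> homs mod_ar A A" by (rule homs_id)
  with C m zero_hom[OF m(2,1)] that show ?thesis
    unfolding free_prod_def by fastforce
qed

section \<open>Coordinates in free modules\<close>

lemma card_Times_le:
  assumes "infinite A" "|B| \<le>o |A|"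
  shows "|A \<times> B| \<le>o |A|"
  using ordLeq_ordIso_trans[OF card_of_Times_mono2[OF assms(2)] card_of_Times_same_infinite[OF assms(1)]] .

lemma card_lists_infinite:
  assumes "infinite A"
  shows "|lists A| \<le>o |A|"
proof -
  have A: "A \<noteq> {}" using assms by auto
  define L where "L n = {xs. set xs \<subseteq> A \<and> length xs = n}" for n
  have L: "|L n| \<le>o |A|" for n
  proof (induction n)
    case 0
    have "L 0 = {[]}" by (auto simp: L_def)
    then show ?case using card_of_singl_ordLeq[OF A] by simp
  next
    case (Suc n)
    have "L (Suc n) = (\<lambda>(x, xs). x # xs) ` (A \<times> L n)"
      by (auto simp: L_def length_Suc_conv image_iff)
    then have "|L (Suc n)| \<le>o |A \<times> L n|" by (simp add: card_of_image)
    moreover have "|A \<times> L n| \<le>o |A|"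
      using assms Suc by (rule card_Times_le)
    ultimately show ?case by (rule ordLeq_transitive)
  qed
  have "lists A = (\<Union>n. L n)" by (auto simp: L_def)
  moreover have "|UNIV :: nat set| \<le>o |A|"
    using assms by (simp add: infinite_iff_card_of_nat)
  ultimately show ?thesis
    using card_of_UNION_ordLeq_infinite[OF assms, of UNIV L] L by simp
qed

section \<open>Finitely supported functions, linear forms and coordinates\<close>

definition fin_funs :: "'u set \<Rightarrow> ('u \<Rightarrow> 'r::zero) set" where
  "fin_funs X = {v. finite {x. v x \<noteq> 0} \<and> {x. v x \<noteq> 0} \<subseteq> X}"

lemma fin_funs_outside: "v \<in> fin_funs X \<Longrightarrow> x \<notin> X \<Longrightarrow> v x = 0"
  by (auto simp: fin_funs_def)

text \<open>A finitely supported function is determined by the graph of its nonzero values. This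
  finite graph is the set of entries of a list over \<open>X\<close> times the countable ring, and
  there are at most as many such lists as elements of \<open>X\<close>.\<close>

lemma card_fin_funs:
  assumes "infinite X"
  shows "|fin_funs X :: ('u \<Rightarrow> 'r :: {zero, countable}) set| \<le>o |X|"
proof -
  let ?G = "\<lambda>v :: 'u \<Rightarrow> 'r. {(x, v x) | x. v x \<noteq> 0}"
  let ?P = "X \<times> (UNIV :: 'r set)"
  have inj: "inj_on ?G (fin_funs X)"
  proof (rule inj_onI)
    fix v w assume "?G v = ?G w"
    then have g: "(x, a) \<in> ?G v \<longleftrightarrow> (x, a) \<in> ?G w" for x a by simp
    have "v x = w x" for x using g[of x "v x"] g[of x "w x"] by auto
    then show "v = w" by blast
  qed
  have "?G v \<in> set ` lists ?P" if "v \<in> fin_funs X" for v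
  proof -
    have "?G v = (\<lambda>x. (x, v x)) ` {x. v x \<noteq> 0}" by auto
    then have "finite (?G v)" "?G v \<subseteq> ?P" using that by (auto simp: fin_funs_def)
    moreover obtain xs where "set xs = ?G v" using finite_list[OF \<open>finite (?G v)\<close>] by blast
    ultimately have "xs \<in> lists ?P" "?G v = set xs" by (auto simp only: lists_eq_set mem_Collect_eq)
    then show ?thesis by blast
  qed
  then have "|fin_funs X :: ('u \<Rightarrow> 'r) set| \<le>o |set ` lists ?P|"
    using inj by (intro card_of_ordLeqI[of ?G]) auto
  also have "|set ` lists ?P| \<le>o |lists ?P|" by (rule card_of_image)
  also have "|lists ?P| \<le>o |?P|"
    using assms by (intro card_lists_infinite) (auto dest: finite_cartesian_productD1)
  also have "|?P| \<le>o |X|"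
  proof -
    have "|UNIV :: 'r set| \<le>o |UNIV :: nat set|"
      by (rule card_of_ordLeqI[of to_nat]) auto
    then have "|UNIV :: 'r set| \<le>o |X|"
      using assms ordLeq_transitive by (auto simp: infinite_iff_card_of_nat)
    then show ?thesis
      by (rule card_Times_le[OF assms])
  qed
  finally show ?thesis .
qed

text \<open>Left linear forms with values in the ring. The ring lives in a type of its own, so it
  cannot serve as a codomain for \<open>homs\<close>.\<close>

definition lin :: "('r :: {ring, monoid_mult} mod_sym, 'u) struc \<Rightarrow> ('u \<Rightarrow> 'r) \<Rightarrow> bool" where
  "lin F \<phi> \<longleftrightarrow> \<phi> (zr F) = 0 \<and> (\<forall>v\<in>univ F. \<forall>w\<in>univ F. \<phi> (pl F v w) = \<phi> v + \<phi> w) \<and>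
     (\<forall>v\<in>univ F. \<phi> (ng F v) = - \<phi> v) \<and> (\<forall>r. \<forall>v\<in>univ F. \<phi> (sc F r v) = r * \<phi> v)"

definition coordinates ::
  "('r :: {ring, monoid_mult} mod_sym, 'u) struc \<Rightarrow> 'u set \<Rightarrow> ('u \<Rightarrow> 'u \<Rightarrow> 'r) \<Rightarrow> bool" where
  "coordinates F X c \<longleftrightarrow> (\<forall>x\<in>X. lin F (c x)) \<and>
     (\<forall>x\<in>X. \<forall>y\<in>X. c x y = (if x = y then 1 else 0)) \<and>
     (\<forall>v\<in>univ F. finite {x \<in> X. c x v \<noteq> 0}) \<and>
     (\<forall>v\<in>univ F. \<forall>w\<in>univ F. (\<forall>x\<in>X. c x v = c x w) \<longrightarrow> v = w)"

lemma linD: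
  assumes "lin F \<phi>"
  shows "\<phi> (zr F) = 0" "v \<in> univ F \<Longrightarrow> w \<in> univ F \<Longrightarrow> \<phi> (pl F v w) = \<phi> v + \<phi> w"
    "v \<in> univ F \<Longrightarrow> \<phi> (ng F v) = - \<phi> v" "v \<in> univ F \<Longrightarrow> \<phi> (sc F r v) = r * \<phi> v"
  using assms by (auto simp: lin_def)

lemma lin_comp:
  assumes "lin B \<phi>" "h \<in> homs mod_ar A B"
  shows "lin A (\<lambda>v. \<phi> (h v))"
  using assms homs_closed[OF assms(2)] by (auto simp: lin_def homs_mod[OF assms(2)])

lemma lin_diff: "lin F \<phi> \<Longrightarrow> lin F \<psi> \<Longrightarrow> lin F (\<lambda>v. \<phi> v - \<psi> v)"
  by (auto simp: lin_def algebra_simps)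

text \<open>Left linearity survives multiplication of the values on the right. This is the side on
  which the ring elements of \<open>twist\<close> enter the coordinates of an image.\<close>

lemma lin_mult_right: "lin F \<phi> \<Longrightarrow> lin F (\<lambda>v. \<phi> v * r)"
  by (auto simp: lin_def algebra_simps)

lemma lin_eq_on_free:
  assumes "free_on mod_ar modules F X" "lin F \<phi>" "lin F \<psi>" "\<And>x. x \<in> X \<Longrightarrow> \<phi> x = \<psi> x" "v \<in> univ F"
  shows "\<phi> v = \<psi> v"
proof -
  have "span mod_ar F X \<subseteq> {v \<in> univ F. \<phi> v = \<psi> v}"
    using assms(4) free_onD[OF assms(1)] modules_closed[OF free_onD(1)[OF assms(1)]]
    by (intro span_minimal) (auto simp: closed_under_mod_iff linD[OF assms(2)] linD[OF assms(3)])
  then show ?thesis using assms(5) free_onD(4)[OF assms(1)] by auto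
qed

section \<open>The free module of finitely supported functions\<close>

primrec fin_fun_op :: "'r mod_sym \<Rightarrow> ('u \<Rightarrow> 'r :: {ring, monoid_mult}) list \<Rightarrow> 'u \<Rightarrow> 'r" where
  "fin_fun_op Zero vs = (\<lambda>x. 0)"
| "fin_fun_op Plus vs = (\<lambda>x. (vs ! 0) x + (vs ! 1) x)"
| "fin_fun_op Minus vs = (\<lambda>x. - (vs ! 0) x)"
| "fin_fun_op (Scale r) vs = (\<lambda>x. r * (vs ! 0) x)"

lemma fin_funs_ops:
  fixes v w :: "'u \<Rightarrow> 'r :: {ring, monoid_mult}"
  shows "(\<lambda>x. 0 :: 'r) \<in> fin_funs X"
    "v \<in> fin_funs X \<Longrightarrow> w \<in> fin_funs X \<Longrightarrow> (\<lambda>x. v x + w x) \<in> fin_funs X"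
    "v \<in> fin_funs X \<Longrightarrow> (\<lambda>x. - v x) \<in> fin_funs X"
    "v \<in> fin_funs X \<Longrightarrow> (\<lambda>x. r * v x) \<in> fin_funs X"
proof -
  show "(\<lambda>x. 0 :: 'r) \<in> fin_funs X" "v \<in> fin_funs X \<Longrightarrow> (\<lambda>x. - v x) \<in> fin_funs X"
    by (auto simp: fin_funs_def)
  have "{x. v x + w x \<noteq> 0} \<subseteq> {x. v x \<noteq> 0} \<union> {x. w x \<noteq> 0}" "{x. r * v x \<noteq> 0} \<subseteq> {x. v x \<noteq> 0}"
    by auto
  then show "v \<in> fin_funs X \<Longrightarrow> w \<in> fin_funs X \<Longrightarrow> (\<lambda>x. v x + w x) \<in> fin_funs X"
    "v \<in> fin_funs X \<Longrightarrow> (\<lambda>x. r * v x) \<in> fin_funs X"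
    unfolding fin_funs_def by (auto intro: finite_subset)
qed

text \<open>Structures have their elements in \<open>'u\<close>, so functions are coded there by an
  injection \<open>e\<close>. The bound \<open>small\<close> makes the set of codes an admissible
  carrier.\<close>

locale fin_fun_module =
  fixes X :: "'u set" and e :: "('u \<Rightarrow> 'r :: {ring, monoid_mult}) \<Rightarrow> 'u"
  assumes inj_e: "inj_on e (fin_funs X)"
    and small: "|fin_funs X :: ('u \<Rightarrow> 'r) set| <o |UNIV :: 'u set|"
begin

definition dec where "dec = inv_into (fin_funs X) e"

definition FM :: "('r mod_sym, 'u) struc" where
  "FM = \<lparr>univ = e ` fin_funs X, opn = (\<lambda>f xs. if set xs \<subseteq> e ` fin_funs X \<and> length xs = mod_ar f
     then e (fin_fun_op f (map dec xs)) else undefined)\<rparr>"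

lemma univ_FM: "univ FM = e ` fin_funs X" by (simp add: FM_def)

lemma dec_e [simp]: "v \<in> fin_funs X \<Longrightarrow> dec (e v) = v"
  using inj_e by (simp add: dec_def)

lemma opn_FM:
  "zr FM = e (\<lambda>x. 0)"
  "v \<in> fin_funs X \<Longrightarrow> w \<in> fin_funs X \<Longrightarrow> pl FM (e v) (e w) = e (\<lambda>x. v x + w x)"
  "v \<in> fin_funs X \<Longrightarrow> ng FM (e v) = e (\<lambda>x. - v x)"
  "v \<in> fin_funs X \<Longrightarrow> sc FM r (e v) = e (\<lambda>x. r * v x)"
  by (simp_all add: FM_def)

lemma FM_structures: "FM \<in> structures mod_ar"
proof -
  have "|univ FM| <o |UNIV :: 'u set|"
    using card_of_image small unfolding univ_FM by (rule ordLeq_ordLess_trans)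
  moreover have "closed_under mod_ar FM (univ FM)"
    unfolding closed_under_mod_iff univ_FM
    by (auto simp: opn_FM intro!: imageI fin_funs_ops)
  ultimately show ?thesis by (auto simp: structures_def FM_def)
qed

lemma FM_modules: "FM \<in> modules"
  unfolding modules_def mem_Collect_eq univ_FM ball_simps
  using FM_structures by (auto simp: opn_FM fin_funs_ops algebra_simps)

definition unit :: "'u \<Rightarrow> 'u" where "unit x = e (\<lambda>y. if y = x then 1 else 0)"

lemma unit_fin_funs: "x \<in> X \<Longrightarrow> (\<lambda>y. if y = x then 1 else 0 :: 'r) \<in> fin_funs X"
  by (auto simp: fin_funs_def intro: finite_subset[of _ "{x}"])

lemma dec_lin: "lin FM (\<lambda>v. dec v x)"
  unfolding lin_def univ_FM by (auto simp: opn_FM fin_funs_ops)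

lemma FM_span: "span mod_ar FM (unit ` X) = univ FM"
proof
  let ?S = "span mod_ar FM (unit ` X)"
  have uX: "unit ` X \<subseteq> univ FM" by (auto simp: unit_def univ_FM unit_fin_funs)
  show "?S \<subseteq> univ FM" by (intro span_subset_univ FM_structures uX)
  have c: "closed_under mod_ar FM ?S" by (intro closed_under_span FM_structures)
  \<comment> \<open>Induction on a finite set containing the support: clearing the value at
    \<open>t\<close> leaves a function supported in \<open>T\<close>, and the part removed is a
    multiple of a unit.\<close>
  have "e v \<in> ?S" if "finite T" "T \<subseteq> X" "{x. v x \<noteq> 0} \<subseteq> T" for T and v :: "'u \<Rightarrow> 'r"
    using that
  proof (induction T arbitrary: v)
    case empty
    then have "v = (\<lambda>x. 0)" by auto
    moreover have "zr FM = e (\<lambda>x. 0)" by (simp add: FM_def)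
    ultimately show ?case using c by (simp add: closed_under_mod_iff)
  next
    case (insert t T)
    let ?w = "v(t := 0)" and ?d = "\<lambda>y. if y = t then 1 else 0 :: 'r"
    have "{x. ?w x \<noteq> 0} \<subseteq> T" using insert by auto
    then have w: "?w \<in> fin_funs X" "e ?w \<in> ?S"
      using insert by (auto simp: fin_funs_def intro: finite_subset)
    have d: "?d \<in> fin_funs X" using insert by (simp add: unit_fin_funs)
    have "e ?d \<in> ?S" using insert span_superset[of "unit ` X" mod_ar FM] by (auto simp: unit_def)
    then have "pl FM (e ?w) (sc FM (v t) (e ?d)) \<in> ?S"
      using w c by (simp add: closed_under_mod_iff)
    moreover have "(\<lambda>x. ?w x + v t * ?d x) = v" by auto
    ultimately show ?case
      using w d fin_funs_ops(4)[OF d, of "v t"] by (simp add: opn_FM)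
  qed
  then show "univ FM \<subseteq> ?S" by (auto simp: univ_FM fin_funs_def)
qed

text \<open>The extension of \<open>g\<close> sends the code of \<open>v\<close> to the finite sum
  of the terms \<open>sc N (v x) (g (unit x))\<close>.\<close>

lemma FM_free: "free_on mod_ar modules FM (unit ` X)"
proof (rule free_onI)
  show "FM \<in> modules" by (rule FM_modules)
  show "unit ` X \<subseteq> univ FM" by (auto simp: unit_def univ_FM unit_fin_funs)
  show "span mod_ar FM (unit ` X) = univ FM" by (rule FM_span)
  fix N :: "('r mod_sym, 'u) struc" and g
  assume N: "N \<in> modules" and g: "\<And>x. x \<in> unit ` X \<Longrightarrow> g x \<in> univ N"
  interpret G: comm_group "add_group N" by (rule comm_group_add_group[OF N])
  note cl = modules_closed[OF N]
  have g': "g (unit x) \<in> univ N" if "x \<in> X" for x using g that by auto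
  define t where "t v x = sc N (v x) (g (unit x))" for v :: "'u \<Rightarrow> 'r" and x
  have t: "t v x \<in> univ N" if "x \<in> X" for v x using g' that by (simp add: t_def cl)
  define S where "S v T = finprod (add_group N) (t v) T" for v T
  have S_closed: "S v T \<in> univ N" if "T \<subseteq> X" for v T
    using G.finprod_closed[of "t v" T] t that by (auto simp: S_def Pi_iff)
  \<comment> \<open>Terms off the support vanish, so the sum may run over any finite superset of it.
    Two functions can therefore be summed over a common index set.\<close>
  have S_supp: "S v {x. v x \<noteq> 0} = S v T" if "finite T" "T \<subseteq> X" "{x. v x \<noteq> 0} \<subseteq> T" for v T
    unfolding S_def using that t g'
    by (intro G.finprod_mono_neutral_cong_left)
      (auto simp: Pi_iff subset_iff, auto simp: t_def mod_zero_scale[OF N])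
  define h where "h y = S (dec y) {x. dec y x \<noteq> 0}" for y
  have h: "h (e v) = S v T" if "v \<in> fin_funs X" "finite T" "T \<subseteq> X" "{x. v x \<noteq> 0} \<subseteq> T" for v T
    using that S_supp by (simp add: h_def)
  have h0: "h (e v) = S v {x. v x \<noteq> 0}" if "v \<in> fin_funs X" for v
    using that by (simp add: h_def)
  have h_pl: "h (e (\<lambda>x. v x + w x)) = pl N (h (e v)) (h (e w))"
    if v: "v \<in> fin_funs X" and w: "w \<in> fin_funs X" for v w
  proof -
    let ?T = "{x. v x \<noteq> 0} \<union> {x. w x \<noteq> 0}"
    have T: "finite ?T" "?T \<subseteq> X" using v w by (auto simp: fin_funs_def)
    have sum: "(\<lambda>x. v x + w x) \<in> fin_funs X" using v w by (rule fin_funs_ops)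
    have "h (e (\<lambda>x. v x + w x)) = S (\<lambda>x. v x + w x) ?T" using T by (intro h sum) auto
    also have "\<dots> = finprod (add_group N) (\<lambda>x. pl N (t v x) (t w x)) ?T"
      unfolding S_def using T t
      by (intro G.finprod_cong') (auto simp: t_def mod_scale(2)[OF N g' g'] subset_iff cl)
    also have "\<dots> = pl N (S v ?T) (S w ?T)"
      unfolding S_def using T t G.finprod_multf[of "t v" ?T "t w"] by (auto simp: Pi_iff subset_iff)
    also have "\<dots> = pl N (h (e v)) (h (e w))" using T h[OF v T] h[OF w T] by auto
    finally show ?thesis .
  qed
  have h_sc: "h (e (\<lambda>x. r * v x)) = sc N r (h (e v))" if v: "v \<in> fin_funs X" for v r
  proof -
    let ?T = "{x. v x \<noteq> 0}"
    have T: "finite ?T" "?T \<subseteq> X" using v by (auto simp: fin_funs_def)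
    have rv: "(\<lambda>x. r * v x) \<in> fin_funs X" using v by (rule fin_funs_ops)
    have "S (\<lambda>x. r * v x) T = sc N r (S v T)" if "finite T" "T \<subseteq> X" for T
      using that
    proof (induction T)
      case empty
      then show ?case by (simp add: S_def mod_zero_scale[OF N])
    next
      case (insert x T)
      have i: "S u (insert x T) = pl N (t u x) (S u T)" for u
        unfolding S_def using insert t
        by (subst G.finprod_insert) (auto simp: Pi_iff subset_iff)
      have "t (\<lambda>x. r * v x) x = sc N r (t v x)"
        using insert mod_scale(3)[OF N g' g', of x x] by (simp add: t_def)
      then show ?case
        using insert t S_closed mod_scale(1)[OF N, of "t v x" "S v T" r] by (simp add: i)
    qed
    moreover have "h (e (\<lambda>x. r * v x)) = S (\<lambda>x. r * v x) ?T" using T by (intro h rv) auto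
    ultimately show ?thesis using T v by (simp add: h)
  qed
  have h_closed: "h (e v) \<in> univ N" if "v \<in> fin_funs X" for v
    using that S_closed by (auto simp: h0 fin_funs_def)
  have h_ng: "h (e (\<lambda>x. - v x)) = ng N (h (e v))" if v: "v \<in> fin_funs X" for v
    using h_sc[OF v, of "- 1"] h_closed[OF v]
      mod_scale_neg(1)[OF N h_closed[OF v], of 1] mod_scale(4)[OF N h_closed[OF v] h_closed[OF v]]
    by simp
  have h_zr: "h (e (\<lambda>x. 0)) = zr N"
    using h[of "\<lambda>x. 0" "{}"] by (simp add: fin_funs_def S_def)
  have "restrict h (univ FM) \<in> homs mod_ar FM N"
    unfolding homs_mod_iff univ_FM
    by (auto simp: h_closed opn_FM h_pl h_sc h_ng h_zr fin_funs_ops)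
  moreover have "h (unit x) = g (unit x)" if "x \<in> X" for x
  proof -
    let ?d = "\<lambda>y. if y = x then 1 else 0 :: 'r"
    have "h (e ?d) = S ?d {x}" using that by (intro h unit_fin_funs) auto
    also have "\<dots> = t ?d x"
      using G.finprod_insert[of "{}" x "t ?d"] t[OF that] mod_zero(2)[OF N t[OF that] t[OF that]]
      by (simp add: S_def)
    also have "\<dots> = g (unit x)" using mod_scale(4)[OF N g'[OF that] g'[OF that]] by (simp add: t_def)
    finally show ?thesis by (simp add: unit_def)
  qed
  moreover have "unit x \<in> univ FM" if "x \<in> X" for x
    using that by (simp add: unit_def univ_FM unit_fin_funs)
  ultimately show "\<exists>h\<in>homs mod_ar FM N. \<forall>x\<in>unit ` X. h x = g x"
    by (intro bexI[of _ "restrict h (univ FM)"]) auto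
qed

lemma unit_inj:
  assumes "(1 :: 'r) \<noteq> 0"
  shows "inj_on unit X"
proof (rule inj_onI)
  fix x y assume "x \<in> X" "y \<in> X" "unit x = unit y"
  then have "(\<lambda>z. if z = x then 1 else 0 :: 'r) = (\<lambda>z. if z = y then 1 else 0)"
    using inj_e unit_fin_funs unfolding unit_def by (blast dest: inj_onD)
  from fun_cong[OF this, of x] show "x = y" using assms by (auto split: if_splits)
qed

end

section \<open>Transfer of coordinates to arbitrary free modules\<close>

lemma exists_fin_fun_module:
  fixes X :: "'u set"
  assumes "infinite X" "|X| <o |UNIV :: 'u set|"
  obtains e :: "('u \<Rightarrow> 'r :: {ring, monoid_mult, countable}) \<Rightarrow> 'u" where "fin_fun_module X e"
proof -
  have s: "|fin_funs X :: ('u \<Rightarrow> 'r) set| <o |UNIV :: 'u set|"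
    using card_fin_funs[OF assms(1)] assms(2) by (rule ordLeq_ordLess_trans)
  then have "|fin_funs X :: ('u \<Rightarrow> 'r) set| \<le>o |UNIV :: 'u set|" by (rule ordLess_imp_ordLeq)
  then obtain e :: "('u \<Rightarrow> 'r) \<Rightarrow> 'u" where "inj_on e (fin_funs X)"
    by (auto simp: card_of_ordLeq[symmetric])
  with s that show ?thesis by (auto simp: fin_fun_module_def)
qed

text \<open>The universal properties of \<open>F\<close> and of the module of finitely supported
  functions on \<open>X\<close> give homomorphisms with \<open>k (h v) = v\<close>. Hence
  \<open>h\<close> is injective, the values of the decoded function of \<open>h v\<close> separate
  points, and \<open>card_fin_funs\<close> bounds the size of \<open>F\<close>.\<close>

lemma free_coordinates:
  fixes F :: "('r :: {ring, monoid_mult, countable} mod_sym, 'u) struc"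
  assumes F: "free_on mod_ar modules F X" and "infinite X" and nontriv: "(1 :: 'r) \<noteq> 0"
  obtains c where "coordinates F X c" and "|univ F| \<le>o |X|"
proof -
  have "|X| <o |UNIV :: 'u set|"
    using card_of_mono1[OF free_onD(3)[OF F]] structures_card[OF free_onD(2)[OF F]]
    by (rule ordLeq_ordLess_trans)
  then obtain e :: "('u \<Rightarrow> 'r) \<Rightarrow> 'u" where "fin_fun_module X e"
    using exists_fin_fun_module[OF assms(2)] by blast
  then interpret fin_fun_module X e .
  have u: "inj_on unit X" by (rule unit_inj[OF nontriv])
  have uF: "unit x \<in> univ FM" if "x \<in> X" for x using that by (simp add: unit_def univ_FM unit_fin_funs)
  obtain h where h: "h \<in> homs mod_ar F FM" "\<And>x. x \<in> X \<Longrightarrow> h x = unit x"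
    using free_on_extend[OF F FM_modules, of unit] uF by metis
  obtain k where k: "k \<in> homs mod_ar FM F" "\<And>y. y \<in> unit ` X \<Longrightarrow> k y = inv_into X unit y"
    using free_on_extend[OF FM_free free_onD(1)[OF F], of "inv_into X unit"] free_onD(3)[OF F]
    by (metis inv_into_into subsetD)
  have sub: "substructure mod_ar F F" using free_onD(2)[OF F] by (auto simp: substructure_def)
  have kh: "k (h v) = v" if "v \<in> univ F" for v
    using homs_eq_on_free[OF F homs_comp[OF h(1) k(1) free_onD(2)[OF F]] homs_id[OF sub] _ that]
      h(2) k(2) u free_onD(3)[OF F] that by (auto simp: subset_iff)
  have hF: "h v \<in> e ` fin_funs X" if "v \<in> univ F" for v
    using homs_closed[OF h(1) that] by (simp add: univ_FM)
  have e_dec: "e (dec y) = y" if "y \<in> e ` fin_funs X" for y using that by auto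
  have "coordinates F X (\<lambda>x v. dec (h v) x)"
    unfolding coordinates_def
  proof (intro conjI ballI impI)
    fix x assume "x \<in> X"
    show "lin F (\<lambda>v. dec (h v) x)" using lin_comp[OF dec_lin h(1)] .
    fix y assume "y \<in> X"
    then show "dec (h y) x = (if x = y then 1 else 0)" by (simp add: h(2) unit_def unit_fin_funs)
  next
    fix v assume v: "v \<in> univ F"
    show "finite {x \<in> X. dec (h v) x \<noteq> 0}"
      using hF[OF v] finite_subset[of "{x \<in> X. dec (h v) x \<noteq> 0}" "{x. dec (h v) x \<noteq> 0}"]
      by (auto simp: fin_funs_def)
    fix w assume w: "w \<in> univ F" and eq: "\<forall>x\<in>X. dec (h v) x = dec (h w) x"
    have "dec (h v) \<in> fin_funs X" "dec (h w) \<in> fin_funs X" using hF[OF v] hF[OF w] by auto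
    then have "dec (h v) x = dec (h w) x" if "x \<notin> X" for x
      using that fin_funs_outside[of "dec (h v)" X x] fin_funs_outside[of "dec (h w)" X x] by simp
    then have "dec (h v) x = dec (h w) x" for x using eq by (cases "x \<in> X") simp_all
    then have "dec (h v) = dec (h w)" by (rule ext)
    then have "e (dec (h v)) = e (dec (h w))" by (rule arg_cong)
    then have "h v = h w" unfolding e_dec[OF hF[OF v]] e_dec[OF hF[OF w]] .
    then have "k (h v) = k (h w)" by (rule arg_cong)
    then show "v = w" unfolding kh[OF v] kh[OF w] .
  qed
  moreover have "|univ F| \<le>o |X|"
  proof -
    have "inj_on h (univ F)" using kh by (metis inj_onI)
    then have "|univ F| \<le>o |univ FM|" using homs_closed[OF h(1)] by (intro card_of_ordLeqI)
    also have "|univ FM| \<le>o |fin_funs X :: ('u \<Rightarrow> 'r) set|" unfolding univ_FM by (rule card_of_image)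
    also have "|fin_funs X :: ('u \<Rightarrow> 'r) set| \<le>o |X|" by (rule card_fin_funs[OF assms(2)])
    finally show ?thesis .
  qed
  ultimately show ?thesis by (rule that)
qed

lemma exists_free_module:
  fixes X :: "'u set"
  assumes "infinite X" "|X| <o |UNIV :: 'u set|" "(1 :: 'r) \<noteq> 0"
  obtains F :: "('r :: {ring, monoid_mult, countable} mod_sym, 'u) struc" and B
  where "free_on mod_ar modules F B" "|B| =o |X|"
proof -
  obtain e :: "('u \<Rightarrow> 'r) \<Rightarrow> 'u" where "fin_fun_module X e"
    using exists_fin_fun_module[OF assms(1,2)] by blast
  then interpret fin_fun_module X e .
  have "bij_betw unit X (unit ` X)" using unit_inj[OF assms(3)] by (simp add: bij_betw_def)
  then have "|unit ` X| =o |X|" by (meson card_of_ordIso ordIso_symmetric)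
  with FM_free that show ?thesis by blast
qed

section \<open>The twisted endomorphism\<close>

text \<open>
  The recurrence says that the \<open>j\<close>-th coordinates \<open>c j\<close> of a sequence \<open>x\<close> in a free module satisfy
  \<open>x i - r i x (i + 1) = e i\<close> for all \<open>i\<close> and \<open>j \<ge> n\<close>, where \<open>e\<close> is part of a basis. Then
  \<open>c j 0 = r 0 \<cdots> r (j - 1) c j j\<close>, so \<open>c j j = 0\<close> for almost all \<open>j\<close>, and \<open>- c j (j + 1)\<close> is a right
  inverse of \<open>r j\<close>.
\<close>
lemma prod_right_unit_stabilises:
  fixes r :: "nat \<Rightarrow> 'r :: {ring, monoid_mult}"
  assumes "\<And>m. \<not> zero_divisor (prod_list (map r [0..<Suc m]))"
    and rec: "\<And>i j. j \<ge> n \<Longrightarrow> c j i = r i * c j (Suc i) + (if i = j then 1 else 0)"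
    and fin: "finite {j. c j 0 \<noteq> 0}"
  shows "\<exists>k. \<forall>m\<ge>k. range ((*) (prod_list (map r [0..<Suc m]))) =
           range ((*) (prod_list (map r [0..<Suc k])))"
proof -
  define P where "P i = prod_list (map r [0..<i])" for i
  have P_Suc: "P (Suc i) = P i * r i" for i by (simp add: P_def)
  have cancel: "x = 0" if "P i * x = 0" for i x
  proof (cases i)
    case 0
    then show ?thesis using that by (simp add: P_def)
  next
    case (Suc m)
    then show ?thesis using that assms(1)[of m] by (auto simp: P_def zero_divisor_def)
  qed
  obtain K where K: "c j 0 = 0" if "j > K" for j
    using fin by (metis (mono_tags, lifting) finite_nat_set_iff_bounded_le mem_Collect_eq not_le)
  have step: "range ((*) (P (Suc j))) = range ((*) (P j))" if j: "j \<ge> n" "j > K" for j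
  proof -
    \<comment> \<open>Before the index \<open>j\<close> the recurrence has no constant term, so it
      telescopes.\<close>
    have "c j 0 = P i * c j i" if "i \<le> j" for i
      using that
    proof (induction i)
      case 0
      then show ?case by (simp add: P_def)
    next
      case (Suc i)
      then show ?case using rec[OF j(1), of i] by (simp add: P_Suc mult.assoc)
    qed
    from this[of j] have "c j j = 0" using cancel K[OF j(2)] by simp
    then have "r j * c j (Suc j) + 1 = 0" using rec[OF j(1), of j] by simp
    then have u: "r j * (- c j (Suc j)) = 1" by (simp add: add_eq_0_iff)
    have 1: "P j * y = P (Suc j) * (- c j (Suc j) * y)" for y
    proof -
      have "P (Suc j) * (- c j (Suc j) * y) = P j * (r j * (- c j (Suc j))) * y"
        by (simp only: P_Suc mult.assoc)
      then show ?thesis by (simp only: u mult_1_right)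
    qed
    have 2: "P (Suc j) * y = P j * (r j * y)" for y by (simp add: P_Suc mult.assoc)
    show ?thesis
    proof (intro subset_antisym image_subsetI)
      show "P (Suc j) * y \<in> range ((*) (P j))" for y unfolding 2 by (rule rangeI)
      show "P j * y \<in> range ((*) (P (Suc j)))" for y by (subst 1) (rule rangeI)
    qed
  qed
  \<comment> \<open>Past both bounds. The products in the claim have \<open>Suc m\<close> factors,
    so \<open>step\<close> will be used at \<open>Suc m\<close>.\<close>
  let ?k = "n + Suc K"
  have "range ((*) (P (Suc m))) = range ((*) (P (Suc ?k)))" if "m \<ge> ?k" for m
    using that
  proof (induction m rule: dec_induct)
    case (step m)
    then show ?case using \<open>\<And>j. j \<ge> n \<Longrightarrow> j > K \<Longrightarrow> _\<close>[of "Suc m"] by simp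
  qed simp
  then show ?thesis unfolding P_def by blast
qed

text \<open>As \<open>z'\<close> differs from \<open>z\<close>, the element \<open>e z'\<close>
  stays in the new basis, and adding \<open>r\<close> times it to \<open>d\<close> recovers
  \<open>e z\<close>. This gives both spanning and the extension of maps. The basis is indexed by
  \<open>e\<close> so that such replacements can be iterated.\<close>

lemma free_on_transvection:
  fixes F :: "('r :: {ring, monoid_mult, countable} mod_sym, 'u) struc" and r :: 'r
  assumes F: "free_on mod_ar modules F (e ` X)" and inj: "inj_on e X" and "infinite X"
    and z: "z \<in> X" "z' \<in> X" "z \<noteq> z'" and nontriv: "(1 :: 'r) \<noteq> 0"
  defines "d \<equiv> pl F (e z) (ng F (sc F r (e z')))"
  shows "free_on mod_ar modules F (e(z := d) ` X)" "inj_on (e(z := d)) X"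
proof -
  let ?e = "e(z := d)"
  note Fm = free_onD[OF F]
  note cl = modules_closed[OF Fm(1)]
  have eX: "e x \<in> univ F" if "x \<in> X" for x using that Fm by auto
  have d: "d \<in> univ F" using eX z by (simp add: d_def cl)
  obtain c where c: "coordinates F (e ` X) c"
    using free_coordinates[OF F _ nontriv] inj assms(3) finite_imageD by metis
  have lin: "lin F (c (e x))" if "x \<in> X" for x using c that by (simp add: coordinates_def)
  have cc: "c (e x) (e y) = (if x = y then 1 else 0)" if "x \<in> X" "y \<in> X" for x y
    using c that inj by (auto simp: coordinates_def dest: inj_onD)
  \<comment> \<open>The coordinate at \<open>e z\<close> separates \<open>d\<close> from the other
    basis elements, where it vanishes.\<close>
  have "c (e z) d = 1"
    using z linD[OF lin[OF z(1)]] by (simp add: d_def eX cl cc)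
  then have "d \<noteq> e x" if "x \<in> X" "x \<noteq> z" for x
    using cc[OF z(1) that(1)] that nontriv by auto
  with inj show "inj_on ?e X" by (auto simp: inj_on_def)
  show "free_on mod_ar modules F (?e ` X)"
  proof (rule free_onI)
    show "F \<in> modules" by fact
    show eX': "?e ` X \<subseteq> univ F" using eX d by auto
    let ?S = "span mod_ar F (?e ` X)"
    have c: "closed_under mod_ar F ?S" by (intro closed_under_span Fm)
    have S: "?e x \<in> ?S" if "x \<in> X" for x using that span_superset[of "?e ` X" mod_ar F] by auto
    have "e z = pl F d (sc F r (e z'))"
      using mod_add_diff(2)[OF Fm(1) eX[OF z(1)] cl(4)[OF eX[OF z(2)]], of r] by (simp add: d_def)
    also have "\<dots> \<in> ?S"
      using c S[OF z(1)] S[OF z(2)] z(3) by (simp add: closed_under_mod_iff)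
    finally have "e x \<in> ?S" if "x \<in> X" for x using S[OF that] by (cases "x = z") auto
    then have "span mod_ar F (e ` X) \<subseteq> ?S"
      by (intro span_mono Fm eX') auto
    then show "?S = univ F" using Fm span_subset_univ[OF Fm(2) eX'] by simp
    fix N :: "('r mod_sym, 'u) struc" and g
    assume N: "N \<in> modules" and g: "\<And>x. x \<in> ?e ` X \<Longrightarrow> g x \<in> univ N"
    note clN = modules_closed[OF N]
    have g': "g (?e x) \<in> univ N" if "x \<in> X" for x using g that by auto
    have gz: "g d \<in> univ N" "g (e z') \<in> univ N" using g'[OF z(1)] g'[OF z(2)] z(3) by auto
    \<comment> \<open>The value at \<open>e z\<close> is chosen so that the extension takes the
      value \<open>g d\<close> at \<open>d\<close>.\<close>
    let ?g = "\<lambda>x. if x = z then pl N (g d) (sc N r (g (e z'))) else g (e x)"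
    have "?g x \<in> univ N" if "x \<in> X" for x using gz g'[OF that] by (auto simp: clN)
    then have "?g (inv_into X e y) \<in> univ N" if "y \<in> e ` X" for y
      using that by (metis inv_into_into)
    then obtain h where h: "h \<in> homs mod_ar F N" "\<And>y. y \<in> e ` X \<Longrightarrow> h y = ?g (inv_into X e y)"
      using free_on_extend[OF F N, of "\<lambda>y. ?g (inv_into X e y)"] by metis
    have he: "h (e x) = ?g x" if "x \<in> X" for x using h(2)[of "e x"] that inj by simp
    have "h d = g d"
      using z gz eX mod_add_diff(1)[OF N gz(1) clN(4)[OF gz(2)]]
      by (simp add: d_def homs_mod[OF h(1)] cl he)
    then have "\<forall>y\<in>?e ` X. h y = g y" using he by auto
    with h(1) show "\<exists>h\<in>homs mod_ar F N. \<forall>x\<in>?e ` X. h x = g x" by blast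
  qed
qed

text \<open>The index of a branch element is read off by \<open>inv_into UNIV s\<close>. The set
  \<open>I\<close> says where the change is made: everywhere for the endomorphism itself, on an
  initial segment for a change of basis that agrees with it there.\<close>

definition twist :: "('r mod_sym, 'u) struc \<Rightarrow> (nat \<Rightarrow> 'u) \<Rightarrow> (nat \<Rightarrow> 'r) \<Rightarrow> nat set \<Rightarrow> 'u \<Rightarrow> 'u" where
  "twist F s r I x = (if x \<in> s ` I
     then pl F x (ng F (sc F (r (inv_into UNIV s x)) (s (Suc (inv_into UNIV s x))))) else x)"

lemma twist_simps:
  assumes "inj s"
  shows "i \<in> I \<Longrightarrow> twist F s r I (s i) = pl F (s i) (ng F (sc F (r i) (s (Suc i))))"
    "i \<notin> I \<Longrightarrow> twist F s r I (s i) = s i"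
    "x \<notin> s ` I \<Longrightarrow> twist F s r I x = x"
  using assms by (auto simp: twist_def inj_image_mem_iff)

text \<open>Each stage is one transvection: when \<open>s m\<close> is changed,
  \<open>s (Suc m)\<close> is still unchanged and hence an element of the current basis.\<close>

lemma free_on_twist_finite:
  fixes F :: "('r :: {ring, monoid_mult, countable} mod_sym, 'u) struc"
  assumes "free_on mod_ar modules F X" "infinite X" "inj s" "range s \<subseteq> X" "(1 :: 'r) \<noteq> 0"
  shows "free_on mod_ar modules F (twist F s r {..<m} ` X) \<and> inj_on (twist F s r {..<m}) X"
proof (induction m)
  case 0
  have "twist F s r {..<0} = id" by (auto simp: twist_def)
  then show ?case using assms by simp
next
  case (Suc m)
  let ?t = "twist F s r {..<m}"
  have "twist F s r {..<Suc m} =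
    ?t(s m := pl F (?t (s m)) (ng F (sc F (r m) (?t (s (Suc m))))))" (is "_ = ?t'")
  proof
    fix x
    show "twist F s r {..<Suc m} x = ?t' x"
    proof (cases "x = s m")
      case True
      then show ?thesis by (simp add: twist_simps[OF assms(3)])
    next
      case False
      then have "x \<in> s ` {..<Suc m} \<longleftrightarrow> x \<in> s ` {..<m}" by (auto simp: lessThan_Suc)
      with False show ?thesis by (simp add: twist_def)
    qed
  qed
  moreover have "s m \<in> X" "s (Suc m) \<in> X" "s m \<noteq> s (Suc m)"
    using assms by (auto dest: injD)
  ultimately show ?case
    using free_on_transvection[of F ?t X "s m" "s (Suc m)" "r m"] Suc assms(2,5) by metis
qed

locale twisted =
  fixes F :: "('r :: {ring, monoid_mult, countable} mod_sym, 'u) struc" and X and s :: "nat \<Rightarrow> 'u"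
    and r :: "nat \<Rightarrow> 'r" and h :: "'u \<Rightarrow> 'u"
  assumes F: "free_on mod_ar modules F X" and infX: "infinite X" and inj_s: "inj s"
    and s_X: "range s \<subseteq> X" and nontriv: "(1 :: 'r) \<noteq> 0"
    and h: "h \<in> homs mod_ar F F" and h_X: "\<And>x. x \<in> X \<Longrightarrow> h x = twist F s r UNIV x"
begin

lemmas Fm = free_onD[OF F]
lemmas cl = modules_closed[OF Fm(1)]

lemma s_mem: "s i \<in> X" "s i \<in> univ F"
  using s_X Fm by auto

lemma h_s: "h (s i) = pl F (s i) (ng F (sc F (r i) (s (Suc i))))"
  using s_mem(1) by (simp add: h_X twist_simps[OF inj_s])

lemma h_other: "x \<in> X \<Longrightarrow> x \<notin> range s \<Longrightarrow> h x = x"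
  by (simp add: h_X twist_def)

text \<open>The coordinates of \<open>v\<close> are recovered recursively from those of
  \<open>h v\<close>: the one at \<open>s 0\<close> is the same, and the one at
  \<open>s (Suc i)\<close> differs by \<open>c (s i) v * r i\<close>. Coordinates off the branch do
  not change. No condition on \<open>r\<close> enters.\<close>

lemma inj_h: "inj_on h (univ F)"
proof -
  obtain c where c: "coordinates F X c" using free_coordinates[OF F infX nontriv] by blast
  have lin: "lin F (c x)" if "x \<in> X" for x using c that by (simp add: coordinates_def)
  have cc: "c x y = (if x = y then 1 else 0)" if "x \<in> X" "y \<in> X" for x y
    using c that by (simp add: coordinates_def)
  have cs: "c (s i) (s j) = (if i = j then 1 else 0)" for i j
    using cc s_mem inj_s by (auto dest: injD)
  have c_h_s: "c x (h (s j)) = c x (s j) - r j * c x (s (Suc j))" if "x \<in> X" for x j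
    using linD[OF lin[OF that]] s_mem by (simp add: h_s cl)
  have c_0: "c (s 0) (h v) = c (s 0) v" if "v \<in> univ F" for v
  proof (rule lin_eq_on_free[OF F lin_comp[OF lin h] lin _ that])
    fix x assume "x \<in> X"
    then show "c (s 0) (h x) = c (s 0) x"
      by (cases "x \<in> range s") (auto simp: h_other c_h_s s_mem cs)
  qed (use s_mem in auto)
  have c_Suc: "c (s (Suc i)) (h v) = c (s (Suc i)) v - c (s i) v * r i" if "v \<in> univ F" for v i
  proof (rule lin_eq_on_free[OF F lin_comp[OF lin h] lin_diff[OF lin lin_mult_right[OF lin]] _ that])
    fix x assume x: "x \<in> X"
    show "c (s (Suc i)) (h x) = c (s (Suc i)) x - c (s i) x * r i"
    proof (cases "x \<in> range s")
      case True
      then show ?thesis by (auto simp: c_h_s s_mem cs)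
    next
      case False
      then have "c (s i) x = 0" using cc[OF s_mem(1) x, of i] by auto
      with False x show ?thesis by (simp add: h_other)
    qed
  qed (use s_mem in auto)
  have c_other: "c x (h v) = c x v" if x: "x \<in> X" "x \<notin> range s" and v: "v \<in> univ F" for x v
  proof (rule lin_eq_on_free[OF F lin_comp[OF lin h] lin _ v])
    fix y assume y: "y \<in> X"
    have "c x (s i) = 0" for i using cc[OF x(1) s_mem(1), of i] x(2) by auto
    with x(1) y show "c x (h y) = c x y"
      by (cases "y \<in> range s") (auto simp: h_other c_h_s s_mem)
  qed (use x in auto)
  show ?thesis
  proof (rule inj_onI)
    fix v w assume v: "v \<in> univ F" and w: "w \<in> univ F" and eq: "h v = h w"
    have "c (s i) v = c (s i) w" for i
    proof (induction i)
      case 0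
      show ?case using c_0[OF v] c_0[OF w] eq by simp
    next
      case (Suc i)
      then show ?case using c_Suc[OF v, of i] c_Suc[OF w, of i] eq by simp
    qed
    then have "c x v = c x w" if "x \<in> X" for x
      using that c_other[OF that _ v] c_other[OF that _ w] eq by (cases "x \<in> range s") auto
    with c v w show "v = w" unfolding coordinates_def by blast
  qed
qed

abbreviation "img \<equiv> restr mod_ar F (h ` univ F)"

lemma image_closed: "closed_under mod_ar F (h ` univ F)" "h ` univ F \<subseteq> univ F"
  using homs_image_closed[OF h structures_closed[OF Fm(2)]] homs_closed[OF h] by auto

lemma h_iso: "h \<in> isos mod_ar F img"
  by (rule inj_homs_iso_image[OF h inj_h])

lemma image_structures: "img \<in> structures mod_ar"
  by (intro restr_structures Fm image_closed)

lemma free_on_image: "free_on mod_ar modules img (h ` X)"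
  by (rule free_on_isos[OF F h_iso image_structures])

lemma generated_image: "J \<subseteq> X \<Longrightarrow> generated mod_ar img (h ` J) = generated mod_ar F (h ` J)"
  using Fm by (intro generated_restr image_closed) auto

lemma inj_h_X: "inj_on h X"
  using inj_h Fm(3) by (rule inj_on_subset)

text \<open>The set \<open>J\<close> meets the branch only below \<open>m\<close>, so
  \<open>h\<close> acts on it like a finite twist, which carries \<open>X\<close> to another basis
  of \<open>F\<close>.\<close>

lemma ff_le_twist_image:
  assumes "J \<subseteq> X" "J \<inter> s ` {m..} = {}"
  shows "ff_le mod_ar modules (generated mod_ar F (h ` J)) F"
proof -
  have "h x = twist F s r {..<m} x" if "x \<in> J" for x
  proof (cases "x \<in> range s")
    case True
    then obtain i where i: "x = s i" by auto
    then have "i < m" using assms(2) that by (auto simp: not_le[symmetric])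
    then show ?thesis by (simp add: i h_s twist_simps[OF inj_s])
  next
    case False
    then show ?thesis using that assms(1) by (auto simp: h_other twist_def)
  qed
  then have "h ` J = twist F s r {..<m} ` J" by auto
  then show ?thesis
    using free_on_twist_finite[OF F infX inj_s s_X nontriv, of r m] assms(1)
    by (auto intro!: ff_le_generated)
qed

text \<open>The element \<open>s (Suc i)\<close> needed for the image of \<open>s i\<close> is again
  in \<open>Y\<close>, so \<open>h\<close> preserves the submodule on \<open>Y\<close>. This allows
  passing from a large \<open>F\<close> to a countable submodule, where (RCP) can be
  witnessed.\<close>

lemma twisted_subset:
  assumes "Y \<subseteq> X" "range s \<subseteq> Y"
  shows "twisted (generated mod_ar F Y) Y s r (restrict h (univ (generated mod_ar F Y)))"
proof
  let ?B = "generated mod_ar F Y"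
  have Y: "Y \<subseteq> univ F" using assms Fm by auto
  have sub: "substructure mod_ar ?B F" by (intro substructure_generated Fm Y)
  show B: "free_on mod_ar modules ?B Y" by (rule free_on_generated[OF F assms(1)])
  show "infinite Y" using assms(2) inj_s range_inj_infinite infinite_super by blast
  have YB: "y \<in> univ ?B" if "y \<in> Y" for y using free_onD(3)[OF B] that by auto
  have ops: "x \<in> univ ?B \<Longrightarrow> y \<in> univ ?B \<Longrightarrow> pl ?B x y = pl F x y"
    "x \<in> univ ?B \<Longrightarrow> ng ?B x = ng F x" "x \<in> univ ?B \<Longrightarrow> sc ?B a x = sc F a x" for x y a
    using substructureD(4)[OF sub, of "[x, y]" Plus] substructureD(4)[OF sub, of "[x]" Minus]
      substructureD(4)[OF sub, of "[x]" "Scale a"] by auto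
  note clB = modules_closed[OF free_onD(1)[OF B]]
  have tw: "twist ?B s r UNIV y = twist F s r UNIV y" if "y \<in> Y" for y
  proof (cases "y \<in> range s")
    case True
    then obtain i where i: "y = s i" by auto
    have "s i \<in> univ ?B" "s (Suc i) \<in> univ ?B" using YB assms(2) by auto
    then show ?thesis
      using clB(4)[of "s (Suc i)" "r i"] clB(3)[of "sc ?B (r i) (s (Suc i))"]
      by (simp add: i twist_simps[OF inj_s] ops)
  qed (simp add: twist_def)
  have tY: "twist F s r UNIV y \<in> univ ?B" if "y \<in> Y" for y
  proof (cases "y \<in> range s")
    case True
    then obtain i where i: "y = s i" by auto
    have "s i \<in> univ ?B" "s (Suc i) \<in> univ ?B" using YB assms(2) by auto
    then have "twist ?B s r UNIV (s i) \<in> univ ?B" by (simp add: twist_simps[OF inj_s] clB)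
    then show ?thesis using tw[OF that] i by simp
  qed (simp add: twist_def YB that)
  have "h ` univ ?B = span mod_ar F (h ` Y)"
    unfolding univ_generated by (rule homs_image_span[OF h Fm(2,2) Y])
  also have "\<dots> \<subseteq> univ ?B"
    unfolding univ_generated
    using tY h_X assms(1) by (intro span_mono Fm Y) (auto simp: univ_generated)
  finally have "restrict h (univ ?B) ` univ ?B \<subseteq> univ ?B" by auto
  from homs_codomain[OF homs_restrict[OF h sub] this]
  show "restrict h (univ ?B) \<in> homs mod_ar ?B ?B"
    using substructure_eq_restr[OF sub] by simp
  show "restrict h (univ ?B) y = twist ?B s r UNIV y" if "y \<in> Y" for y
    using that YB tw h_X assms(1) by auto
qed (use inj_s assms nontriv in auto)

end

section \<open>Closure properties of the quantifier-free definable closure\<close>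

text \<open>Renamings combine formulas into one about a longer tuple, with the variables kept apart
  or identified as required.\<close>

primrec ren :: "(nat \<Rightarrow> nat) \<Rightarrow> ('f, 'u) trm \<Rightarrow> ('f, 'u) trm" where
  "ren \<sigma> (Var i) = Var (\<sigma> i)"
| "ren \<sigma> (Par c) = Par c"
| "ren \<sigma> (App f ts) = App f (map (ren \<sigma>) ts)"

primrec ren_qf :: "(nat \<Rightarrow> nat) \<Rightarrow> ('f, 'u) qf \<Rightarrow> ('f, 'u) qf" where
  "ren_qf \<sigma> (Eq s t) = Eq (ren \<sigma> s) (ren \<sigma> t)"
| "ren_qf \<sigma> (Neg \<phi>) = Neg (ren_qf \<sigma> \<phi>)"
| "ren_qf \<sigma> (Conj \<phi> \<psi>) = Conj (ren_qf \<sigma> \<phi>) (ren_qf \<sigma> \<psi>)"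

lemma ren_over:
  "t \<in> trm_over ar n C \<Longrightarrow> (\<And>i. i < n \<Longrightarrow> \<sigma> i < n') \<Longrightarrow> ren \<sigma> t \<in> trm_over ar n' C"
  by (induction rule: trm_over.induct) (auto intro!: trm_over.intros)

lemma ren_qf_over:
  "qf_over ar n C \<phi> \<Longrightarrow> (\<And>i. i < n \<Longrightarrow> \<sigma> i < n') \<Longrightarrow> qf_over ar n' C (ren_qf \<sigma> \<phi>)"
  by (induction \<phi>) (auto intro: ren_over)

lemma ren_val:
  "t \<in> trm_over ar n C \<Longrightarrow> (\<And>i. i < n \<Longrightarrow> xs ! \<sigma> i = ys ! i) \<Longrightarrow> trm_val M xs (ren \<sigma> t) = trm_val M ys t"
proof (induction rule: trm_over.induct)
  case (3 ts f)
  then have "map (trm_val M xs \<circ> ren \<sigma>) ts = map (trm_val M ys) ts" by auto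
  then show ?case by (simp del: map_eq_conv)
qed auto

lemma ren_qf_sat:
  "qf_over ar n C \<phi> \<Longrightarrow> (\<And>i. i < n \<Longrightarrow> xs ! \<sigma> i = ys ! i) \<Longrightarrow> qf_sat M xs (ren_qf \<sigma> \<phi>) \<longleftrightarrow> qf_sat M ys \<phi>"
  by (induction \<phi>) (auto simp: ren_val[of _ ar n C xs \<sigma> ys])

definition solutions :: "('f, 'u) struc \<Rightarrow> nat \<Rightarrow> ('f, 'u) qf \<Rightarrow> 'u list set" where
  "solutions M n \<phi> = {xs. length xs = n \<and> set xs \<subseteq> univ M \<and> qf_sat M xs \<phi>}"

lemma dcl_qfI:
  "qf_over ar n C \<phi> \<Longrightarrow> solutions M n \<phi> = {bs} \<Longrightarrow> b \<in> set bs \<Longrightarrow> b \<in> dcl_qf ar M C"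
  unfolding dcl_qf_def solutions_def by blast

lemma dcl_qfE:
  assumes "b \<in> dcl_qf ar M C"
  obtains n \<phi> bs where "qf_over ar n C \<phi>" "solutions M n \<phi> = {bs}" "b \<in> set bs"
  using assms unfolding dcl_qf_def solutions_def by blast

lemma solutions_Conj:
  assumes "qf_over ar n C \<phi>" "qf_over ar m C \<psi>"
  shows "solutions M (n + m) (Conj (ren_qf id \<phi>) (ren_qf ((+) n) \<psi>)) =
    {xs @ ys | xs ys. xs \<in> solutions M n \<phi> \<and> ys \<in> solutions M m \<psi>}" (is "?L = ?R")
proof
  have *: "qf_sat M (xs @ ys) (ren_qf id \<phi>) = qf_sat M xs \<phi>"
      "qf_sat M (xs @ ys) (ren_qf ((+) n) \<psi>) = qf_sat M ys \<psi>"
    if "length xs = n" "length ys = m" for xs ys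
    using that by (auto intro!: ren_qf_sat[OF assms(1)] ren_qf_sat[OF assms(2)] simp: nth_append)
  show "?R \<subseteq> ?L" using * by (auto simp: solutions_def)
  show "?L \<subseteq> ?R"
  proof
    fix zs assume z: "zs \<in> ?L"
    then have "zs = take n zs @ drop n zs" "length (take n zs) = n" "length (drop n zs) = m"
      by (auto simp: solutions_def)
    then obtain xs ys where "zs = xs @ ys" "length xs = n" "length ys = m" by blast
    with z * show "zs \<in> ?R" by (auto simp: solutions_def)
  qed
qed

lemma dcl_qf_subset: "dcl_qf ar M C \<subseteq> univ M"
proof
  fix b assume "b \<in> dcl_qf ar M C"
  then obtain n \<phi> bs where "solutions M n \<phi> = {bs}" "b \<in> set bs" by (rule dcl_qfE)
  then have "bs \<in> solutions M n \<phi>" "b \<in> set bs" by auto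
  then show "b \<in> univ M" by (auto simp: solutions_def)
qed

text \<open>Defining formulas of the entries are conjoined in disjoint variables. The empty tuple is
  defined by the true formula \<open>Eq (Par c) (Par c)\<close> in no variables, for which a
  parameter \<open>c\<close> is taken.\<close>

lemma dcl_qf_tuple:
  assumes "set ds \<subseteq> dcl_qf ar M C" "c \<in> C"
  obtains n \<phi> bs where "qf_over ar n C \<phi>" "solutions M n \<phi> = {bs}" "set ds \<subseteq> set bs"
proof -
  have "\<exists>n \<phi> bs. qf_over ar n C \<phi> \<and> solutions M n \<phi> = {bs} \<and> set ds \<subseteq> set bs"
    using assms(1)
  proof (induction ds)
    case Nil
    have "solutions M 0 (Eq (Par c) (Par c)) = {[]}" by (auto simp: solutions_def)
    moreover have "qf_over ar 0 C (Eq (Par c) (Par c))"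
      using assms(2) by (auto intro: trm_over.intros)
    ultimately show ?case by (metis empty_subsetI list.set(1))
  next
    case (Cons d ds)
    then obtain n \<phi> bs where 1: "qf_over ar n C \<phi>" "solutions M n \<phi> = {bs}" "set ds \<subseteq> set bs"
      by auto
    obtain m \<psi> cs where 2: "qf_over ar m C \<psi>" "solutions M m \<psi> = {cs}" "d \<in> set cs"
      using Cons.prems by (auto elim: dcl_qfE)
    have "qf_over ar (n + m) C (Conj (ren_qf id \<phi>) (ren_qf ((+) n) \<psi>))"
      using 1 2 by (auto intro!: ren_qf_over)
    moreover have "solutions M (n + m) (Conj (ren_qf id \<phi>) (ren_qf ((+) n) \<psi>)) = {bs @ cs}"
      using 1(2) 2(2) by (auto simp: solutions_Conj[OF 1(1) 2(1)])
    ultimately show ?case using 1(3) 2(3)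
      by (intro exI[of _ "n + m"] exI[of _ "bs @ cs"] exI conjI) auto
  qed
  with that show ?thesis by blast
qed

text \<open>A form of transitivity: in \<open>\<psi>\<close> the elements \<open>ds\<close> of the
  closure are values of variables, and only elements of \<open>C\<close> occur as
  parameters.\<close>

lemma dcl_qf_solution:
  assumes "set ds \<subseteq> dcl_qf ar M C" "c \<in> C" "qf_over ar (Suc (length ds)) C \<psi>"
    "b \<in> univ M" "\<And>x. x \<in> univ M \<Longrightarrow> qf_sat M (ds @ [x]) \<psi> \<longleftrightarrow> x = b"
  shows "b \<in> dcl_qf ar M C"
proof -
  obtain n \<phi> bs where b: "qf_over ar n C \<phi>" "solutions M n \<phi> = {bs}" "set ds \<subseteq> set bs"
    using dcl_qf_tuple[OF assms(1,2)] .
  have lb: "length bs = n" "set bs \<subseteq> univ M" using equalityD2[OF b(2)] by (auto simp: solutions_def)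
  have "\<exists>k<n. bs ! k = ds ! i" if "i < length ds" for i
    using that b(3) lb by (metis in_set_conv_nth nth_mem subsetD)
  then obtain \<sigma> where \<sigma>: "\<And>i. i < length ds \<Longrightarrow> \<sigma> i < n \<and> bs ! \<sigma> i = ds ! i" by metis
  \<comment> \<open>Variable \<open>i\<close> of \<open>\<psi>\<close> moves to a position of
    \<open>bs\<close> occupied by \<open>ds ! i\<close>; its last variable becomes the new last
    entry of the tuple.\<close>
  let ?\<sigma> = "\<lambda>i. if i < length ds then \<sigma> i else n"
  let ?\<chi> = "Conj (ren_qf id \<phi>) (ren_qf ?\<sigma> \<psi>)"
  have "qf_over ar (Suc n) C ?\<chi>"
    using b(1) assms(3) \<sigma> by (auto intro!: ren_qf_over simp: less_SucI)
  moreover have "solutions M (Suc n) ?\<chi> = {bs @ [b]}"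
  proof -
    have sat: "qf_sat M (ys @ [x]) (ren_qf id \<phi>) \<longleftrightarrow> qf_sat M ys \<phi>" if "length ys = n" for ys x
      using that by (intro ren_qf_sat[OF b(1)]) (auto simp: nth_append)
    have sat': "qf_sat M (bs @ [x]) (ren_qf ?\<sigma> \<psi>) \<longleftrightarrow> qf_sat M (ds @ [x]) \<psi>" for x
      using lb \<sigma> by (intro ren_qf_sat[OF assms(3)]) (auto simp: nth_append less_Suc_eq)
    have bs: "qf_sat M ys \<phi> \<longleftrightarrow> ys = bs" if "length ys = n" "set ys \<subseteq> univ M" for ys
      using b(2) that by (auto simp: solutions_def set_eq_iff)
    have "xs \<in> solutions M (Suc n) ?\<chi> \<longleftrightarrow> xs = bs @ [b]" for xs
    proof (cases "length xs = Suc n \<and> set xs \<subseteq> univ M")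
      case True
      then obtain ys x where xs: "xs = ys @ [x]" by (cases xs rule: rev_cases) auto
      with True have y: "length ys = n" "set ys \<subseteq> univ M" "x \<in> univ M" by auto
      then have "xs \<in> solutions M (Suc n) ?\<chi> \<longleftrightarrow> ys = bs \<and> qf_sat M (bs @ [x]) (ren_qf ?\<sigma> \<psi>)"
        using sat[OF y(1)] bs[OF y(1,2)] by (auto simp: solutions_def xs)
      then show ?thesis using sat' assms(5)[OF y(3)] xs by auto
    next
      case False
      then show ?thesis using lb assms(4) by (auto simp: solutions_def)
    qed
    then show ?thesis by blast
  qed
  ultimately show ?thesis by (rule dcl_qfI) simp
qed

lemma dcl_qf_base:
  assumes "C \<subseteq> univ M"
  shows "C \<subseteq> dcl_qf ar M C"
proof
  fix c assume c: "c \<in> C"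
  then show "c \<in> dcl_qf ar M C"
    using assms by (intro dcl_qf_solution[of "[]" ar M C c "Eq (Var 0) (Par c)"])
      (auto intro: trm_over.intros)
qed

text \<open>The value of an operation is the only solution of an equation between the last variable
  and a term in the arguments.\<close>

lemma dcl_qf_closed:
  assumes "M \<in> structures ar" "C \<noteq> {}"
  shows "closed_under ar M (dcl_qf ar M C)"
  unfolding closed_under_def
proof (intro allI impI)
  fix f xs assume x: "set xs \<subseteq> dcl_qf ar M C \<and> length xs = ar f"
  obtain c where c: "c \<in> C" using assms(2) by blast
  let ?n = "length xs"
  have m: "map (trm_val M (xs @ [y]) \<circ> Var) [0..<?n] = xs" for y
    by (rule nth_equalityI) (auto simp: nth_append)
  show "opn M f xs \<in> dcl_qf ar M C"
  proof (rule dcl_qf_solution[of xs ar M C c "Eq (Var ?n) (App f (map Var [0..<?n]))"])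
    show "qf_over ar (Suc ?n) C (Eq (Var ?n) (App f (map Var [0..<?n])))"
      using x by (auto intro!: trm_over.intros)
    show "opn M f xs \<in> univ M"
      using x dcl_qf_subset[of ar M C] by (intro structures_opn[OF assms(1)]) auto
    show "qf_sat M (xs @ [y]) (Eq (Var ?n) (App f (map Var [0..<?n]))) \<longleftrightarrow> y = opn M f xs" for y
      using m[of y] by simp
  qed (use x c in auto)
qed

section \<open>Automorphisms and definable closure\<close>

lemma trm_val_auts:
  assumes "g \<in> auts ar M" "M \<in> structures ar" "C \<subseteq> univ M" "set xs \<subseteq> univ M" "t \<in> trm_over ar (length xs) C"
  shows "trm_val M xs t \<in> univ M \<and> trm_val M (map g xs) (map_trm (\<lambda>a. a) g t) = g (trm_val M xs t)
    \<and> map_trm (\<lambda>a. a) g t \<in> trm_over ar (length xs) (g ` C)"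
  using assms(5)
proof (induction rule: trm_over.induct)
  case (3 ts f)
  have g: "g \<in> homs ar M M" using assms(1) by (auto simp: auts_def isos_def)
  have s: "set (map (trm_val M xs) ts) \<subseteq> univ M" using 3 by auto
  have e: "map (trm_val M (map g xs) \<circ> map_trm (\<lambda>a. a) g) ts = map g (map (trm_val M xs) ts)"
    using 3 by auto
  have "opn M f (map (trm_val M xs) ts) \<in> univ M"
    using 3 by (intro structures_opn[OF assms(2) s]) simp
  moreover have "g (opn M f (map (trm_val M xs) ts)) = opn M f (map g (map (trm_val M xs) ts))"
    using 3 by (intro homs_opn[OF g s]) simp
  moreover have "map_trm (\<lambda>a. a) g (App f ts) \<in> trm_over ar (length xs) (g ` C)"
    using 3 by (auto intro!: trm_over.intros)
  ultimately show ?case using e by (simp only: trm_val.simps trm.map map_map simp_thms)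
qed (use assms in \<open>auto intro: trm_over.intros\<close>)

lemma qf_auts:
  assumes "g \<in> auts ar M" "M \<in> structures ar" "C \<subseteq> univ M" "set xs \<subseteq> univ M" "qf_over ar (length xs) C \<phi>"
  shows "(qf_sat M (map g xs) (map_qf (\<lambda>a. a) g \<phi>) \<longleftrightarrow> qf_sat M xs \<phi>)
    \<and> qf_over ar (length xs) (g ` C) (map_qf (\<lambda>a. a) g \<phi>)"
  using assms(5)
proof (induction \<phi>)
  case (Eq s t)
  have "inj_on g (univ M)" using assms(1) by (auto simp: auts_def isos_def bij_betw_def)
  then show ?case
    using Eq trm_val_auts[OF assms(1-4), of s] trm_val_auts[OF assms(1-4), of t]
    by (auto dest: inj_onD)
qed auto

text \<open>Replacing the parameters of a formula by their images replaces its solution set by the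
  image under \<open>g\<close>, so a unique solution stays unique.\<close>

lemma dcl_qf_auts:
  assumes "g \<in> auts ar M" "M \<in> structures ar" "C \<subseteq> univ M" "b \<in> dcl_qf ar M C"
  shows "g b \<in> dcl_qf ar M (g ` C)"
proof -
  obtain n \<phi> bs where b: "qf_over ar n C \<phi>" "solutions M n \<phi> = {bs}" "b \<in> set bs"
    using assms(4) by (rule dcl_qfE)
  have bs: "length bs = n" "set bs \<subseteq> univ M" using equalityD2[OF b(2)] by (auto simp: solutions_def)
  have gM: "g ` univ M = univ M" using assms(1) by (auto simp: auts_def isos_def bij_betw_def)
  have "ys \<in> solutions M n (map_qf (\<lambda>a. a) g \<phi>) \<longleftrightarrow> ys = map g bs" for ys
  proof
    assume y: "ys \<in> solutions M n (map_qf (\<lambda>a. a) g \<phi>)"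
    then have "ys \<in> lists (g ` univ M)" unfolding gM by (auto simp: solutions_def)
    then obtain xs where xs: "ys = map g xs" "set xs \<subseteq> univ M" by (auto simp: lists_image)
    then have "xs \<in> solutions M n \<phi>"
      using y qf_auts[OF assms(1-3) xs(2)] b(1) by (auto simp: solutions_def)
    then show "ys = map g bs" using b(2) xs by auto
  next
    assume "ys = map g bs"
    moreover have "bs \<in> solutions M n \<phi>" using b(2) by auto
    ultimately show "ys \<in> solutions M n (map_qf (\<lambda>a. a) g \<phi>)"
      using bs qf_auts[OF assms(1-3) bs(2)] b(1) gM by (auto simp: solutions_def)
  qed
  then have "solutions M n (map_qf (\<lambda>a. a) g \<phi>) = {map g bs}" by blast
  moreover have "qf_over ar n (g ` C) (map_qf (\<lambda>a. a) g \<phi>)"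
    using qf_auts[OF assms(1-3) bs(2)] b(1) bs by simp
  ultimately show ?thesis using b(3) by (intro dcl_qfI) auto
qed

section \<open>Witnesses of the Reinforced Construction Principle\<close>

lemma free_on_countable:
  fixes F :: "('r :: {ring, monoid_mult, countable} mod_sym, 'u) struc"
  assumes "free_on mod_ar modules F X" "infinite X" "countable X" "(1 :: 'r) \<noteq> 0"
  shows "countable (univ F)"
proof -
  have "|univ F| \<le>o |X|" using free_coordinates[OF assms(1,2,4)] by blast
  then obtain f where "inj_on f (univ F)" "f ` univ F \<subseteq> X" by (auto simp: card_of_ordLeq[symmetric])
  then show ?thesis using assms(3) countable_subset countable_image_inj_on by metis
qed

section \<open>The axioms of abstract elementary classes in usable form, and an enumeration\<close>

lemma AEC_coherence:
  fixes le :: "('f, 'u) struc \<Rightarrow> ('f, 'u) struc \<Rightarrow> bool"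
  assumes "AEC ar K le" "le A C" "le B C" "substructure ar A B"
  shows "le A B"
proof -
  have "\<forall>A B C. le A C \<and> le B C \<and> substructure ar A B \<longrightarrow> le A B"
    using assms(1) unfolding AEC_def by - (elim conjE, assumption)
  then show ?thesis using assms(2-4) by blast
qed

lemma AEC_chain_le:
  fixes le :: "('f, 'u) struc \<Rightarrow> ('f, 'u) struc \<Rightarrow> bool"
  assumes "AEC ar K le" "cont_chain ar K le r A" "is_union ar (Field r) A U"
    "B \<in> K" "\<And>i. i \<in> Field r \<Longrightarrow> le (A i) B"
  shows "le U B"
proof -
  have "\<forall>r A U. cont_chain ar K le r A \<and> is_union ar (Field r) A U \<longrightarrow>
      U \<in> K \<and> (\<forall>j \<in> Field r. le (A j) U) \<and> (\<forall>B \<in> K. (\<forall>i \<in> Field r. le (A i) B) \<longrightarrow> le U B)"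
    using assms(1) unfolding AEC_def by - (elim conjE, assumption)
  then show ?thesis using assms(2-5) by blast
qed

lemma AEC_trans:
  fixes le :: "('f, 'u) struc \<Rightarrow> ('f, 'u) struc \<Rightarrow> bool"
  assumes "AEC ar K le" "le A B" "le B C"
  shows "le A C"
proof -
  have "\<forall>A B. le A B \<longrightarrow> A \<in> K \<and> B \<in> K" "transp_on K le"
    using assms(1) unfolding AEC_def by - (elim conjE, assumption)+
  then show ?thesis using assms(2,3) by (meson transp_onD)
qed

lemma AEC_substructure:
  fixes le :: "('f, 'u) struc \<Rightarrow> ('f, 'u) struc \<Rightarrow> bool"
  assumes "AEC ar K le" "le A B"
  shows "substructure ar A B"
proof -
  have "\<forall>A B. le A B \<longrightarrow> substructure ar A B"
    using assms(1) unfolding AEC_def by - (elim conjE, assumption)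
  then show ?thesis using assms(2) by blast
qed

text \<open>Any enumeration serves after exchanging the index of \<open>x\<close> with 0.\<close>

lemma enumeration_with_start:
  assumes "infinite X" "countable X" "x \<in> X"
  obtains b :: "nat \<Rightarrow> 'a" where "inj b" "range b = X" "b 0 = x"
proof -
  have y: "bij_betw (from_nat_into X) UNIV X" using assms by (intro bij_betw_from_nat_into)
  obtain k where k: "from_nat_into X k = x"
    using bij_betw_imp_surj_on[OF y] assms(3) by (metis imageE)
  let ?t = "\<lambda>i. if i = 0 then k else if i = k then 0 else i"
  have "bij ?t" by (rule involuntory_imp_bij) auto
  then have "bij_betw (from_nat_into X \<circ> ?t) UNIV X" using y by (rule bij_betw_trans)
  then show ?thesis using k by (intro that[of "from_nat_into X \<circ> ?t"]) (auto simp: bij_betw_def)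
qed

lemma free_algs_infI: "free_on ar V F X \<Longrightarrow> infinite X \<Longrightarrow> F \<in> free_algs_inf ar V"
  by (auto simp: free_algs_inf_def)

section \<open>The image of the twisted endomorphism as a submodule\<close>

context twisted
begin

lemma infinite_h_image: "Y \<subseteq> X \<Longrightarrow> infinite Y \<Longrightarrow> infinite (h ` Y)"
  using inj_h_X by (metis finite_imageD inj_on_subset)

lemma free_on_generated_image: "J \<subseteq> X \<Longrightarrow> free_on mod_ar modules (generated mod_ar F (h ` J)) (h ` J)"
  using free_on_generated[OF free_on_image, of "h ` J"] by (auto simp: generated_image)

text \<open>Cancelling \<open>r i\<close> in every coordinate makes \<open>s (Suc i)\<close> the
  only solution of its equation, so the branch is defined step by step from \<open>s 0\<close>.
  Basis elements off the branch are fixed by \<open>h\<close> and lie in the image.\<close>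

lemma dcl_image:
  assumes cancel: "\<And>i x. r i * x = 0 \<Longrightarrow> x = 0"
  shows "dcl_qf mod_ar F (h ` univ F \<union> {s 0}) = univ F" (is "?D = _")
proof
  show "?D \<subseteq> univ F" by (rule dcl_qf_subset)
  let ?C = "h ` univ F \<union> {s 0}"
  obtain c where c: "coordinates F X c" using free_coordinates[OF F infX nontriv] by blast
  have lin: "lin F (c x)" if "x \<in> X" for x using c that by (simp add: coordinates_def)
  have C: "?C \<subseteq> univ F" using image_closed s_mem by auto
  have base: "?C \<subseteq> ?D" by (rule dcl_qf_base[OF C])
  have s: "s i \<in> ?D" for i
  proof (induction i)
    case 0
    show ?case using base by auto
  next
    case (Suc i)
    \<comment> \<open>\<open>Var 0\<close> takes the value \<open>s i\<close>, in the closure by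
      induction, and \<open>Var 1\<close> is the unknown. Only \<open>h (s i)\<close> is a
      parameter.\<close>
    let ?\<psi> = "Eq (Par (h (s i))) (App Plus [Var 0, App Minus [App (Scale (r i)) [Var 1]]])"
    show ?case
    proof (rule dcl_qf_solution[of "[s i]" mod_ar F ?C "s 0" ?\<psi>])
      show "qf_over mod_ar (Suc (length [s i])) ?C ?\<psi>"
        using s_mem by (auto intro!: trm_over.intros)
      fix x assume x: "x \<in> univ F"
      have "x = s (Suc i)" if eq: "h (s i) = pl F (s i) (ng F (sc F (r i) x))"
      proof -
        have "c y x = c y (s (Suc i))" if y: "y \<in> X" for y
        proof -
          have "c y (s i) - r i * c y (s (Suc i)) = c y (s i) - r i * c y x"
            using arg_cong[OF eq, of "c y"] linD[OF lin[OF y]] x s_mem by (simp add: h_s cl)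
          then have "r i * (c y x - c y (s (Suc i))) = 0" by (simp add: algebra_simps)
          then show ?thesis using cancel by fastforce
        qed
        then show ?thesis using c x s_mem unfolding coordinates_def by blast
      qed
      then show "qf_sat F ([s i] @ [x]) ?\<psi> \<longleftrightarrow> x = s (Suc i)" by (auto simp: h_s)
    qed (use Suc s_mem in auto)
  qed
  have "x \<in> ?D" if "x \<in> X" for x
  proof (cases "x \<in> range s")
    case True
    then show ?thesis using s by auto
  next
    case False
    then have "x \<in> h ` univ F" using h_other[OF that] that Fm(3) by (metis image_eqI subsetD)
    then show ?thesis using base by auto
  qed
  then have "span mod_ar F X \<subseteq> ?D"
    by (intro span_minimal dcl_qf_subset dcl_qf_closed Fm) auto
  then show "univ F \<subseteq> ?D" using Fm by simp
qed

text \<open>A retraction fixes \<open>h (s i)\<close>; applying it to the defining equation of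
  \<open>h (s i)\<close> and taking the coordinate at \<open>h (s j)\<close> gives the recurrence of
  \<open>prod_right_unit_stabilises\<close> for all \<open>j\<close>.\<close>

lemma image_no_retract:
  assumes nzd: "\<And>m. \<not> zero_divisor (prod_list (map r [0..<Suc m]))"
    and unstable: "\<nexists>k. \<forall>m\<ge>k. range ((*) (prod_list (map r [0..<Suc m]))) =
          range ((*) (prod_list (map r [0..<Suc k])))"
    and \<rho>: "\<rho> \<in> homs mod_ar F img"
  shows "\<not> (\<forall>x\<in>univ img. \<rho> x = x)"
proof
  assume id: "\<forall>x\<in>univ img. \<rho> x = x"
  obtain c where c: "coordinates img (h ` X) c"
    using free_coordinates[OF free_on_image infinite_h_image[OF subset_refl infX] nontriv] by blast
  have lin: "lin img (c (h (s j)))" for j using c s_mem by (simp add: coordinates_def)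
  have hs: "h (s i) \<in> univ img" for i using s_mem by simp
  have \<rho>_img: "\<rho> x \<in> univ img" if "x \<in> univ F" for x using homs_closed[OF \<rho> that] .
  note cl_img = modules_closed[OF free_onD(1)[OF free_on_image]]
  define a where "a j i = c (h (s j)) (\<rho> (s i))" for j i
  have "a j i = r i * a j (Suc i) + (if i = j then 1 else 0)" for j i
  proof -
    have "h (s i) = \<rho> (h (s i))" using id hs[of i] by metis
    also have "\<dots> = pl img (\<rho> (s i)) (ng img (sc img (r i) (\<rho> (s (Suc i)))))"
      using s_mem by (simp add: h_s homs_mod[OF \<rho>] cl)
    finally have "c (h (s j)) (h (s i)) = a j i - r i * a j (Suc i)"
      using linD[OF lin] \<rho>_img s_mem cl_img by (simp add: a_def)
    moreover have "c (h (s j)) (h (s i)) = (if i = j then 1 else 0)"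
    proof -
      have "h (s j) = h (s i) \<longleftrightarrow> i = j"
        using inj_on_eq_iff[OF inj_h s_mem(2) s_mem(2), of j i] inj_eq[OF inj_s] by auto
      then show ?thesis using c s_mem(1) by (auto simp: coordinates_def)
    qed
    ultimately show ?thesis by (simp add: algebra_simps)
  qed
  moreover have "finite {j. a j 0 \<noteq> 0}"
  proof -
    have "finite {x \<in> h ` X. c x (\<rho> (s 0)) \<noteq> 0}"
      using c \<rho>_img[OF s_mem(2)] unfolding coordinates_def by blast
    moreover have "(\<lambda>j. h (s j)) ` {j. a j 0 \<noteq> 0} \<subseteq> {x \<in> h ` X. c x (\<rho> (s 0)) \<noteq> 0}"
      using s_mem by (auto simp: a_def)
    moreover have "inj (\<lambda>j. h (s j))"
      using inj_h s_mem inj_s by (auto intro!: injI dest!: inj_onD dest: injD)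
    ultimately show ?thesis by (meson finite_imageD finite_subset inj_on_subset subset_UNIV)
  qed
  ultimately show False
    using prod_right_unit_stabilises[of r 0 a] nzd unstable by blast
qed

lemma RCP_pair_image:
  assumes nzd: "\<And>m. \<not> zero_divisor (prod_list (map r [0..<Suc m]))"
    and unstable: "\<nexists>k. \<forall>m\<ge>k. range ((*) (prod_list (map r [0..<Suc m]))) =
          range ((*) (prod_list (map r [0..<Suc k])))"
    and cX: "countable X"
  shows "RCP_pair mod_ar modules img F (s 0)"
  unfolding RCP_pair_def
proof (intro conjI allI impI)
  show "img \<in> free_algs_inf mod_ar modules"
    by (rule free_algs_infI[OF free_on_image infinite_h_image[OF subset_refl infX]])
  show "F \<in> free_algs_inf mod_ar modules" by (rule free_algs_infI[OF F infX])
  show "countable (univ F)" by (rule free_on_countable[OF F infX cX nontriv])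
  then show "countable (univ img)" by simp
  show "substructure mod_ar img F" by (intro substructure_restr Fm image_closed)
  \<comment> \<open>One enumeration serves twice: \<open>y\<close> starts at the distinguished
    element of clause (c), and \<open>h \<circ> y\<close> enumerates the basis of the image for
    clause (a).\<close>
  obtain y :: "nat \<Rightarrow> 'u" where y: "inj y" "range y = X" "y 0 = s 0"
    using enumeration_with_start[OF infX cX s_mem(1)] .
  show "\<exists>a :: nat \<Rightarrow> 'u. inj a \<and> free_on mod_ar modules img (range a) \<and>
    (\<forall>i. ff_le mod_ar modules (generated mod_ar F (a ` {..i})) F)"
  proof (intro exI[of _ "h \<circ> y"] conjI allI)
    show "inj (h \<circ> y)" using y inj_h_X by (simp add: comp_inj_on)
    show "free_on mod_ar modules img (range (h \<circ> y))"
      using free_on_image unfolding image_comp[symmetric] y(2) .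
    fix i
    \<comment> \<open>Only finitely many branch elements occur among the first \<open>i + 1\<close>
      basis elements, so some \<open>m\<close> bounds their positions on the branch.\<close>
    have "finite (s -` (y ` {..i}))" using inj_s by (intro finite_vimageI) auto
    then obtain m where m: "\<forall>k\<in>s -` (y ` {..i}). k < m"
      using finite_nat_set_iff_bounded by blast
    have "y ` {..i} \<inter> s ` {m..} = {}"
    proof (rule ccontr)
      assume "y ` {..i} \<inter> s ` {m..} \<noteq> {}"
      then obtain x where "x \<in> y ` {..i}" "x \<in> s ` {m..}" by blast
      then obtain k where "s k \<in> y ` {..i}" "m \<le> k" by (metis atLeast_iff imageE)
      with m show False by (metis not_le vimageI)
    qed
    then have "ff_le mod_ar modules (generated mod_ar F (h ` (y ` {..i}))) F"
      using y(2) by (intro ff_le_twist_image) auto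
    then show "ff_le mod_ar modules (generated mod_ar F ((h \<circ> y) ` {..i})) F"
      by (simp add: image_comp)
  qed
  show "\<exists>b :: nat \<Rightarrow> 'u. inj b \<and> free_on mod_ar modules F (range b) \<and> b 0 = s 0 \<and>
    dcl_qf mod_ar F (univ img \<union> {s 0}) = univ F"
  proof (intro exI[of _ y] conjI)
    have "x = 0" if "r i * x = 0" for i x
    proof (rule ccontr)
      assume "x \<noteq> 0"
      moreover have "prod_list (map r [0..<Suc i]) * x = 0" using that by (simp add: mult.assoc)
      ultimately show False using nzd[of i] unfolding zero_divisor_def by blast
    qed
    then show "dcl_qf mod_ar F (univ img \<union> {s 0}) = univ F" using dcl_image by simp
  qed (use y F in auto)
  fix C D assume CD: "C \<in> free_algs mod_ar modules \<and> free_prod mod_ar modules F C D"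
  show "\<not> ff_le mod_ar modules img D"
  proof
    assume "ff_le mod_ar modules img D"
    then obtain \<rho> where \<rho>: "\<rho> \<in> homs mod_ar D img" "\<And>x. x \<in> univ img \<Longrightarrow> \<rho> x = x"
      by (rule ff_le_retraction) blast
    \<comment> \<open>A retraction defined on the free product \<open>D\<close> restricts to one
      defined on \<open>F\<close>.\<close>
    have "substructure mod_ar F D" using CD by (auto simp: free_prod_def)
    then have "restrict \<rho> (univ F) \<in> homs mod_ar F img" by (rule homs_restrict[OF \<rho>(1)])
    moreover have "restrict \<rho> (univ F) x = x" if "x \<in> univ img" for x
      using \<rho>(2)[OF that] that image_closed(2) by auto
    ultimately show False using image_no_retract[OF nzd unstable] by blast
  qed
qed

text \<open>\<open>J m\<close> omits the tail of the branch from \<open>m\<close> on, so the images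
  of the \<open>J m\<close> span free factors of \<open>F\<close> that increase to the whole image.
  The basis elements off the branch keep each \<open>J m\<close> infinite, which puts these factors
  into \<open>K\<close>.\<close>

lemma le_image:
  fixes le :: "('r mod_sym, 'u) struc \<Rightarrow> ('r mod_sym, 'u) struc \<Rightarrow> bool"
  assumes cov: "AEC_covering mod_ar modules K le" and inf: "infinite (X - range s)"
    and inacc: "natLeq <o |UNIV :: 'u set|"
  shows "le img F"
proof -
  define J where "J m = X - s ` {m..}" for m
  define A where "A x = generated mod_ar F (h ` J (inv_into UNIV s x))" for x
  \<comment> \<open>The index order of a chain must live on \<open>'u\<close>, so the order type of
    the natural numbers is carried over along \<open>s\<close>.\<close>
  let ?R = "dir_image natLeq s"
  have A: "A (s m) = generated mod_ar F (h ` J m)" for m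
    using inj_s by (simp add: A_def)
  have "X - range s \<subseteq> J m" for m by (auto simp: J_def)
  then have "infinite (J m)" for m using inf finite_subset by blast
  then have J: "J m \<subseteq> X" "infinite (J m)" "i \<le> j \<Longrightarrow> J i \<subseteq> J j" for i j m
    by (auto simp: J_def)
  have hJ: "h ` J m \<subseteq> univ F" for m using J(1)[of m] Fm(3) image_closed(2) by blast
  have aec: "AEC mod_ar K le" "free_algs_inf mod_ar modules \<subseteq> K"
    "\<And>A B. A \<in> free_algs mod_ar modules \<inter> K \<Longrightarrow> B \<in> free_algs mod_ar modules \<inter> K \<Longrightarrow>
       ff_le mod_ar modules A B \<Longrightarrow> le A B"
    using cov by (auto simp: AEC_covering_def)
  have F_K: "F \<in> K" using free_algs_infI[OF F infX] aec(2) by auto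
  have A_K: "A (s m) \<in> K" for m
    unfolding A
    using free_algs_infI[OF free_on_generated_image[OF J(1)] infinite_h_image[OF J(1,2)]] aec(2) by auto
  have A_F: "le (A (s m)) F" for m
  proof (rule aec(3))
    show "ff_le mod_ar modules (A (s m)) F"
      unfolding A by (intro ff_le_twist_image[of _ m]) (auto simp: J_def)
  qed (use A_K F_K F free_on_generated_image[OF J(1)] in \<open>auto simp: free_algs_def A\<close>)
  have univ_A: "univ (A (s m)) = h ` span mod_ar F (J m)" for m
    unfolding A univ_generated using J(1) Fm by (intro homs_image_span[symmetric] h) auto
  have sub: "substructure mod_ar (A (s i)) (A (s j))" if "i \<le> j" for i j
  proof -
    have "h ` J i \<subseteq> h ` J j" using J(3)[OF that] by auto
    then have "h ` J i \<subseteq> span mod_ar F (h ` J j)" using span_superset[of "h ` J j" mod_ar F] by auto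
    then have "generated mod_ar (generated mod_ar F (h ` J j)) (h ` J i) = generated mod_ar F (h ` J i)"
      unfolding generated_span[of _ _ "h ` J j"]
      using Fm hJ by (intro generated_restr closed_under_span span_subset_univ)
    moreover have "substructure mod_ar (generated mod_ar (generated mod_ar F (h ` J j)) (h ` J i))
        (generated mod_ar F (h ` J j))"
      using \<open>h ` J i \<subseteq> span mod_ar F (h ` J j)\<close> hJ[of j]
      by (intro substructure_generated) (auto simp: univ_generated substructureD[OF substructure_generated[OF Fm(2)]])
    ultimately show ?thesis by (simp add: A)
  qed
  have le_A: "le (A (s i)) (A (s j))" if "i \<le> j" for i j
    by (rule AEC_coherence[OF aec(1) A_F A_F sub[OF that]])
  have Field: "Field ?R = range s" by (simp add: dir_image_Field Field_natLeq)
  have under: "underS ?R (s n) = s ` {..<n}" for n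
  proof -
    have R: "(x, s n) \<in> ?R \<longleftrightarrow> (\<exists>i\<le>n. x = s i)" for x
      unfolding dir_image_def natLeq_def using injD[OF inj_s, of n] by blast
    have "x \<in> underS ?R (s n) \<longleftrightarrow> (\<exists>i\<le>n. x = s i \<and> s i \<noteq> s n)" for x
      unfolding underS_def mem_Collect_eq R by metis
    then have "x \<in> underS ?R (s n) \<longleftrightarrow> (\<exists>i<n. x = s i)" for x
      unfolding inj_eq[OF inj_s] nat_less_le by blast
    then show ?thesis by blast
  qed
  have "cont_chain mod_ar K le ?R A"
    unfolding cont_chain_def Field
  proof (intro conjI allI ballI)
    have "Well_order ?R"
      using inj_s by (intro Well_order_dir_image natLeq_Well_order) (simp add: Field_natLeq)
    then show "well_order_on (range s) ?R" by (simp add: Field)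
    have "|range s| \<le>o natLeq"
      using card_of_image[of s UNIV] card_of_nat by (rule ordLeq_ordIso_trans)
    then show "|range s| <o |UNIV :: 'u set|" using inacc by (rule ordLeq_ordLess_trans)
    show "A i \<in> K" if "i \<in> range s" for i using that A_K by auto
    show "case p of (i, j) \<Rightarrow> le (A i) (A j)" if "p \<in> ?R" for p
      using that le_A by (auto simp: dir_image_def natLeq_def)
    \<comment> \<open>Every index other than \<open>s 0\<close> has an immediate predecessor, and
      \<open>s 0\<close> has none below it, so continuity holds vacuously.\<close>
    show "limit_point ?R i \<longrightarrow> is_union mod_ar (underS ?R i) A (A i)" for i
    proof
      assume l: "limit_point ?R i"
      then obtain n where n: "i = s n" by (auto simp: limit_point_def Field)
      with l have "n > 0" by (auto simp: limit_point_def under)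
      then have "s (n - 1) \<in> underS ?R i" by (auto simp: n under)
      then obtain k where "k \<in> underS ?R i" "s (n - 1) \<in> underS ?R k"
        using l unfolding limit_point_def by blast
      then obtain k where "k < n" "s (n - 1) \<in> s ` {..<k}" by (auto simp: n under)
      then have False using inj_s by (auto dest: injD)
      then show "is_union mod_ar (underS ?R i) A (A i)" ..
    qed
  qed auto
  moreover have "is_union mod_ar (Field ?R) A img"
    unfolding is_union_def Field
  proof (intro conjI ballI)
    show "img \<in> structures mod_ar" by (rule image_structures)
    let ?U = "\<Union>m. span mod_ar F (J m)"
    have mono: "span mod_ar F (J i) \<subseteq> span mod_ar F (J j)" if "i \<le> j" for i j
      using order_trans[OF J(3)[OF that] span_superset[of "J j" mod_ar F]] order_trans[OF J(1)[of j] Fm(3)]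
      by (rule span_mono[OF Fm(2)])
    have "closed_under mod_ar F ?U"
    proof -
      have c: "closed_under mod_ar F (span mod_ar F (J m))" for m by (rule closed_under_span[OF Fm(2)])
      have "pl F x y \<in> ?U" if "x \<in> span mod_ar F (J i)" "y \<in> span mod_ar F (J j)" for x y i j
      proof -
        have "x \<in> span mod_ar F (J (max i j))" "y \<in> span mod_ar F (J (max i j))"
          using that mono[of i "max i j"] mono[of j "max i j"] by auto
        then show ?thesis using c[of "max i j"] by (auto simp: closed_under_mod_iff)
      qed
      then show ?thesis using c unfolding closed_under_mod_iff UN_iff by blast
    qed
    moreover have "X \<subseteq> ?U"
    proof
      fix x assume x: "x \<in> X"
      have "\<exists>m. x \<in> J m"
      proof (cases "x \<in> range s")
        case True
        then obtain i where "x = s i" by auto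
        then have "x \<in> J (Suc i)" using x inj_s by (auto simp: J_def dest: injD)
        then show ?thesis ..
      qed (use x in \<open>auto simp: J_def\<close>)
      then show "x \<in> ?U" using span_superset[of "J _" mod_ar F] by blast
    qed
    moreover have U: "?U \<subseteq> univ F"
      using span_subset_univ[OF Fm(2) subset_trans[OF J(1) Fm(3)]] by (intro UN_least)
    ultimately have "span mod_ar F X \<subseteq> ?U" by (intro span_minimal)
    with U have "?U = univ F" unfolding Fm(4) by (rule subset_antisym)
    then have "h ` univ F = (\<Union>m. h ` span mod_ar F (J m))" by (metis image_UN)
    then show "univ img = (\<Union>i\<in>range s. univ (A i))" by (simp add: univ_A)
    fix i assume "i \<in> range s"
    then obtain m where m: "i = s m" by auto
    have "substructure mod_ar (generated mod_ar img (h ` J m)) img"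
      using J(1) Fm(3) by (intro substructure_generated image_structures) auto
    then show "substructure mod_ar (A i) img" by (simp add: m A generated_image J(1))
  qed
  moreover have "le (A i) F" if "i \<in> Field ?R" for i
    using that A_F unfolding Field by blast
  ultimately show ?thesis by (rule AEC_chain_le[OF aec(1) _ _ F_K])
qed

end

section \<open>A cardinal with many branches\<close>

text \<open>\<open>U\<close> is a union of countably many iterated power sets, so its cardinality
  has countable cofinality and is exceeded by the number of sequences in \<open>U\<close>. Closure
  under power sets and regularity keep it below the universe.\<close>

lemma limit_tower:
  fixes \<kappa> :: "'u rel"
  assumes inacc: "inaccessible TYPE('u)" and \<kappa>: "small_card \<kappa>"
  obtains U :: "'u set" where "infinite U" "\<kappa> \<le>o |U|" "|U| <o |UNIV :: 'u set|"
    "\<nexists>\<Phi> :: (nat \<Rightarrow> 'u) \<Rightarrow> 'u. inj_on \<Phi> (UNIV \<rightarrow> U) \<and> \<Phi> ` (UNIV \<rightarrow> U) \<subseteq> U"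
proof -
  let ?V = "|UNIV :: 'u set|"
  have nat_V: "natLeq <o ?V" and reg: "regularCard ?V"
    and pow: "\<And>X :: 'u set. |X| <o ?V \<Longrightarrow> |Pow X| <o ?V"
    using inacc by (auto simp: inaccessible_def)
  have inf_V: "infinite (UNIV :: 'u set)"
    using infinite_iff_natLeq_ordLeq ordLess_imp_ordLeq[OF nat_V] by blast
  have cinf: "Cinfinite ?V" unfolding cinfinite_def Field_card_of using inf_V card_of_card_order_on by blast
  have nat_lt: "|UNIV :: nat set| <o ?V"
    using card_of_nat nat_V by (rule ordIso_ordLess_trans)
  obtain e :: "nat \<Rightarrow> 'u" where e: "inj e" using inf_V infinite_countable_subset by blast
  have \<kappa>F: "|Field \<kappa>| =o \<kappa>" using \<kappa> by (simp add: small_card_def card_of_Field_ordIso)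
  let ?S = "Field \<kappa> \<union> range e"
  have "|Field \<kappa>| <o ?V" using \<kappa>F \<kappa> ordIso_ordLess_trans by (auto simp: small_card_def)
  moreover have "|range e| <o ?V" using card_of_image nat_lt by (rule ordLeq_ordLess_trans)
  ultimately have U0: "|?S| <o ?V" using inf_V by (intro card_of_Un_ordLess_infinite)
  \<comment> \<open>Power sets are copied back into \<open>'u\<close>. The levels \<open>T n\<close>
    thus grow in cardinality without having to be nested.\<close>
  have "\<exists>Y :: 'u set. |X| <o ?V \<longrightarrow> |Y| =o |Pow X|" for X :: "'u set"
  proof (cases "|X| <o ?V")
    case True
    then have "|Pow X| \<le>o ?V" using pow ordLess_imp_ordLeq by blast
    then obtain f :: "'u set \<Rightarrow> 'u" where "inj_on f (Pow X)" by (auto simp: card_of_ordLeq[symmetric])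
    then have "|f ` Pow X| =o |Pow X|"
      by (meson card_of_ordIso inj_on_imp_bij_betw ordIso_symmetric)
    then show ?thesis by blast
  qed blast
  then obtain nxt :: "'u set \<Rightarrow> 'u set" where nxt: "\<And>X. |X| <o ?V \<Longrightarrow> |nxt X| =o |Pow X|" by metis
  define T where "T n = (nxt ^^ n) ?S" for n
  have T_small: "|T n| <o ?V" for n
  proof (induction n)
    case 0
    show ?case using U0 by (simp add: T_def)
  next
    case (Suc n)
    then have "|nxt (T n)| <o ?V" using nxt pow ordIso_ordLess_trans by blast
    then show ?case by (simp add: T_def)
  qed
  have T_less: "|T n| <o |T (Suc n)|" for n
  proof -
    have "|T (Suc n)| =o |Pow (T n)|" using nxt[OF T_small[of n]] by (simp add: T_def)
    then show ?thesis using card_of_Pow ordLess_ordIso_trans ordIso_symmetric by blast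
  qed
  let ?U = "\<Union>n. T n"
  have T_U: "|T n| <o |?U|" for n
  proof -
    have "|T (Suc n)| \<le>o |?U|" by (intro card_of_mono1) blast
    with T_less show ?thesis by (rule ordLess_ordLeq_trans)
  qed
  have sub: "?S \<subseteq> ?U"
  proof -
    have "T 0 = ?S" by (simp add: T_def)
    then show ?thesis by blast
  qed
  show ?thesis
  proof (rule that)
    show "infinite ?U" using sub range_inj_infinite[OF e] by (meson Un_subset_iff infinite_super)
    have "|Field \<kappa>| \<le>o |?U|" using sub by (intro card_of_mono1) blast
    then show "\<kappa> \<le>o |?U|" by (rule ordIso_ordLeq_trans[OF ordIso_symmetric[OF \<kappa>F]])
    show "|?U| <o ?V"
      using T_small by (intro card_of_UNION_ordLess_infinite_Field_regularCard[OF reg cinf nat_lt]) blast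
    show "\<nexists>\<Phi> :: (nat \<Rightarrow> 'u) \<Rightarrow> 'u. inj_on \<Phi> (UNIV \<rightarrow> ?U) \<and> \<Phi> ` (UNIV \<rightarrow> ?U) \<subseteq> ?U"
    proof (intro notI, elim exE conjE)
      fix \<Phi> :: "(nat \<Rightarrow> 'u) \<Rightarrow> 'u"
      assume inj: "inj_on \<Phi> (UNIV \<rightarrow> ?U)" and \<Phi>: "\<Phi> ` (UNIV \<rightarrow> ?U) \<subseteq> ?U"
      let ?I = "inv_into (UNIV \<rightarrow> ?U) \<Phi>"
      \<comment> \<open>Koenig's diagonal: the branch \<open>p\<close> differs at \<open>n\<close> from every branch coded in \<open>T n\<close>.\<close>
      have "\<exists>y\<in>?U. y \<notin> (\<lambda>u. ?I u n) ` T n" for n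
      proof (rule ccontr)
        assume "\<not> ?thesis"
        then have "|?U| \<le>o |(\<lambda>u. ?I u n) ` T n|" by (intro card_of_mono1) blast
        also have "|(\<lambda>u. ?I u n) ` T n| \<le>o |T n|" by (rule card_of_image)
        finally show False using T_U[of n] not_ordLess_ordLeq by blast
      qed
      then obtain p where p: "\<And>n. p n \<in> ?U" "\<And>n. p n \<notin> (\<lambda>u. ?I u n) ` T n" by metis
      then have pU: "p \<in> UNIV \<rightarrow> ?U" by blast
      then have "\<Phi> p \<in> ?U" using \<Phi> by blast
      then obtain n where "\<Phi> p \<in> T n" by blast
      moreover have "?I (\<Phi> p) = p" using inj pU by (rule inv_into_f_f)
      ultimately have "p n \<in> (\<lambda>u. ?I u n) ` T n" by (metis imageI)
      with p(2) show False by blast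
    qed
  qed
qed

text \<open>Take \<open>n\<close> to be the first place where \<open>p\<close> and \<open>q\<close>
  differ. An initial segment of \<open>q\<close> longer than \<open>n\<close> contains the entry
  \<open>q n\<close> and so is not an initial segment of \<open>p\<close>.\<close>

lemma branches_meet_finitely:
  assumes "p \<noteq> (q :: nat \<Rightarrow> 'a)"
  obtains n where "\<And>i. i \<le> n \<Longrightarrow> map p [0..<i] = map q [0..<i]"
    "\<And>i j. j > n \<Longrightarrow> map q [0..<j] \<noteq> map p [0..<i]"
proof -
  obtain k where "p k \<noteq> q k" using assms by blast
  define n where "n = (LEAST k. p k \<noteq> q k)"
  have n: "p n \<noteq> q n" unfolding n_def using \<open>p k \<noteq> q k\<close> by (rule LeastI)
  have n_less: "p i = q i" if "i < n" for i using not_less_Least[OF that[unfolded n_def]] by simp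
  show ?thesis
  proof (rule that[of n])
    show "map p [0..<i] = map q [0..<i]" if "i \<le> n" for i using n_less that by simp
    fix i j assume j: "j > n"
    show "map q [0..<j] \<noteq> map p [0..<i]"
    proof
      assume eq: "map q [0..<j] = map p [0..<i]"
      then have "length (map q [0..<j]) = length (map p [0..<i])" by (rule arg_cong)
      then have "map q [0..<j] ! n = q n" "map p [0..<i] ! n = p n" using j by simp_all
      with eq n show False by simp
    qed
  qed
qed

section \<open>Many Galois types\<close>

lemma auts_comp:
  assumes "g \<in> auts ar M" "f \<in> auts ar M" "M \<in> structures ar"
  shows "restrict (g \<circ> f) (univ M) \<in> auts ar M"
proof -
  have "bij_betw (g \<circ> f) (univ M) (univ M)"
    using assms by (auto simp: auts_def isos_def intro: bij_betw_trans)
  moreover have "restrict (g \<circ> f) (univ M) \<in> homs ar M M"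
    using assms by (intro homs_comp) (auto simp: auts_def isos_def)
  ultimately show ?thesis by (simp add: auts_def isos_def cong: bij_betw_cong)
qed

lemma auts_inverse:
  assumes "g \<in> auts ar M" "M \<in> structures ar"
  obtains g' where "g' \<in> auts ar M" "\<forall>x\<in>univ M. g' (g x) = x"
proof -
  let ?g' = "restrict (inv_into (univ M) g) (univ M)"
  have "bij_betw g (univ M) (univ M)" using assms by (auto simp: auts_def isos_def)
  then have "\<forall>x\<in>univ M. ?g' (g x) = x"
    using bij_betwE by (fastforce simp: bij_betw_inv_into_left)
  moreover have "?g' \<in> auts ar M" using assms unfolding auts_def by (intro isos_inverse)
  ultimately show ?thesis using that by blast
qed

lemma auts_closed: "g \<in> auts ar M \<Longrightarrow> x \<in> univ M \<Longrightarrow> g x \<in> univ M"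
  by (auto simp: auts_def isos_def dest: homs_closed)

lemma RCP_pair_dcl: "RCP_pair ar V A B b \<Longrightarrow> dcl_qf ar B (univ A \<union> {b}) = univ B"
  unfolding RCP_pair_def by blast

text \<open>The comparison takes place in the countable submodule \<open>B\<close> spanned by both
  branches. It is a free factor of \<open>F\<close>, hence strong in \<open>M\<close>, and each of
  the two maps makes it the larger member of an (RCP) pair.\<close>

lemma branches_not_conjugate:
  fixes K :: "('r :: {ring, monoid_mult, countable} mod_sym, 'u) struc set"
    and le :: "('r mod_sym, 'u) struc \<Rightarrow> ('r mod_sym, 'u) struc \<Rightarrow> bool"
  assumes cov: "AEC_covering mod_ar modules K le"
    and dcl: "\<And>A B b. RCP_pair mod_ar modules A B b \<Longrightarrow> le B M \<Longrightarrow>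
      dcl_qf mod_ar B (univ A \<union> {b}) = dcl_qf mod_ar M (univ A \<union> {b})"
    and dcl_aut: "\<And>A B b f. RCP_pair mod_ar modules A B b \<Longrightarrow> le B M \<Longrightarrow> f \<in> auts mod_ar M \<Longrightarrow>
      (\<And>x. x \<in> univ A \<Longrightarrow> f x = x) \<Longrightarrow>
      dcl_qf mod_ar M (univ A \<union> {b}) = dcl_qf mod_ar M (univ A \<union> {f b})"
    and nzd: "\<And>m. \<not> zero_divisor (prod_list (map r [0..<Suc m]))"
    and unstable: "\<nexists>k. \<forall>m\<ge>k. range ((*) (prod_list (map r [0..<Suc m]))) =
          range ((*) (prod_list (map r [0..<Suc k])))"
    and p: "twisted F X sp r hp" and q: "twisted F X sq r hq" and FM: "le F M"
    and start: "sp 0 = sq 0"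
    and common: "\<And>i. i \<le> n \<Longrightarrow> sp i = sq i" and apart: "\<And>j. j > n \<Longrightarrow> sq j \<notin> range sp"
    and gp: "gp \<in> auts mod_ar M" "\<And>x. x \<in> univ F \<Longrightarrow> gp x = hp x"
    and gq: "gq \<in> auts mod_ar M" "\<And>x. x \<in> univ F \<Longrightarrow> gq x = hq x"
    and bp: "bp \<in> univ M" "gp bp = sp 0" and bq: "bq \<in> univ M" "gq bq = sq 0"
    and f: "f \<in> auts mod_ar M" "\<And>x. x \<in> univ F \<Longrightarrow> f x = x" "f bp = bq"
  shows False
proof -
  interpret p: twisted F X sp r hp by (rule p)
  interpret q: twisted F X sq r hq by (rule q)
  have aec: "AEC mod_ar K le" "free_algs_inf mod_ar modules \<subseteq> K"
    "\<And>A B. A \<in> free_algs mod_ar modules \<inter> K \<Longrightarrow> B \<in> free_algs mod_ar modules \<inter> K \<Longrightarrow>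
       ff_le mod_ar modules A B \<Longrightarrow> le A B"
    using cov by (auto simp: AEC_covering_def)
  define Y where "Y = range sp \<union> range sq"
  have Y: "Y \<subseteq> X" "range sp \<subseteq> Y" "range sq \<subseteq> Y" "countable Y"
    using p.s_X q.s_X by (auto simp: Y_def)
  have infY: "infinite Y" using Y(2) range_inj_infinite[OF p.inj_s] infinite_super by blast
  define B where "B = generated mod_ar F Y"
  interpret tp: twisted B Y sp r "restrict hp (univ B)"
    unfolding B_def by (rule p.twisted_subset[OF Y(1,2)])
  interpret tq: twisted B Y sq r "restrict hq (univ B)"
    unfolding B_def by (rule q.twisted_subset[OF Y(1,3)])
  have RCPp: "RCP_pair mod_ar modules tp.img B (sp 0)"
    by (rule tp.RCP_pair_image[OF nzd unstable Y(4)])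
  have RCPq: "RCP_pair mod_ar modules tq.img B (sq 0)"
    by (rule tq.RCP_pair_image[OF nzd unstable Y(4)])
  have BF: "le B F"
  proof (rule aec(3))
    show "ff_le mod_ar modules B F" unfolding B_def by (rule ff_le_generated[OF p.F Y(1)])
    show "B \<in> free_algs mod_ar modules \<inter> K"
      using free_algs_infI[OF tp.F infY] aec(2) tp.F by (auto simp: free_algs_def)
    show "F \<in> free_algs mod_ar modules \<inter> K"
      using free_algs_infI[OF p.F p.infX] aec(2) p.F by (auto simp: free_algs_def)
  qed
  have BM: "le B M" by (rule AEC_trans[OF aec(1) BF FM])
  have subBM: "substructure mod_ar B M" by (rule AEC_substructure[OF aec(1) BM])
  have uB: "univ B \<subseteq> univ F" "univ B \<subseteq> univ M" "univ F \<subseteq> univ M"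
    using AEC_substructure[OF aec(1) BF] subBM AEC_substructure[OF aec(1) FM]
    by (auto simp: substructure_def)
  have M: "M \<in> structures mod_ar" using subBM by (simp add: substructure_def)
  obtain gp' where gp': "gp' \<in> auts mod_ar M" "\<forall>x\<in>univ M. gp' (gp x) = x"
    using auts_inverse[OF gp(1) M] .
  obtain gq' where gq': "gq' \<in> auts mod_ar M" "\<forall>x\<in>univ M. gq' (gq x) = x"
    using auts_inverse[OF gq(1) M] .
  have imgp: "univ tp.img = hp ` univ B" and imgq: "univ tq.img = hq ` univ B" by simp_all
  have hpB: "hp ` univ B \<subseteq> univ B" using tp.image_closed(2) by auto
  have hqB: "hq ` univ B \<subseteq> univ B" using tq.image_closed(2) by auto
  \<comment> \<open>\<open>k1\<close> is \<open>f\<close> conjugated by \<open>gp\<close>. It fixes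
    the image of \<open>hp\<close> on \<open>B\<close>, because \<open>f\<close> fixes
    \<open>F\<close>, and it moves \<open>sp 0\<close> to \<open>gp bq\<close>. So these two
    elements have the same definable closure over that image, namely \<open>B\<close>.\<close>
  define k1 where "k1 = restrict (gp \<circ> restrict (f \<circ> gp') (univ M)) (univ M)"
  have k1: "k1 \<in> auts mod_ar M"
    unfolding k1_def by (intro auts_comp gp f gp' M)
  have k1_eq: "k1 (gp x) = gp (f x)" if "x \<in> univ M" for x
    using that auts_closed[OF gp(1) that] bspec[OF gp'(2) that] by (simp add: k1_def)
  have k1_fix: "k1 x = x" if "x \<in> univ tp.img" for x
  proof -
    obtain y where y: "y \<in> univ B" "x = hp y" using \<open>x \<in> univ tp.img\<close> unfolding imgp by blast
    then have "y \<in> univ F" "y \<in> univ M" using uB by auto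
    then show ?thesis using k1_eq[of y] f(2)[of y] gp(2)[of y] y(2) by simp
  qed
  have "dcl_qf mod_ar M (univ tp.img \<union> {sp 0}) = dcl_qf mod_ar M (univ tp.img \<union> {k1 (sp 0)})"
    by (rule dcl_aut[OF RCPp BM k1 k1_fix])
  moreover have "k1 (sp 0) = gp bq" using k1_eq[OF bp(1)] bp(2) f(3) by simp
  moreover have "dcl_qf mod_ar M (univ tp.img \<union> {sp 0}) = univ B"
    using dcl[OF RCPp BM] RCP_pair_dcl[OF RCPp] by simp
  ultimately have dcl_p: "dcl_qf mod_ar M (hp ` univ B \<union> {gp bq}) = univ B"
    unfolding imgp by simp
  have dcl_q: "dcl_qf mod_ar M (hq ` univ B \<union> {sq 0}) = univ B"
    using dcl[OF RCPq BM] RCP_pair_dcl[OF RCPq] unfolding imgq by simp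
  \<comment> \<open>\<open>k\<close> carries \<open>sq 0\<close> to \<open>gp bq\<close> and the
    image of \<open>hq\<close> on \<open>B\<close> to that of \<open>hp\<close>. Both sets of
    parameters have definable closure \<open>B\<close>, so \<open>k\<close> maps \<open>B\<close>
    into itself.\<close>
  define k where "k = restrict (gp \<circ> gq') (univ M)"
  have k: "k \<in> auts mod_ar M" unfolding k_def by (intro auts_comp gp gq' M)
  have k_gq: "k (gq x) = gp x" if "x \<in> univ M" for x
    using that auts_closed[OF gq(1) that] bspec[OF gq'(2) that] by (simp add: k_def)
  have k_h: "k (hq y) = hp y" if "y \<in> univ B" for y
    using k_gq[of y] gp(2)[of y] gq(2)[of y] that uB by (simp add: subset_iff)
  have kB: "k x \<in> univ B" if "x \<in> univ B" for x
  proof -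
    let ?C = "hq ` univ B \<union> {sq 0}"
    have "?C \<subseteq> univ M" using hqB uB tq.s_mem(2) by auto
    moreover have "x \<in> dcl_qf mod_ar M ?C" unfolding dcl_q by (rule that)
    ultimately have "k x \<in> dcl_qf mod_ar M (k ` ?C)" by (rule dcl_qf_auts[OF k M])
    moreover have "k ` ?C = hp ` univ B \<union> {gp bq}"
    proof -
      have "k ` hq ` univ B = hp ` univ B" using k_h by (auto simp: image_image)
      moreover have "k (sq 0) = gp bq" using k_gq[OF bq(1)] bq(2) by simp
      ultimately show ?thesis by (simp add: image_Un)
    qed
    ultimately show ?thesis using dcl_p by simp
  qed
  have "k \<in> homs mod_ar M M" using k by (simp add: auts_def isos_def)
  then have "restrict k (univ B) \<in> homs mod_ar B (restr mod_ar M (univ B))"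
    using kB by (intro homs_codomain homs_restrict[OF _ subBM]) auto
  then have k': "restrict k (univ B) \<in> homs mod_ar B B"
    using substructure_eq_restr[OF subBM] by simp
  obtain c where c: "coordinates B Y c" using free_coordinates[OF tp.F infY p.nontriv] by blast
  have lin: "lin B (c y)" if "y \<in> Y" for y using c that by (simp add: coordinates_def)
  have cc: "c x y = (if x = y then 1 else 0)" if "x \<in> Y" "y \<in> Y" for x y
    using c that by (simp add: coordinates_def)
  \<comment> \<open>These are the coordinates along the branch \<open>sq\<close> of the
    \<open>k\<close>-image of that branch; applying \<open>k\<close> to the formula for
    \<open>hq (sq i)\<close> yields their recurrence.\<close>
  define a where "a j i = c (sq j) (k (sq i))" for j i
  have "a j i = r i * a j (Suc i) + (if i = j then 1 else 0)" if j: "j \<ge> Suc n" for i j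
  proof -
    have "c (sq j) (k (hq (sq i))) = a j i - r i * a j (Suc i)"
    proof -
      have m: "sq i \<in> univ B" "sq (Suc i) \<in> univ B" using tq.s_mem(2) by auto
      have e: "hq (sq i) = pl B (sq i) (ng B (sc B (r i) (sq (Suc i))))"
        using tq.h_s[of i] m by simp
      let ?x = "sc B (r i) (sq (Suc i))"
      have x: "?x \<in> univ B" "ng B ?x \<in> univ B" using m by (auto intro: tq.cl)
      have "restrict k (univ B) (hq (sq i)) = pl B (k (sq i)) (ng B (sc B (r i) (k (sq (Suc i)))))"
        unfolding e homs_mod(2)[OF k' m(1) x(2)] homs_mod(3)[OF k' x(1)] homs_mod(4)[OF k' m(2)]
        using m by simp
      moreover have "hq (sq i) \<in> univ B" using hqB m by auto
      ultimately have "k (hq (sq i)) = pl B (k (sq i)) (ng B (sc B (r i) (k (sq (Suc i)))))" by simp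
      then show ?thesis
        using linD[OF lin[OF tq.s_mem(1)[of j]]] kB m by (simp add: a_def tq.cl)
    qed
    moreover have "k (hq (sq i)) = hp (sq i)" using k_h tq.s_mem(2) by simp
    \<comment> \<open>For \<open>i \<le> n\<close> the element \<open>sq i\<close> lies on the
      branch \<open>sp\<close>, so its \<open>hp\<close>-image is a combination of elements of
      \<open>sp\<close>, none of which is \<open>sq j\<close>. For larger \<open>i\<close> it is off
      that branch and fixed by \<open>hp\<close>.\<close>
    moreover have "c (sq j) (hp (sq i)) = (if i = j then 1 else 0)"
    proof (cases "i \<le> n")
      case True
      have m: "sp i \<in> univ B" "sp (Suc i) \<in> univ B" using tp.s_mem(2) by auto
      have e: "hp (sp i) = pl B (sp i) (ng B (sc B (r i) (sp (Suc i))))"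
        using tp.h_s[of i] m by simp
      have "c (sq j) (sp l) = 0" for l
        using cc[OF tq.s_mem(1)[of j] tp.s_mem(1)[of l]] apart[of j] j by auto
      then have "c (sq j) (hp (sp i)) = 0"
        unfolding e using linD[OF lin[OF tq.s_mem(1)[of j]]] m by (simp add: tq.cl)
      then show ?thesis using True common j by simp
    next
      case False
      then have "hp (sq i) = sq i" using p.h_other[OF q.s_mem(1)] apart[of i] by simp
      then show ?thesis
        using cc[OF tq.s_mem(1)[of j] tq.s_mem(1)[of i]] inj_eq[OF q.inj_s, of j i] by auto
    qed
    ultimately show ?thesis by (simp add: algebra_simps)
  qed
  moreover have "finite {j. a j 0 \<noteq> 0}"
  proof -
    have "finite {y \<in> Y. c y (k (sq 0)) \<noteq> 0}"
      using c kB[OF tq.s_mem(2)] unfolding coordinates_def by blast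
    moreover have "sq ` {j. a j 0 \<noteq> 0} \<subseteq> {y \<in> Y. c y (k (sq 0)) \<noteq> 0}"
      using tq.s_mem(1) by (auto simp: a_def)
    ultimately show ?thesis using q.inj_s by (meson finite_imageD finite_subset inj_on_subset subset_UNIV)
  qed
  ultimately show False
    using prod_right_unit_stabilises[of r "Suc n" a] nzd unstable by blast
qed

text \<open>Excludes the zero ring, over which all basis elements would coincide.\<close>

lemma zero_ring_weakly_left_perfect:
  assumes "(1 :: 'r :: {ring, monoid_mult}) = 0"
  shows "weakly_left_perfect TYPE('r)"
proof -
  have "x = 0" for x :: 'r using assms by (metis mult_1_left mult_zero_left)
  then have "range ((*) x) = range ((*) y)" for x y :: 'r by metis
  then show ?thesis unfolding weakly_left_perfect_def by blast
qed

theorem corollary1p10: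
  fixes K :: "('r :: {ring, monoid_mult, countable} mod_sym, 'u) struc set"
    and le :: "('r mod_sym, 'u) struc \<Rightarrow> ('r mod_sym, 'u) struc \<Rightarrow> bool"
  assumes "inaccessible TYPE('u)"
    and "\<not> weakly_left_perfect TYPE('r)"
    and "AEC_covering mod_ar modules K le"
    and "strong_enough mod_ar modules K le"
  shows "\<not> superstable mod_ar K le"
proof
  assume ss: "superstable mod_ar K le"
  have nontriv: "(1 :: 'r) \<noteq> 0" using assms(2) zero_ring_weakly_left_perfect by blast
  obtain r :: "nat \<Rightarrow> 'r" where nzd: "\<And>m. \<not> zero_divisor (prod_list (map r [0..<Suc m]))"
    and unstable: "\<nexists>k. \<forall>m\<ge>k. range ((*) (prod_list (map r [0..<Suc m]))) =
      range ((*) (prod_list (map r [0..<Suc k])))"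
    using assms(2) unfolding weakly_left_perfect_def by blast
  have aec: "AEC mod_ar K le" "free_algs_inf mod_ar modules \<subseteq> K"
    using assms(3) by (auto simp: AEC_covering_def)
  have inacc: "natLeq <o |UNIV :: 'u set|" using assms(1) by (simp add: inaccessible_def)
  obtain \<mu>\<^sub>0 :: "'u rel" where \<mu>\<^sub>0: "small_card \<mu>\<^sub>0"
    and stable: "\<And>\<mu> :: 'u rel. small_card \<mu> \<Longrightarrow> \<mu>\<^sub>0 \<le>o \<mu> \<Longrightarrow> stable_in mod_ar K le \<mu>"
    using ss unfolding superstable_def by blast
  have dcl: "\<And>A B b M. RCP_pair mod_ar modules A B b \<Longrightarrow> le B M \<Longrightarrow>
      dcl_qf mod_ar B (univ A \<union> {b}) = dcl_qf mod_ar M (univ A \<union> {b})"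
    using assms(4) unfolding strong_enough_def by blast
  obtain \<kappa>\<^sub>0 :: "'u rel" where \<kappa>\<^sub>0: "small_card \<kappa>\<^sub>0"
    and dcl_aut: "\<forall>\<kappa> M A B b\<^sub>0 f. \<kappa>\<^sub>0 \<le>o \<kappa> \<and> monster mod_ar K le \<kappa> M \<and>
      RCP_pair mod_ar modules A B b\<^sub>0 \<and> le B M \<and> f \<in> auts mod_ar M \<and> (\<forall>x \<in> univ A. f x = x) \<longrightarrow>
      dcl_qf mod_ar M (univ A \<union> {b\<^sub>0}) = dcl_qf mod_ar M (univ A \<union> {f b\<^sub>0})"
    using assms(4) unfolding strong_enough_def by (elim conjE exE)
  \<comment> \<open>The larger of two thresholds: the one for stability and the one from which the
    automorphism clause of \<open>strong_enough\<close> applies.\<close>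
  obtain \<nu> :: "'u rel" where \<nu>: "small_card \<nu>" "\<mu>\<^sub>0 \<le>o \<nu>" "\<kappa>\<^sub>0 \<le>o \<nu>"
  proof -
    have w: "Well_order \<mu>\<^sub>0" "Well_order \<kappa>\<^sub>0"
      using \<mu>\<^sub>0 \<kappa>\<^sub>0 by (auto simp: small_card_def card_order_on_def)
    then have "\<mu>\<^sub>0 \<le>o \<kappa>\<^sub>0 \<or> \<kappa>\<^sub>0 \<le>o \<mu>\<^sub>0" by (rule ordLeq_total)
    then show ?thesis using that \<mu>\<^sub>0 \<kappa>\<^sub>0 ordLeq_refl[of \<mu>\<^sub>0] ordLeq_refl[of \<kappa>\<^sub>0] small_card_def by blast
  qed
  obtain U :: "'u set" where infU: "infinite U" and \<nu>U: "\<nu> \<le>o |U|" and U_small: "|U| <o |UNIV :: 'u set|"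
    and many: "\<nexists>\<Phi> :: (nat \<Rightarrow> 'u) \<Rightarrow> 'u. inj_on \<Phi> (UNIV \<rightarrow> U) \<and> \<Phi> ` (UNIV \<rightarrow> U) \<subseteq> U"
    using limit_tower[OF assms(1) \<nu>(1)] .
  have "stable_in mod_ar K le |U|"
    using U_small ordLeq_transitive[OF \<nu>(2) \<nu>U] card_of_Card_order
    by (intro stable) (auto simp: small_card_def)
  then obtain \<kappa> M where \<kappa>: "|U| <o \<kappa>" and mon: "monster mod_ar K le \<kappa> M"
    and few: "\<And>B. le B M \<Longrightarrow> |univ B| =o |U| \<Longrightarrow> |galois_types mod_ar M B| \<le>o |U|"
    unfolding stable_in_def by blast
  have \<kappa>\<^sub>0\<kappa>: "\<kappa>\<^sub>0 \<le>o \<kappa>"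
    using ordLeq_transitive[OF \<nu>(3) \<nu>U] ordLess_imp_ordLeq[OF \<kappa>] by (rule ordLeq_transitive)
  have univ_M: "\<And>C. C \<in> K \<Longrightarrow> |univ C| \<le>o \<kappa> \<Longrightarrow> strong_embs mod_ar le C M \<noteq> {}"
    and hom_M: "\<And>A\<^sub>0 A\<^sub>1 f. le A\<^sub>0 M \<Longrightarrow> le A\<^sub>1 M \<Longrightarrow> |univ A\<^sub>0| <o \<kappa> \<Longrightarrow> |univ A\<^sub>1| <o \<kappa> \<Longrightarrow>
      f \<in> isos mod_ar A\<^sub>0 A\<^sub>1 \<Longrightarrow> \<exists>g\<in>auts mod_ar M. \<forall>x\<in>univ A\<^sub>0. g x = f x"
    using mon unfolding monster_def universal_model_def homogeneous_model_def by blast+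
  \<comment> \<open>A free module of rank \<open>|U|\<close> is built first; universality then
    yields the strong copy \<open>F\<close> in the monster.\<close>
  obtain F\<^sub>0 :: "('r mod_sym, 'u) struc" and X\<^sub>0 where
    F\<^sub>0: "free_on mod_ar modules F\<^sub>0 X\<^sub>0" and X\<^sub>0: "|X\<^sub>0| =o |U|"
    using exists_free_module[OF infU U_small nontriv] .
  have infX\<^sub>0: "infinite X\<^sub>0" using X\<^sub>0 infU card_of_ordIso_finite by blast
  have F\<^sub>0_card: "|univ F\<^sub>0| \<le>o |X\<^sub>0|" using free_coordinates[OF F\<^sub>0 infX\<^sub>0 nontriv] by blast
  have "|univ F\<^sub>0| \<le>o |U|" using F\<^sub>0_card X\<^sub>0 by (rule ordLeq_ordIso_trans)
  then have "|univ F\<^sub>0| \<le>o \<kappa>" using ordLess_imp_ordLeq[OF \<kappa>] by (rule ordLeq_transitive)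
  moreover have "F\<^sub>0 \<in> K" using free_algs_infI[OF F\<^sub>0 infX\<^sub>0] aec(2) by auto
  ultimately obtain \<phi> where \<phi>: "\<phi> \<in> homs mod_ar F\<^sub>0 M" "inj_on \<phi> (univ F\<^sub>0)"
      "le (restr mod_ar M (\<phi> ` univ F\<^sub>0)) M"
    using univ_M[of F\<^sub>0] by (auto simp: strong_embs_def)
  define F where "F = restr mod_ar M (\<phi> ` univ F\<^sub>0)"
  define X where "X = \<phi> ` X\<^sub>0"
  have FM: "le F M" using \<phi>(3) by (simp add: F_def)
  note subFM = AEC_substructure[OF aec(1) FM]
  have M: "M \<in> structures mod_ar" using subFM by (simp add: substructure_def)
  have F_str: "F \<in> structures mod_ar" using subFM by (simp add: substructure_def)
  have F: "free_on mod_ar modules F X"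
    unfolding X_def using free_on_isos[OF F\<^sub>0 _ F_str] inj_homs_iso_image[OF \<phi>(1,2)] by (simp add: F_def)
  note Fm = free_onD[OF F]
  have XU: "|X| =o |U|"
  proof -
    have "bij_betw \<phi> X\<^sub>0 X"
      unfolding X_def bij_betw_def using inj_on_subset[OF \<phi>(2) free_onD(3)[OF F\<^sub>0]] by simp
    then have "|X\<^sub>0| =o |X|" using card_of_ordIso by blast
    then show ?thesis using X\<^sub>0 ordIso_symmetric ordIso_transitive by blast
  qed
  have infX: "infinite X" using XU infU card_of_ordIso_finite by blast
  have FU: "|univ F| =o |U|"
  proof -
    have "|univ F| \<le>o |X|" using free_coordinates[OF F infX nontriv] by blast
    moreover have "|X| \<le>o |univ F|" using Fm(3) by (rule card_of_mono1)
    ultimately show ?thesis using XU ordIso_iff_ordLeq ordIso_transitive by blast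
  qed
  have F\<kappa>: "|univ F| <o \<kappa>" using FU \<kappa> by (rule ordIso_ordLess_trans)
  have "|lists U| \<le>o |X|"
    using ordLeq_ordIso_trans[OF card_lists_infinite[OF infU] ordIso_symmetric[OF XU]] .
  then obtain e where e: "inj_on e (lists U)" "e ` lists U \<subseteq> X"
    by (auto simp: card_of_ordLeq[symmetric])
  \<comment> \<open>Nodes of the tree are coded by basis elements through \<open>e\<close>, and
    \<open>s p\<close> follows the initial segments of \<open>p\<close>. All branches share the root
    \<open>s p 0\<close>, the code of the empty list.\<close>
  define s where "s p i = e (map p [0..<i])" for p :: "nat \<Rightarrow> 'u" and i :: nat
  have path: "map p [0..<i] \<in> lists U" if "p \<in> UNIV \<rightarrow> U" for p :: "nat \<Rightarrow> 'u" and i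
    using that by (auto simp: Pi_iff)
  have s_X: "range (s p) \<subseteq> X" if "p \<in> UNIV \<rightarrow> U" for p
    using path[OF that] e(2) by (auto simp: s_def)
  have s_inj: "inj (s p)" if "p \<in> UNIV \<rightarrow> U" for p
  proof (rule injI)
    fix i j assume "s p i = s p j"
    then have "map p [0..<i] = map p [0..<j]"
      unfolding s_def by (rule inj_onD[OF e(1) _ path[OF that] path[OF that]])
    then have "length (map p [0..<i]) = length (map p [0..<j])" by (rule arg_cong)
    then show "i = j" by simp
  qed
  have s_coinf: "infinite (X - range (s p))" if p: "p \<in> UNIV \<rightarrow> U" for p
  proof -
    \<comment> \<open>The nodes of length one other than the one on \<open>p\<close> already give
      infinitely many basis elements off the branch, as \<open>le_image\<close> requires.\<close>
    let ?L = "(\<lambda>u. [u]) ` (U - {p 0})"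
    have L: "?L \<subseteq> lists U" by auto
    have "infinite ?L" using infU by (auto dest!: finite_imageD simp: inj_on_def)
    then have "infinite (e ` ?L)" using inj_on_subset[OF e(1) L] by (metis finite_imageD)
    moreover have "e ` ?L \<subseteq> X - range (s p)"
    proof
      fix x assume "x \<in> e ` ?L"
      then obtain u where u: "u \<in> U" "u \<noteq> p 0" "x = e [u]" by auto
      have "x \<noteq> s p i" for i
      proof
        assume "x = s p i"
        then have "e [u] = e (map p [0..<i])" using u by (simp add: s_def)
        then have eq: "[u] = map p [0..<i]"
          by (rule inj_onD[OF e(1)]) (use u path[OF p] in auto)
        then have "length [u] = length (map p [0..<i])" by (rule arg_cong)
        then have "i = 1" by simp
        with eq u(2) show False by simp
      qed
      then show "x \<in> X - range (s p)" using u e(2) by auto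
    qed
    ultimately show ?thesis using infinite_super by blast
  qed
  have "\<exists>h. twisted F X (s p) r h" if p: "p \<in> UNIV \<rightarrow> U" for p
  proof -
    note cl = modules_closed[OF Fm(1)]
    have sF: "s p i \<in> univ F" for i using s_X[OF p] Fm(3) by auto
    have "twist F (s p) r UNIV x \<in> univ F" if "x \<in> X" for x
      using that Fm(3) sF by (cases "x \<in> range (s p)") (auto simp: twist_simps[OF s_inj[OF p]] twist_def cl)
    then obtain h where "h \<in> homs mod_ar F F" "\<And>x. x \<in> X \<Longrightarrow> h x = twist F (s p) r UNIV x"
      using free_on_extend[OF F Fm(1)] by blast
    then show ?thesis
      using F infX s_inj[OF p] s_X[OF p] nontriv by (blast intro: twisted.intro)
  qed
  then obtain h where h: "\<And>p. p \<in> UNIV \<rightarrow> U \<Longrightarrow> twisted F X (s p) r (h p)" by metis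
  \<comment> \<open>\<open>h p\<close> is an isomorphism between two strong submodules of size below
    \<open>\<kappa>\<close>, so homogeneity extends it.\<close>
  have "\<exists>g\<in>auts mod_ar M. \<forall>x\<in>univ F. g x = h p x" if p: "p \<in> UNIV \<rightarrow> U" for p
  proof -
    interpret twisted F X "s p" r "h p" by (rule h[OF p])
    have "|univ img| \<le>o |univ F|" by (simp add: card_of_image)
    then have "|univ img| <o \<kappa>" using F\<kappa> by (rule ordLeq_ordLess_trans)
    moreover have "le img M"
      by (rule AEC_trans[OF aec(1) le_image[OF assms(3) s_coinf[OF p] inacc] FM])
    ultimately show ?thesis using hom_M[OF FM _ F\<kappa> _ h_iso] by blast
  qed
  then obtain g where g: "\<And>p. p \<in> UNIV \<rightarrow> U \<Longrightarrow> g p \<in> auts mod_ar M"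
      "\<And>p x. p \<in> UNIV \<rightarrow> U \<Longrightarrow> x \<in> univ F \<Longrightarrow> g p x = h p x"
    by metis
  have "\<exists>b\<in>univ M. g p b = s p 0" if p: "p \<in> UNIV \<rightarrow> U" for p
  proof -
    have "s p 0 \<in> univ F" using s_X[OF p] Fm(3) by auto
    then have sM: "s p 0 \<in> univ M" using substructureD(3)[OF subFM] by blast
    have "g p ` univ M = univ M" using g(1)[OF p] by (auto simp: auts_def isos_def bij_betw_def)
    then show ?thesis using sM by (metis imageE)
  qed
  then obtain b where b: "\<And>p. p \<in> UNIV \<rightarrow> U \<Longrightarrow> b p \<in> univ M"
      "\<And>p. p \<in> UNIV \<rightarrow> U \<Longrightarrow> g p (b p) = s p 0"
    by metis
  \<comment> \<open>Stability injects the types over \<open>F\<close> into \<open>U\<close>. Since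
    the branches do not inject into \<open>U\<close>, two of the \<open>b p\<close> must have the
    same type.\<close>
  obtain \<iota> where \<iota>: "inj_on \<iota> (galois_types mod_ar M F)" "\<iota> ` galois_types mod_ar M F \<subseteq> U"
    using few[OF FM FU] by (auto simp: card_of_ordLeq[symmetric])
  let ?\<Phi> = "\<lambda>p. \<iota> (galois_type mod_ar M F (b p))"
  have types: "galois_type mod_ar M F (b p) \<in> galois_types mod_ar M F" if "p \<in> UNIV \<rightarrow> U" for p
    using b(1)[OF that] by (simp add: galois_types_def)
  then have "?\<Phi> ` (UNIV \<rightarrow> U) \<subseteq> U" using \<iota>(2) by blast
  then have "\<not> inj_on ?\<Phi> (UNIV \<rightarrow> U)" using many by blast
  then obtain p q where p: "p \<in> UNIV \<rightarrow> U" and q: "q \<in> UNIV \<rightarrow> U" and "p \<noteq> q" "?\<Phi> p = ?\<Phi> q"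
    unfolding inj_on_def by blast
  then have same: "galois_type mod_ar M F (b p) = galois_type mod_ar M F (b q)"
    using inj_onD[OF \<iota>(1) _ types[OF p] types[OF q]] by blast
  \<comment> \<open>The identity puts \<open>b q\<close> into its own orbit; equality of the orbits
    then provides an automorphism over \<open>F\<close> from \<open>b p\<close> to
    \<open>b q\<close>.\<close>
  have "substructure mod_ar M M" using M by (simp add: substructure_def)
  then have "restrict id (univ M) \<in> auts mod_ar M"
    using homs_id[of mod_ar M M] by (simp add: auts_def isos_def bij_betw_def inj_on_def)
  moreover have "restrict id (univ M) x = x" if "x \<in> univ F" for x
    using that substructureD(3)[OF subFM] by auto
  moreover have "b q = restrict id (univ M) (b q)" using b(1)[OF q] by simp
  ultimately have "b q \<in> galois_type mod_ar M F (b q)" unfolding galois_type_def by blast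
  then have "b q \<in> galois_type mod_ar M F (b p)" by (simp only: same)
  then obtain f where f: "f \<in> auts mod_ar M" "\<And>x. x \<in> univ F \<Longrightarrow> f x = x" "f (b p) = b q"
    unfolding galois_type_def by force
  obtain n where n: "\<And>i. i \<le> n \<Longrightarrow> map p [0..<i] = map q [0..<i]"
      "\<And>i j. j > n \<Longrightarrow> map q [0..<j] \<noteq> map p [0..<i]"
    using branches_meet_finitely[OF \<open>p \<noteq> q\<close>] by blast
  show False
  proof (rule branches_not_conjugate[OF assms(3) dcl _ nzd unstable h[OF p] h[OF q] FM _ _ _
        g(1)[OF p] g(2)[OF p] g(1)[OF q] g(2)[OF q] b(1)[OF p] b(2)[OF p] b(1)[OF q] b(2)[OF q] f])
    show "dcl_qf mod_ar M (univ A \<union> {b'}) = dcl_qf mod_ar M (univ A \<union> {f' b'})"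
      if "RCP_pair mod_ar modules A B b'" "le B M" "f' \<in> auts mod_ar M" "\<And>x. x \<in> univ A \<Longrightarrow> f' x = x"
      for A B b' f'
      using that \<kappa>\<^sub>0\<kappa> mon dcl_aut by blast
    show "s p 0 = s q 0" by (simp add: s_def)
    show "s p i = s q i" if "i \<le> n" for i unfolding s_def n(1)[OF that] ..
    show "s q j \<notin> range (s p)" if "j > n" for j
    proof
      assume "s q j \<in> range (s p)"
      then obtain i where "e (map q [0..<j]) = e (map p [0..<i])" by (auto simp: s_def)
      then have "map q [0..<j] = map p [0..<i]" by (rule inj_onD[OF e(1) _ path[OF q] path[OF p]])
      then show False using n(2)[OF that] by blast
    qed
  qed
qed

end
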